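(* Consider the four-color urn model (white, black, green, yellow) with replacement matrix $$R=\begin{pmatrix} sQ & E\\ 0 & P\end{pmatrix},$$ a stochastic matrix with $2\times2$ blocks, where $0<s<1$ and $P,Q$ are irreducible stochastic matrices; $\boldsymbol\pi_P$ is the stationary distribution (row vector) of $P$; the eigenvalues of $Q$ are $\lambda$ and $1$ with $|\lambda|<1$, and those of $P$ are $\beta$ and $1$ with $|\beta|<1$. Assume $W_0+B_0>0$. Let $\boldsymbol\xi$ be a right eigenvector of $Q$ corresponding to $\lambda$, and put $\boldsymbol v_1=(1,1,0,0)'$ and $\boldsymbol v_2=(\boldsymbol\xi',0,0)'$, which are eigenvectors of $R$ corresponding to $s$ and $s\lambda$ respectively. Suppose that $R$ is not diagonalizable, so that $\beta\in\{s,s\lambda\}$; let $\alpha$ be the other element of $\{s,s\lambda\}$. Let $RT=TJ$ be a Jordan decomposition with $T$ non-singular with columns $\boldsymbol t_1,\boldsymbol t_2,\boldsymbol t_3,\boldsymbol t_4$ and $$J=\begin{pmatrix}\alpha&0&0&0\\0&\beta&1&0\\0&0&\beta&0\\0&0&0&1\end{pmatrix},$$ where $\boldsymbol t_4=(1,1,1,1)'$, and $\boldsymbol t_1$ and $\boldsymbol t_2$ are those of $\boldsymbol v_1,\boldsymbol v_2$ that correspond to $\alpha$ and $\beta$ respectively (so $\boldsymbol t_2=\boldsymbol v_1$ if $\beta=s$, $\boldsymbol t_2=\boldsymbol v_2$ if $\beta=s\lambda$, and $R\boldsymbol t_3=\boldsymbol t_2+\beta\boldsymbol t_3$). Let $\boldsymbol\nu$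 be the two-dimensional vector formed by the lower half (last two coordinates) of $\boldsymbol t_3$ (it is an eigenvector of $P$ corresponding to $\beta$). Then: (i) If $\beta<1/2$, then $\boldsymbol C_n\boldsymbol t_3/\sqrt n\Rightarrow N\left(0,\frac{\beta^2}{1-2\beta}\boldsymbol\pi_P\boldsymbol\nu^2\right)$. (ii) If $\beta\ge1/2$, then $\boldsymbol C_n\boldsymbol t_3/(n^\beta\log n)$ converges to $W$ almost surely, as well as in $L^2$, where $W=U$ when $\beta=s$ and $W=V$ when $\beta=s\lambda$. Here $U$ is the limit (almost surely and in $L^2$) of $\boldsymbol C_n\boldsymbol v_1/n^s$, and $V$ is the limit (almost surely and in $L^2$, existing when $\lambda>1/2$, which is automatic if $\beta=s\lambda\ge1/2$) of $\boldsymbol C_n\boldsymbol v_2/n^{s\lambda}$.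
   Context: Urn model: there are $K$ colors (here $K=4$). $\boldsymbol C_0=(W_0,B_0,G_0,Y_0)$ is a row probability vector (non-negative real coordinates summing to $1$) giving the initial "numbers of balls" of each color, and $R=((r_{ij}))$ is a non-random $K\times K$ stochastic matrix. $\boldsymbol C_n=(W_n,B_n,G_n,Y_n)$ is the row vector of the numbers of balls of each color after the $n$-th trial. At the $n$-th trial a ball is drawn at random, so that, given the past, color $i$ appears with probability $\boldsymbol C_{i,n-1}/n$ (the total after $n-1$ trials is $n$); if color $i$ appears, then for every $j$ the number of balls of color $j$ is increased by $r_{ij}$. Notation: $'$ denotes transpose. For a vector $\boldsymbol\nu$, $\boldsymbol\nu^2$ is the vector of squared coordinates. $\Rightarrow$ denotes convergence in distribution; $N(0,0)$ is the point mass at $0$. *)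

theory Defs
  imports
    "HOL-Probability.Probability"
    "Jordan_Normal_Form.Jordan_Normal_Form"
    "Jordan_Normal_Form.Spectral_Radius"
begin

text \<open>Vectors and matrices are those of \<^theory>\<open>Jordan_Normal_Form.Matrix\<close>; the clashing
  notation of HOL-Analysis is switched off. Indices start at 0, so the colors white, black, green
  and yellow are 0, 1, 2 and 3.\<close>

unbundle no inner_syntax
unbundle no vec_syntax

definition probability_vec :: "nat \<Rightarrow> real vec \<Rightarrow> bool" where
  "probability_vec n v \<longleftrightarrow> v \<in> carrier_vec n \<and> (\<forall>i<n. v $ i \<ge> 0) \<and> (\<Sum>i<n. v $ i) = 1"

definition stochastic_mat :: "nat \<Rightarrow> real mat \<Rightarrow> bool" where
  "stochastic_mat n A \<longleftrightarrow> A \<in> carrier_mat n n \<and> (\<forall>i<n. probability_vec n (row A i))"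

definition irreducible_mat :: "real mat \<Rightarrow> bool" where
  "irreducible_mat A \<longleftrightarrow>
     square_mat A \<and> (\<forall>i<dim_row A. \<forall>j<dim_row A. \<exists>n>0. (A ^\<^sub>m n) $$ (i, j) > 0)"

text \<open>The row vector \<open>v\<close> satisfies \<open>v A = v\<close>.\<close>

definition stationary_distribution :: "real mat \<Rightarrow> real vec \<Rightarrow> bool" where
  "stationary_distribution A v \<longleftrightarrow>
     probability_vec (dim_row A) v \<and> transpose_mat A *\<^sub>v v = v"

definition diagonalizable_mat :: "real mat \<Rightarrow> bool" where
  "diagonalizable_mat A \<longleftrightarrow> (\<exists>D. diagonal_mat D \<and> similar_mat A D)"

text \<open>The urn with \<open>K\<close> colors: \<open>D n\<close> is the color drawn at the \<open>n\<close>-th trial (\<open>n \<ge> 1\<close>), \<open>C n\<close> the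
  vector of numbers of balls after the \<open>n\<close>-th trial, and \<open>F n\<close> the past up to and including the
  \<open>n\<close>-th trial, which may be any filtration containing the information on the draws. The
  value \<open>D 0\<close> is irrelevant.\<close>

locale urn_process = prob_space M + filtration "space M" F
  for M :: "'a measure" and F :: "nat \<Rightarrow> 'a measure" +
  fixes K :: nat and R :: "real mat" and c0 :: "real vec"
    and D :: "nat \<Rightarrow> 'a \<Rightarrow> nat" and C :: "nat \<Rightarrow> 'a \<Rightarrow> real vec"
  assumes subalgebra_F: "subalgebra M (F n)"
    and stochastic_R: "stochastic_mat K R"
    and probability_c0: "probability_vec K c0"
    and adapted_D: "D (Suc n) \<in> measurable (F (Suc n)) (count_space {..<K})"
    and C_0: "\<omega> \<in> space M \<Longrightarrow> C 0 \<omega> = c0"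
    and C_Suc: "\<omega> \<in> space M \<Longrightarrow> C (Suc n) \<omega> = C n \<omega> + row R (D (Suc n) \<omega>)"
    and draw: "i < K \<Longrightarrow> AE \<omega> in M.
      real_cond_exp M (F n) (indicator {\<omega>' \<in> space M. D (Suc n) \<omega>' = i}) \<omega> =
        C n \<omega> $ i / real (Suc n)"

text \<open>The normal distribution with mean \<open>\<mu>\<close> and variance \<open>v \<ge> 0\<close>
  (\<^const>\<open>normal_density\<close> takes the standard deviation).\<close>

definition normal_law :: "real \<Rightarrow> real \<Rightarrow> real measure" where
  "normal_law \<mu> v = (if v = 0 then return borel \<mu>
     else density lborel (\<lambda>x. ennreal (normal_density \<mu> (sqrt v) x)))"

text \<open>Convergence almost surely, as well as in \<open>L\<^sup>2\<close>.\<close>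

definition converges_as_L2 ::
  "'a measure \<Rightarrow> (nat \<Rightarrow> 'a \<Rightarrow> real) \<Rightarrow> ('a \<Rightarrow> real) \<Rightarrow> bool" where
  "converges_as_L2 M X L \<longleftrightarrow>
     L \<in> borel_measurable M \<and> integrable M (\<lambda>\<omega>. (L \<omega>)\<^sup>2) \<and>
     (\<forall>n. X n \<in> borel_measurable M \<and> integrable M (\<lambda>\<omega>. (X n \<omega>)\<^sup>2)) \<and>
     (AE \<omega> in M. (\<lambda>n. X n \<omega>) \<longlonglongrightarrow> L \<omega>) \<and>
     (\<lambda>n. integral\<^sup>L M (\<lambda>\<omega>. (X n \<omega> - L \<omega>)\<^sup>2)) \<longlonglongrightarrow> 0"

end

theory Submission
  imports Defs "HOL-Real_Asymp.Real_Asymp"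
begin

text \<open>Let \<open>R x = \<theta> x + y\<close> and let \<open>a\<^sub>n\<close> be the product of the factors \<open>1 + \<theta>/k\<close> for \<open>1 \<le> k \<le> n\<close>, which
  is asymptotic to a constant times \<open>n\<^sup>\<theta>\<close>. At each trial \<open>C\<^sub>n x\<close> changes by a coordinate of \<open>R x\<close>
  at the drawn color; separating the conditional mean of this coordinate from its deviation,
  the noise, one gets
  \<open>C\<^sub>n x / a\<^sub>n = C\<^sub>0 x + \<Sum> C\<^sub>k y / ((k + 1) a\<^sub>k\<^sub>+\<^sub>1) + \<Sum> noise\<^sub>k / a\<^sub>k\<^sub>+\<^sub>1\<close> with sums over \<open>k < n\<close>
  (lemma \<open>C_prod_decomposition\<close>). The noise consists of bounded martingale differences.

  For the eigenvectors \<open>v\<^sub>1\<close> and \<open>v\<^sub>2\<close> there is no drift. They live on white and black, whose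
  total is of order \<open>n\<^sup>s\<close>, so that their noise has second moments of order \<open>k\<^bsup>s - 1\<^esup>\<close>. Divided
  by \<open>a\<^sub>k\<^sup>2\<close> these are summable for \<open>v\<^sub>1\<close>, and for \<open>v\<^sub>2\<close> if \<open>\<lambda> > 1/2\<close>. A martingale with summable
  second moments of its increments converges almost surely and in mean square
  (\<open>converges_as_L2_sum\<close>, from a maximal inequality); this yields \<open>U\<close> and \<open>V\<close>.

  For \<open>x = t\<^sub>3\<close>, \<open>y = t\<^sub>2\<close> and \<open>\<theta> = \<beta> \<ge> 1/2\<close> the drift is a sum of the convergent quantities
  \<open>C\<^sub>k t\<^sub>2 / a\<^sub>k\<close> with weights \<open>1 / (k + 1 + \<beta>)\<close>. Its order is therefore \<open>ln n\<close>, and its limit on this scale is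
  that of \<open>C\<^sub>k t\<^sub>2 / a\<^sub>k\<close>. The noise is of smaller order by Kronecker's lemma
  (\<open>jordan_chain_converges\<close>).

  For \<open>\<beta> < 1/2\<close> the drift is negligible on the scale \<open>sqrt n\<close>, and a central limit theorem for the
  noise decides (\<open>char_weighted_sums_tendsto\<close>). The squares of the weights
  \<open>a\<^sub>n / (sqrt n a\<^sub>k)\<close> sum up to \<open>1 / (1 - 2 \<beta>)\<close> in the limit. The conditional variance of the noise tends to
  \<open>\<beta>\<^sup>2 \<pi>\<^sub>P \<nu>\<^sup>2\<close>: almost all balls are green or yellow, \<open>\<nu>\<^sup>2\<close> is the combination of \<open>\<nu>\<close> and \<open>(1, 1)\<close> with
  coefficients \<open>\<nu>\<^sub>0 + \<nu>\<^sub>1\<close> and \<open>- \<nu>\<^sub>0 \<nu>\<^sub>1\<close>, and \<open>C\<^sub>n t\<^sub>3 / n\<close> tends to 0; since \<open>\<pi>\<^sub>P \<nu> = 0\<close>, the remaining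
  constant \<open>- \<nu>\<^sub>0 \<nu>\<^sub>1\<close> is \<open>\<pi>\<^sub>P \<nu>\<^sup>2\<close>.\<close>

section \<open>Toeplitz means and products of growth factors\<close>

text \<open>Only finitely many \<open>x k\<close> are far from \<open>l\<close>; their contribution to the weighted sum is
  fixed, while the total weight tends to infinity.\<close>

lemma toeplitz_mean_tendsto:
  fixes w x :: "nat \<Rightarrow> real"
  assumes w: "\<And>k. w k \<ge> 0" and W: "filterlim (\<lambda>n. \<Sum>k<n. w k) at_top sequentially"
    and x: "x \<longlonglongrightarrow> l"
  shows "(\<lambda>n. (\<Sum>k<n. w k * x k) / (\<Sum>k<n. w k)) \<longlonglongrightarrow> l"
proof (rule LIMSEQ_I)
  fix e :: real assume e: "0 < e"
  define W where "W n = (\<Sum>k<n. w k)" for n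
  obtain N where N: "\<And>k. k \<ge> N \<Longrightarrow> \<bar>x k - l\<bar> < e/2"
    using LIMSEQ_D[OF x, of "e/2"] e by auto
  define A where "A = (\<Sum>k<N. w k * \<bar>x k - l\<bar>)"
  have "\<forall>\<^sub>F n in sequentially. W n > max 0 (2 * A / e)"
    using W unfolding filterlim_at_top_dense W_def by blast
  then obtain N' where N': "\<And>n. n \<ge> N' \<Longrightarrow> W n > max 0 (2 * A / e)"
    unfolding eventually_sequentially by blast
  have "norm ((\<Sum>k<n. w k * x k) / W n - l) < e" if n: "n \<ge> max N N'" for n
  proof -
    have Wp: "W n > 0" and WA: "A < e/2 * W n" using N'[of n] n e by (auto simp: field_simps)
    have "(\<Sum>k<n. w k * x k) / W n - l = (\<Sum>k<n. w k * (x k - l)) / W n"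
      using Wp by (simp add: W_def field_simps sum_subtractf sum_distrib_right sum_distrib_left)
    also have "\<bar>\<dots>\<bar> \<le> (\<Sum>k<n. w k * \<bar>x k - l\<bar>) / W n"
      using Wp w by (auto simp: abs_mult intro!: divide_right_mono order_trans[OF sum_abs] sum_mono)
    also have "(\<Sum>k<n. w k * \<bar>x k - l\<bar>) = A + (\<Sum>k\<in>{N..<n}. w k * \<bar>x k - l\<bar>)"
      unfolding A_def using n by (subst sum.atLeastLessThan_concat[of 0 N n, symmetric, unfolded atLeast0LessThan]) auto
    also have "(\<Sum>k\<in>{N..<n}. w k * \<bar>x k - l\<bar>) \<le> (\<Sum>k\<in>{N..<n}. w k * (e/2))"
      using w N by (intro sum_mono mult_left_mono) (auto simp: less_imp_le)
    also have "\<dots> \<le> (\<Sum>k<n. w k * (e/2))"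
      using w e by (intro sum_mono2) auto
    also have "\<dots> = e/2 * W n" by (simp add: W_def sum_distrib_left mult.commute)
    also have "(A + e/2 * W n) / W n < e" using Wp WA by (simp add: field_simps)
    finally show ?thesis using Wp by (simp add: divide_right_mono)
  qed
  then show "\<exists>no. \<forall>n\<ge>no. norm ((\<Sum>k<n. w k * x k) / (\<Sum>k<n. w k) - l) < e"
    unfolding W_def by blast
qed

text \<open>The increments \<open>(k + 1)\<^sup>p - k\<^sup>p\<close> are asymptotic to \<open>p (k + 1)\<^bsup>p - 1\<^esup>\<close> and their sums
  telescope to \<open>n\<^sup>p\<close>, so that they can serve as Toeplitz weights.\<close>

lemma power_sum_tendsto:
  fixes f :: "nat \<Rightarrow> real"
  assumes p: "p > 0" and f: "(\<lambda>k. f k / real (Suc k) powr (p - 1)) \<longlonglongrightarrow> l"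
  shows "(\<lambda>n. (\<Sum>k<n. f k) / real n powr p) \<longlonglongrightarrow> l / p"
proof -
  define w where "w k = real (Suc k) powr p - real k powr p" for k
  have w: "w k > 0" for k using p by (auto simp: w_def intro!: powr_less_mono2)
  have W: "(\<Sum>k<n. w k) = real n powr p" for n
    unfolding w_def by (subst sum_lessThan_telescope) simp
  have "(\<lambda>k. real (Suc k) powr (p - 1) / w k) \<longlonglongrightarrow> 1 / p"
    unfolding w_def using p by (real_asymp simp: field_simps)
  from tendsto_mult[OF f this] have "(\<lambda>k. f k / w k) \<longlonglongrightarrow> l / p"
    by (simp add: field_simps del: of_nat_Suc)
  moreover have "filterlim (\<lambda>n. \<Sum>k<n. w k) at_top sequentially"
    unfolding W using p by real_asymp
  ultimately have "(\<lambda>n. (\<Sum>k<n. w k * (f k / w k)) / (\<Sum>k<n. w k)) \<longlonglongrightarrow> l / p"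
    using w by (intro toeplitz_mean_tendsto) (auto simp: less_imp_le)
  moreover have "w k * (f k / w k) = f k" for k using w[of k] by simp
  ultimately show ?thesis unfolding W by simp
qed

lemma power_sum_bounded:
  fixes c p :: real
  assumes p: "p > 0"
  shows "\<exists>c'\<ge>0. \<forall>n. (\<Sum>k<n. c * real (Suc k) powr (p - 1)) \<le> c' * real n powr p"
proof -
  have "(\<lambda>n. (\<Sum>k<n. c * real (Suc k) powr (p - 1)) / real n powr p) \<longlonglongrightarrow> c / p"
    by (rule power_sum_tendsto[OF p]) simp
  then have "Bseq (\<lambda>n. (\<Sum>k<n. c * real (Suc k) powr (p - 1)) / real n powr p)"
    by (rule convergent_imp_Bseq[OF convergentI])
  then obtain c' where c': "c' > 0"
    "\<And>n. \<bar>(\<Sum>k<n. c * real (Suc k) powr (p - 1)) / real n powr p\<bar> \<le> c'"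
    by (auto elim!: BseqE)
  have "(\<Sum>k<n. c * real (Suc k) powr (p - 1)) \<le> c' * real n powr p" for n
  proof (cases "n = 0")
    case False
    then show ?thesis using abs_le_D1[OF c'(2)[of n]] by (simp add: divide_le_eq)
  qed simp
  with c'(1) show ?thesis by (intro exI[of _ c']) auto
qed

text \<open>If \<open>R x = \<theta> x\<close>, the mean of \<open>C n \<bullet> x\<close> is multiplied by \<open>1 + \<theta> / n\<close> at the \<open>n\<close>-th trial;
  \<open>growth \<theta> n\<close> is the accumulated factor.\<close>

definition growth :: "real \<Rightarrow> nat \<Rightarrow> real" where
  "growth \<theta> n = (\<Prod>k<n. 1 + \<theta> / real (Suc k))"

lemma growth_0 [simp]: "growth \<theta> 0 = 1"
  and growth_Suc: "growth \<theta> (Suc n) = growth \<theta> n * (1 + \<theta> / real (Suc n))"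
  by (simp_all add: growth_def)

lemma growth_pos:
  assumes "\<theta> > -1" shows "growth \<theta> n > 0"
proof -
  have "1 + \<theta> / real (Suc k) > 0" for k
    using assms by (simp add: field_simps)
  then show ?thesis unfolding growth_def by (intro prod_pos) auto
qed

lemma growth_eq_pochhammer: "growth \<theta> n = pochhammer (\<theta> + 1) n / fact n"
proof (induction n)
  case (Suc n)
  have "growth \<theta> (Suc n) = growth \<theta> n * (\<theta> + 1 + real n) / real (Suc n)"
    by (simp add: growth_Suc field_simps)
  with Suc show ?case by (simp add: pochhammer_rec' mult_ac)
qed simp

text \<open>The product is, up to an index shift, the one in the limit formula of Gauss for the reciprocal
  of the Gamma function: that formula has one factor more, which is compensated by
  \<open>n / (n + \<theta> + 1)\<close>. The limit is \<open>1 / \<Gamma>(\<theta> + 1)\<close>.\<close>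

lemma growth_asymptotics:
  assumes "\<theta> > -1"
  shows "\<exists>g>0. (\<lambda>n. growth \<theta> n / real n powr \<theta>) \<longlonglongrightarrow> g"
proof (intro exI conjI)
  show "rGamma (\<theta> + 1) > 0" using assms Gamma_real_pos[of "\<theta>+1"] by (simp add: rGamma_inverse_Gamma)
  have "(\<lambda>n. rGamma_series (\<theta> + 1) n * (real n / (real n + \<theta> + 1))) \<longlonglongrightarrow> rGamma (\<theta> + 1) * 1"
    by (intro tendsto_mult rGamma_series_LIMSEQ) real_asymp
  moreover have "\<forall>\<^sub>F n in sequentially.
      rGamma_series (\<theta> + 1) n * (real n / (real n + \<theta> + 1)) = growth \<theta> n / real n powr \<theta>"
    using eventually_gt_at_top[of 0]
  proof eventually_elim
    case (elim n)
    have "exp ((\<theta> + 1) * ln (real n)) = real n powr \<theta> * real n"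
      using elim by (simp add: powr_def exp_add algebra_simps)
    then have "rGamma_series (\<theta> + 1) n = growth \<theta> n * (real n + \<theta> + 1) / (real n powr \<theta> * real n)"
      by (simp add: rGamma_series_def growth_eq_pochhammer pochhammer_rec' field_simps)
    moreover have "real n + \<theta> + 1 > 0" using assms by simp
    ultimately show ?case using elim by simp
  qed
  ultimately show "(\<lambda>n. growth \<theta> n / real n powr \<theta>) \<longlonglongrightarrow> rGamma (\<theta> + 1)"
    by (auto dest: Lim_transform_eventually)
qed

lemma growth_bounds:
  assumes "\<theta> > -1"
  shows "\<exists>c>0. \<forall>n>0. growth \<theta> n \<le> c * real n powr \<theta> \<and> 1 / growth \<theta> n \<le> c * real n powr (-\<theta>)"
proof -
  obtain g where g: "g > 0" "(\<lambda>n. growth \<theta> n / real n powr \<theta>) \<longlonglongrightarrow> g"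
    using growth_asymptotics[OF assms] by blast
  have "(\<lambda>n. inverse (growth \<theta> n / real n powr \<theta>)) \<longlonglongrightarrow> inverse g"
    using g by (intro tendsto_inverse) auto
  then have "Bseq (\<lambda>n. inverse (growth \<theta> n / real n powr \<theta>))"
    by (rule convergent_imp_Bseq[OF convergentI])
  then obtain c1 where c1: "c1 > 0" "\<And>n. \<bar>inverse (growth \<theta> n / real n powr \<theta>)\<bar> \<le> c1"
    by (auto elim!: BseqE)
  have "Bseq (\<lambda>n. growth \<theta> n / real n powr \<theta>)"
    using g by (intro convergent_imp_Bseq[OF convergentI])
  then obtain c2 where c2: "c2 > 0" "\<And>n. \<bar>growth \<theta> n / real n powr \<theta>\<bar> \<le> c2"
    by (auto elim!: BseqE)
  show ?thesis
  proof (intro exI[of _ "max c1 c2"] conjI allI impI)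
    fix n :: nat assume n: "n > 0"
    have "growth \<theta> n \<le> c2 * real n powr \<theta>"
      using abs_le_D1[OF c2(2)[of n]] n by (simp add: divide_le_eq)
    also have "\<dots> \<le> max c1 c2 * real n powr \<theta>" by (intro mult_right_mono) auto
    finally show "growth \<theta> n \<le> max c1 c2 * real n powr \<theta>" .
    have "1 / growth \<theta> n \<le> c1 * real n powr (-\<theta>)"
      using abs_le_D1[OF c1(2)[of n]] n growth_pos[OF assms, of n]
      by (simp add: powr_minus field_simps)
    also have "\<dots> \<le> max c1 c2 * real n powr (-\<theta>)" by (intro mult_right_mono) auto
    finally show "1 / growth \<theta> n \<le> max c1 c2 * real n powr (-\<theta>)" .
  qed (use c1 in auto)
qed

text \<open>For \<open>\<theta> \<ge> 0\<close> the factors are at least 1, for \<open>\<theta> < 0\<close> they decrease. The bound does not depend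
  on \<open>k\<close>, which makes the weights in the central limit theorem uniformly small.\<close>

lemma growth_ratio_le:
  assumes \<theta>: "\<theta> > -1" and "k \<le> n"
  shows "growth \<theta> n / growth \<theta> k \<le> max 1 (growth \<theta> n)"
proof (cases "\<theta> \<ge> 0")
  case True
  have "growth \<theta> k \<ge> 1" unfolding growth_def using True by (intro prod_ge_1) auto
  then show ?thesis
    using growth_pos[OF \<theta>, of n] by (simp add: divide_le_eq max_def mult_left_le_one_le)
next
  case False
  have "growth \<theta> n \<le> growth \<theta> k"
    using \<open>k \<le> n\<close>
  proof (induction n rule: dec_induct)
    case (step n)
    have "growth \<theta> (Suc n) \<le> growth \<theta> n * 1"
      unfolding growth_Suc using False growth_pos[OF \<theta>, of n]
      by (intro mult_left_mono) (auto simp: divide_nonpos_pos)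
    with step show ?case by simp
  qed simp
  then show ?thesis using growth_pos[OF \<theta>, of k] by (simp add: divide_le_eq max_def)
qed

text \<open>The terms are comparable with the differences of \<open>1 / ln\<close>, which telescope.\<close>

lemma summable_inverse_square_log:
  "summable (\<lambda>k. 1 / (real (Suc k) * (ln (real (k + 2)))\<^sup>2))"
proof (rule summable_comparison_test_bigo)
  define h where "h k = 1 / ln (real (k + 2))" for k
  have "h \<longlonglongrightarrow> 0" unfolding h_def by real_asymp
  then have s: "summable (\<lambda>k. h k - h (Suc k))"
    by (rule telescope_summable')
  moreover have "h k - h (Suc k) \<ge> 0" for k
    unfolding h_def by (simp add: divide_left_mono)
  ultimately show "summable (\<lambda>k. norm (h k - h (Suc k)))" by simp
  show "(\<lambda>k. 1 / (real (Suc k) * (ln (real (k + 2)))\<^sup>2)) \<in> O(\<lambda>k. h k - h (Suc k))"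
    unfolding h_def by real_asymp
qed

section \<open>Almost sure and mean square convergence\<close>

text \<open>Linear combinations, deterministic factors and Toeplitz means are treated once for
  both modes of convergence together. The limit theorems for the urn then follow from the
  convergence of a martingale by deterministic manipulations, without a separate estimate in
  mean square.\<close>

lemma square_sum_le: "(x + y)\<^sup>2 \<le> 2 * x\<^sup>2 + 2 * y\<^sup>2" for x y :: real
  using zero_le_power2[of "x - y"] by (simp add: power2_eq_square algebra_simps)

lemma integrable_square_add:
  fixes f g :: "'a \<Rightarrow> real"
  assumes [measurable]: "f \<in> borel_measurable M" "g \<in> borel_measurable M"
    and "integrable M (\<lambda>\<omega>. (f \<omega>)\<^sup>2)" "integrable M (\<lambda>\<omega>. (g \<omega>)\<^sup>2)"
  shows "integrable M (\<lambda>\<omega>. (f \<omega> + g \<omega>)\<^sup>2)"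
proof (rule Bochner_Integration.integrable_bound)
  show "integrable M (\<lambda>\<omega>. 2 * (f \<omega>)\<^sup>2 + 2 * (g \<omega>)\<^sup>2)" using assms by auto
  show "AE \<omega> in M. norm ((f \<omega> + g \<omega>)\<^sup>2) \<le> norm (2 * (f \<omega>)\<^sup>2 + 2 * (g \<omega>)\<^sup>2)"
    using square_sum_le by auto
qed measurable

lemma integral_square_add_le:
  fixes f g :: "'a \<Rightarrow> real"
  assumes "f \<in> borel_measurable M" "g \<in> borel_measurable M"
    and "integrable M (\<lambda>\<omega>. (f \<omega>)\<^sup>2)" "integrable M (\<lambda>\<omega>. (g \<omega>)\<^sup>2)"
  shows "integral\<^sup>L M (\<lambda>\<omega>. (f \<omega> + g \<omega>)\<^sup>2) \<le>
    2 * integral\<^sup>L M (\<lambda>\<omega>. (f \<omega>)\<^sup>2) + 2 * integral\<^sup>L M (\<lambda>\<omega>. (g \<omega>)\<^sup>2)"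
proof -
  have "integral\<^sup>L M (\<lambda>\<omega>. (f \<omega> + g \<omega>)\<^sup>2) \<le> integral\<^sup>L M (\<lambda>\<omega>. 2 * (f \<omega>)\<^sup>2 + 2 * (g \<omega>)\<^sup>2)"
    using assms integrable_square_add[OF assms] by (intro integral_mono) (auto intro: square_sum_le)
  then show ?thesis using assms by simp
qed

lemma integrable_square_diff:
  fixes f g :: "'a \<Rightarrow> real"
  assumes "f \<in> borel_measurable M" "g \<in> borel_measurable M"
    and "integrable M (\<lambda>\<omega>. (f \<omega>)\<^sup>2)" "integrable M (\<lambda>\<omega>. (g \<omega>)\<^sup>2)"
  shows "integrable M (\<lambda>\<omega>. (f \<omega> - g \<omega>)\<^sup>2)"
  using integrable_square_add[of f M "\<lambda>\<omega>. - g \<omega>"] assms by simp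

abbreviation square_dist :: "'a measure \<Rightarrow> ('a \<Rightarrow> real) \<Rightarrow> ('a \<Rightarrow> real) \<Rightarrow> real" where
  "square_dist M f g \<equiv> integral\<^sup>L M (\<lambda>\<omega>. (f \<omega> - g \<omega>)\<^sup>2)"

lemma converges_as_L2_AE:
  "converges_as_L2 M X L \<Longrightarrow> AE \<omega> in M. (\<lambda>n. X n \<omega>) \<longlonglongrightarrow> L \<omega>"
  by (simp add: converges_as_L2_def)

lemma converges_as_L2_cong:
  assumes "\<And>n \<omega>. \<omega> \<in> space M \<Longrightarrow> X n \<omega> = Y n \<omega>"
  shows "converges_as_L2 M X L \<longleftrightarrow> converges_as_L2 M Y L"
proof -
  have "(X n \<in> borel_measurable M) = (Y n \<in> borel_measurable M)"
    and "integrable M (\<lambda>\<omega>. (X n \<omega>)\<^sup>2) = integrable M (\<lambda>\<omega>. (Y n \<omega>)\<^sup>2)"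
    and "square_dist M (X n) L = square_dist M (Y n) L" for n
    using assms by (auto intro!: measurable_cong Bochner_Integration.integrable_cong
        Bochner_Integration.integral_cong)
  moreover have "(AE \<omega> in M. (\<lambda>n. X n \<omega>) \<longlonglongrightarrow> L \<omega>) = (AE \<omega> in M. (\<lambda>n. Y n \<omega>) \<longlonglongrightarrow> L \<omega>)"
    using assms by (intro AE_cong) simp
  ultimately show ?thesis unfolding converges_as_L2_def by simp
qed

lemma converges_as_L2_add:
  assumes X: "converges_as_L2 M X L" and Y: "converges_as_L2 M Y L'"
  shows "converges_as_L2 M (\<lambda>n \<omega>. X n \<omega> + Y n \<omega>) (\<lambda>\<omega>. L \<omega> + L' \<omega>)"
proof -
  note x = X[unfolded converges_as_L2_def] and y = Y[unfolded converges_as_L2_def]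
  have "(\<lambda>n. integral\<^sup>L M (\<lambda>\<omega>. ((X n \<omega> + Y n \<omega>) - (L \<omega> + L' \<omega>))\<^sup>2)) \<longlonglongrightarrow> 0"
  proof (rule tendsto_sandwich[OF _ _ tendsto_const])
    have "(\<lambda>n. 2 * square_dist M (X n) L + 2 * square_dist M (Y n) L')
        \<longlonglongrightarrow> 2 * 0 + 2 * 0"
      using x y by (intro tendsto_intros) auto
    then show "(\<lambda>n. 2 * square_dist M (X n) L + 2 * square_dist M (Y n) L')
        \<longlonglongrightarrow> 0" by simp
    have "integral\<^sup>L M (\<lambda>\<omega>. ((X n \<omega> - L \<omega>) + (Y n \<omega> - L' \<omega>))\<^sup>2)
       \<le> 2 * square_dist M (X n) L + 2 * square_dist M (Y n) L'" for n
      using x y by (intro integral_square_add_le integrable_square_diff borel_measurable_diff) auto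
    then show "\<forall>\<^sub>F n in sequentially. integral\<^sup>L M (\<lambda>\<omega>. ((X n \<omega> + Y n \<omega>) - (L \<omega> + L' \<omega>))\<^sup>2)
       \<le> 2 * square_dist M (X n) L + 2 * square_dist M (Y n) L'"
      by (simp add: algebra_simps)
  qed auto
  moreover have "AE \<omega> in M. (\<lambda>n. X n \<omega> + Y n \<omega>) \<longlonglongrightarrow> L \<omega> + L' \<omega>"
    using converges_as_L2_AE[OF X] converges_as_L2_AE[OF Y]
    by eventually_elim (rule tendsto_add)
  ultimately show ?thesis
    unfolding converges_as_L2_def using x y by (auto intro!: integrable_square_add borel_measurable_add)
qed

lemma converges_as_L2_scale:
  assumes X: "converges_as_L2 M X L" and c: "c \<longlonglongrightarrow> l"
  shows "converges_as_L2 M (\<lambda>n \<omega>. c n * X n \<omega>) (\<lambda>\<omega>. l * L \<omega>)"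
proof -
  note x = X[unfolded converges_as_L2_def]
  let ?E = "integral\<^sup>L M"
  have "(\<lambda>n. ?E (\<lambda>\<omega>. (c n * X n \<omega> - l * L \<omega>)\<^sup>2)) \<longlonglongrightarrow> 0"
  proof (rule tendsto_sandwich[OF _ _ tendsto_const])
    let ?b = "\<lambda>n. 2 * ((c n)\<^sup>2 * square_dist M (X n) L) + 2 * ((c n - l)\<^sup>2 * ?E (\<lambda>\<omega>. (L \<omega>)\<^sup>2))"
    have "?b \<longlonglongrightarrow> 2 * (l\<^sup>2 * 0) + 2 * ((l - l)\<^sup>2 * ?E (\<lambda>\<omega>. (L \<omega>)\<^sup>2))"
      using x c by (intro tendsto_intros) auto
    then show "?b \<longlonglongrightarrow> 0" by simp
    have "?E (\<lambda>\<omega>. (c n * (X n \<omega> - L \<omega>) + (c n - l) * L \<omega>)\<^sup>2)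
       \<le> 2 * ?E (\<lambda>\<omega>. (c n * (X n \<omega> - L \<omega>))\<^sup>2) + 2 * ?E (\<lambda>\<omega>. ((c n - l) * L \<omega>)\<^sup>2)" for n
      using x integrable_square_diff[of "X n" M L]
      by (intro integral_square_add_le borel_measurable_times borel_measurable_diff borel_measurable_const)
        (auto simp: power_mult_distrib)
    moreover have "c n * (X n \<omega> - L \<omega>) + (c n - l) * L \<omega> = c n * X n \<omega> - l * L \<omega>" for n \<omega>
      by (simp add: algebra_simps)
    ultimately show "\<forall>\<^sub>F n in sequentially. ?E (\<lambda>\<omega>. (c n * X n \<omega> - l * L \<omega>)\<^sup>2) \<le> ?b n"
      by (simp add: power_mult_distrib)
  qed auto
  moreover have "AE \<omega> in M. (\<lambda>n. c n * X n \<omega>) \<longlonglongrightarrow> l * L \<omega>"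
    using converges_as_L2_AE[OF X]
    by eventually_elim (intro tendsto_mult c)
  ultimately show ?thesis
    unfolding converges_as_L2_def using x by (auto simp: power_mult_distrib intro!: borel_measurable_times)
qed

lemma converges_as_L2_Suc:
  assumes "converges_as_L2 M X L"
  shows "converges_as_L2 M (\<lambda>n. X (Suc n)) L"
proof -
  note x = assms[unfolded converges_as_L2_def]
  have "AE \<omega> in M. (\<lambda>n. X (Suc n) \<omega>) \<longlonglongrightarrow> L \<omega>"
    using converges_as_L2_AE[OF assms]
    by eventually_elim (rule LIMSEQ_Suc)
  moreover have "(\<lambda>n. square_dist M (X (Suc n)) L) \<longlonglongrightarrow> 0"
    using x by (intro LIMSEQ_Suc[of "\<lambda>n. square_dist M (X n) L"]) auto
  ultimately show ?thesis unfolding converges_as_L2_def using x by auto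
qed

lemma (in prob_space) converges_as_L2_const:
  assumes "c \<longlonglongrightarrow> l"
  shows "converges_as_L2 M (\<lambda>n \<omega>. c n) (\<lambda>\<omega>. l)"
proof -
  have "(\<lambda>n. (c n - l)\<^sup>2) \<longlonglongrightarrow> (l - l)\<^sup>2" using assms by (intro tendsto_intros)
  then show ?thesis using assms by (simp add: converges_as_L2_def prob_space)
qed

lemma square_weighted_sum_le:
  fixes w y :: "nat \<Rightarrow> real"
  assumes w: "\<And>k. k \<in> A \<Longrightarrow> w k \<ge> 0"
  shows "(\<Sum>k\<in>A. w k * y k)\<^sup>2 \<le> (\<Sum>k\<in>A. w k) * (\<Sum>k\<in>A. w k * (y k)\<^sup>2)"
proof -
  have "(\<Sum>k\<in>A. w k * y k) = (\<Sum>k\<in>A. sqrt (w k) * (sqrt (w k) * y k))"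
    using w by (intro sum.cong) (auto simp flip: mult.assoc)
  also have "(\<Sum>k\<in>A. sqrt (w k) * (sqrt (w k) * y k))\<^sup>2 \<le>
      (\<Sum>k\<in>A. (sqrt (w k))\<^sup>2) * (\<Sum>k\<in>A. (sqrt (w k) * y k)\<^sup>2)"
    by (rule Cauchy_Schwarz_ineq_sum)
  finally show ?thesis using w by (simp add: power_mult_distrib)
qed

text \<open>By the Cauchy-Schwarz inequality the square of a weighted mean is at most the weighted mean of
  the squares. Hence the mean square error is bounded by a Toeplitz mean of the mean square
  errors of the terms.\<close>

lemma converges_as_L2_toeplitz:
  fixes w :: "nat \<Rightarrow> real"
  assumes X: "converges_as_L2 M X L"
    and w: "\<And>k. w k \<ge> 0" and W: "filterlim (\<lambda>n. \<Sum>k<n. w k) at_top sequentially"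
  shows "converges_as_L2 M (\<lambda>n \<omega>. (\<Sum>k<n. w k * X k \<omega>) / (\<Sum>k<n. w k)) L"
proof -
  note x = X[unfolded converges_as_L2_def]
  let ?E = "integral\<^sup>L M"
  define W' where "W' n = (\<Sum>k<n. w k)" for n
  have W0: "W' n \<ge> 0" for n using w by (simp add: W'_def sum_nonneg)
  have D: "integrable M (\<lambda>\<omega>. (X k \<omega> - L \<omega>)\<^sup>2)" for k
    using x by (intro integrable_square_diff) auto
  have mb[measurable]: "X k \<in> borel_measurable M" "L \<in> borel_measurable M" for k using x by auto
  have sq: "integrable M (\<lambda>\<omega>. (\<Sum>k<n. w k * X k \<omega>)\<^sup>2)" for n
  proof (rule Bochner_Integration.integrable_bound)
    show "integrable M (\<lambda>\<omega>. W' n * (\<Sum>k<n. w k * (X k \<omega>)\<^sup>2))" using x by auto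
    show "AE \<omega> in M. norm ((\<Sum>k<n. w k * X k \<omega>)\<^sup>2) \<le> norm (W' n * (\<Sum>k<n. w k * (X k \<omega>)\<^sup>2))"
      using w W0 by (auto simp: W'_def intro!: order_trans[OF square_weighted_sum_le] AE_I2)
  qed measurable
  have le: "?E (\<lambda>\<omega>. ((\<Sum>k<n. w k * X k \<omega>) / W' n - L \<omega>)\<^sup>2) \<le>
      (\<Sum>k<n. w k * square_dist M (X k) L) / W' n" if "W' n > 0" for n
  proof -
    have "((\<Sum>k<n. w k * X k \<omega>) / W' n - L \<omega>)\<^sup>2 \<le> (\<Sum>k<n. w k * (X k \<omega> - L \<omega>)\<^sup>2) / W' n" for \<omega>
    proof -
      have "(\<Sum>k<n. w k * X k \<omega>) / W' n - L \<omega> = (\<Sum>k<n. w k * (X k \<omega> - L \<omega>)) / W' n"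
        using that by (simp add: W'_def field_simps sum_subtractf sum_distrib_right sum_distrib_left)
      also have "\<dots>\<^sup>2 \<le> (W' n * (\<Sum>k<n. w k * (X k \<omega> - L \<omega>)\<^sup>2)) / (W' n)\<^sup>2"
        unfolding power_divide W'_def by (intro divide_right_mono square_weighted_sum_le w) auto
      also have "\<dots> = (\<Sum>k<n. w k * (X k \<omega> - L \<omega>)\<^sup>2) / W' n"
        using that by (simp add: power2_eq_square)
      finally show ?thesis .
    qed
    then have "?E (\<lambda>\<omega>. ((\<Sum>k<n. w k * X k \<omega>) / W' n - L \<omega>)\<^sup>2) \<le>
        ?E (\<lambda>\<omega>. (\<Sum>k<n. w k * (X k \<omega> - L \<omega>)\<^sup>2) / W' n)"
      using D x sq by (intro integral_mono integrable_square_diff) (auto simp: power_divide)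
    also have "\<dots> = (\<Sum>k<n. w k * square_dist M (X k) L) / W' n"
      using D by simp
    finally show ?thesis .
  qed
  have "(\<lambda>n. ?E (\<lambda>\<omega>. ((\<Sum>k<n. w k * X k \<omega>) / W' n - L \<omega>)\<^sup>2)) \<longlonglongrightarrow> 0"
  proof (rule tendsto_sandwich[OF _ _ tendsto_const])
    show "(\<lambda>n. (\<Sum>k<n. w k * square_dist M (X k) L) / W' n) \<longlonglongrightarrow> 0"
      unfolding W'_def using x by (intro toeplitz_mean_tendsto w W) auto
    have "\<forall>\<^sub>F n in sequentially. W' n > 0"
      using W unfolding filterlim_at_top_dense W'_def by blast
    then show "\<forall>\<^sub>F n in sequentially. ?E (\<lambda>\<omega>. ((\<Sum>k<n. w k * X k \<omega>) / W' n - L \<omega>)\<^sup>2)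
       \<le> (\<Sum>k<n. w k * square_dist M (X k) L) / W' n"
      by eventually_elim (rule le)
  qed auto
  moreover have "AE \<omega> in M. (\<lambda>n. (\<Sum>k<n. w k * X k \<omega>) / (\<Sum>k<n. w k)) \<longlonglongrightarrow> L \<omega>"
    using converges_as_L2_AE[OF X]
    by eventually_elim (rule toeplitz_mean_tendsto[OF w W])
  ultimately show ?thesis
    unfolding converges_as_L2_def W'_def using sq x by (auto simp: power_divide)
qed

text \<open>Kronecker's lemma. Summation by parts writes the sum of the \<open>Y k\<close> as \<open>h n\<close> times the
  partial sum of the \<open>Y k / h k\<close> minus \<open>h n - h 0\<close> times a Toeplitz mean of such partial sums;
  after division by \<open>h n\<close> both terms have the same limit.\<close>

lemma converges_as_L2_kronecker:
  fixes h :: "nat \<Rightarrow> real" and Y :: "nat \<Rightarrow> 'a \<Rightarrow> real"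
  assumes X: "converges_as_L2 M (\<lambda>n \<omega>. \<Sum>k<n. Y k \<omega> / h k) L"
    and h: "incseq h" "\<And>k. h k > 0" "filterlim h at_top sequentially"
  shows "converges_as_L2 M (\<lambda>n \<omega>. (\<Sum>k<n. Y k \<omega>) / h n) (\<lambda>\<omega>. 0)"
proof -
  define S where "S n \<omega> = (\<Sum>k<n. Y k \<omega> / h k)" for n \<omega>
  define w where "w k = h (Suc k) - h k" for k
  have W: "(\<Sum>k<n. w k) = h n - h 0" for n unfolding w_def by (rule sum_lessThan_telescope)
  have WF: "filterlim (\<lambda>n. \<Sum>k<n. w k) at_top sequentially"
    unfolding W using filterlim_tendsto_add_at_top[OF tendsto_const h(3), of "- h 0"] by simp
  have hn: "\<forall>\<^sub>F n in sequentially. h n > h 0"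
    using h(3) unfolding filterlim_at_top_dense by blast
  have "(\<lambda>n. h 0 / h n) \<longlonglongrightarrow> 0"
    by (intro tendsto_divide_0[OF tendsto_const] filterlim_at_top_imp_at_infinity h(3))
  then have "(\<lambda>n. -1 * (1 - h 0 / h n)) \<longlonglongrightarrow> -1 * (1 - 0)" by (intro tendsto_intros)
  then have c: "(\<lambda>n. - ((h n - h 0) / h n)) \<longlonglongrightarrow> -1"
    using h(2) by (simp add: diff_divide_distrib less_imp_neq[symmetric])
  have "converges_as_L2 M (\<lambda>n \<omega>. (\<Sum>k<n. w k * S (Suc k) \<omega>) / (\<Sum>k<n. w k)) L"
    using h(1) converges_as_L2_Suc[OF X] unfolding S_def
    by (intro converges_as_L2_toeplitz WF) (auto simp: w_def incseq_SucD)
  from converges_as_L2_scale[OF this c] X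
  have "converges_as_L2 M (\<lambda>n \<omega>. S n \<omega> + - ((h n - h 0) / h n) * ((\<Sum>k<n. w k * S (Suc k) \<omega>) / (h n - h 0)))
     (\<lambda>\<omega>. L \<omega> + -1 * L \<omega>)"
    unfolding W S_def by (intro converges_as_L2_add)
  also have "?this = converges_as_L2 M (\<lambda>n \<omega>. (\<Sum>k<n. Y k \<omega>) / h n) (\<lambda>\<omega>. L \<omega> + -1 * L \<omega>)"
  proof (rule converges_as_L2_cong)
    fix n \<omega>
    have abel: "(\<Sum>k<n. Y k \<omega>) = h n * S n \<omega> - (\<Sum>k<n. w k * S (Suc k) \<omega>)"
    proof (induction n)
      case (Suc n)
      have "S (Suc n) \<omega> = S n \<omega> + Y n \<omega> / h n" by (simp add: S_def)
      then have "Y n \<omega> = h n * S (Suc n) \<omega> - h n * S n \<omega>" using h(2)[of n] by (simp add: field_simps)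
      with Suc show ?case by (simp add: w_def algebra_simps)
    qed (simp add: S_def)
    have "(\<Sum>k<n. w k * S (Suc k) \<omega>) = 0" if "h n = h 0"
    proof -
      have "w k = 0" if "k < n" for k
        using \<open>h n = h 0\<close> that incseqD[OF h(1), of 0 k] incseqD[OF h(1), of "Suc k" n]
          incseqD[OF h(1), of k "Suc k"] by (simp add: w_def)
      then show ?thesis by simp
    qed
    then show "S n \<omega> + - ((h n - h 0) / h n) * ((\<Sum>k<n. w k * S (Suc k) \<omega>) / (h n - h 0)) =
        (\<Sum>k<n. Y k \<omega>) / h n"
      unfolding abel using h(2)[of n] by (cases "h n = h 0") (auto simp: field_simps)
  qed
  finally show ?thesis by simp
qed

section \<open>Weighted sums of bounded martingale differences\<close>

lemma (in prob_space) integrable_bounded: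
  fixes f :: "'a \<Rightarrow> 'b :: {banach, second_countable_topology}"
  assumes "f \<in> borel_measurable M" "\<And>\<omega>. \<omega> \<in> space M \<Longrightarrow> norm (f \<omega>) \<le> B"
  shows "integrable M f"
  using assms by (intro integrable_const_bound[of f B]) auto

lemma (in prob_space) integral_norm_le:
  fixes f :: "'a \<Rightarrow> 'b :: {banach, second_countable_topology}"
  assumes "f \<in> borel_measurable M" "\<And>\<omega>. \<omega> \<in> space M \<Longrightarrow> norm (f \<omega>) \<le> B"
  shows "norm (integral\<^sup>L M f) \<le> B"
proof -
  have "norm (integral\<^sup>L M f) \<le> integral\<^sup>L M (\<lambda>\<omega>. norm (f \<omega>))" by (rule integral_norm_bound)
  also have "\<dots> \<le> integral\<^sup>L M (\<lambda>\<omega>. B)"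
    using assms by (intro integral_mono integrable_norm integrable_bounded[of f B]) auto
  also have "\<dots> = B" by (simp add: prob_space)
  finally show ?thesis .
qed

abbreviation (in prob_space) second_moment :: "('a \<Rightarrow> real) \<Rightarrow> real" where
  "second_moment f \<equiv> expectation (\<lambda>\<omega>. (f \<omega>)\<^sup>2)"

lemma abs_mult_le: "\<bar>x\<bar> \<le> a \<Longrightarrow> \<bar>y\<bar> \<le> c \<Longrightarrow> \<bar>x * y\<bar> \<le> a * c" for x y :: real
  unfolding abs_mult by (intro mult_mono) auto

lemma norm_square_le: "\<bar>x\<bar> \<le> a \<Longrightarrow> norm (x\<^sup>2) \<le> a\<^sup>2" for x :: real
  using power_mono[of "\<bar>x\<bar>" a 2] by simp

lemma (in prob_space) integrable_square_bounded:
  fixes f :: "'a \<Rightarrow> real"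
  assumes "f \<in> borel_measurable M" "\<And>\<omega>. \<omega> \<in> space M \<Longrightarrow> \<bar>f \<omega>\<bar> \<le> B"
  shows "integrable M (\<lambda>\<omega>. (f \<omega>)\<^sup>2)"
  using assms by (intro integrable_bounded[of _ "B\<^sup>2"] norm_square_le) auto

text \<open>The martingale property is expressed as orthogonality to the bounded functions of the past.
  The difference \<open>d n\<close> becomes known at time \<open>n + 1\<close>, so that weights that are
  \<open>F n\<close>-measurable are predictable.\<close>

locale bounded_martingale_differences = prob_space M + filtration "space M" F
  for M :: "'a measure" and F :: "nat \<Rightarrow> 'a measure" +
  fixes d :: "nat \<Rightarrow> 'a \<Rightarrow> real" and b :: real
  assumes subalgebra: "subalgebra M (F n)"
    and adapted: "d n \<in> borel_measurable (F (Suc n))"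
    and bounded: "\<omega> \<in> space M \<Longrightarrow> \<bar>d n \<omega>\<bar> \<le> b"
    and orthogonal: "\<And>n Z B. Z \<in> borel_measurable (F n) \<Longrightarrow>
      (\<And>\<omega>. \<omega> \<in> space M \<Longrightarrow> \<bar>Z \<omega>\<bar> \<le> B) \<Longrightarrow> expectation (\<lambda>\<omega>. Z \<omega> * d n \<omega>) = 0"
begin

lemma b_nonneg: "b \<ge> 0"
proof -
  obtain \<omega> where "\<omega> \<in> space M" using not_empty by blast
  from bounded[OF this, of 0] show ?thesis by linarith
qed

lemma measurable_F_mono:
  "f \<in> borel_measurable (F m) \<Longrightarrow> m \<le> n \<Longrightarrow> f \<in> borel_measurable (F n)"
  by (rule measurable_from_subalg[rotated]) (use sets_F_mono in \<open>auto simp: subalgebra_def space_F\<close>)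

lemma measurable_F_M: "f \<in> borel_measurable (F n) \<Longrightarrow> f \<in> borel_measurable M"
  by (rule measurable_from_subalg[OF subalgebra])

lemma d_measurable [measurable]: "d n \<in> borel_measurable M"
  by (rule measurable_F_M[OF adapted])

lemma weighted_sum_measurable:
  assumes "\<And>k. H k \<in> borel_measurable (F k)"
  shows "(\<lambda>\<omega>. \<Sum>k<n. H k \<omega> * d k \<omega>) \<in> borel_measurable (F n)"
proof (intro borel_measurable_sum borel_measurable_times)
  fix k assume "k \<in> {..<n}"
  then show "H k \<in> borel_measurable (F n)" "d k \<in> borel_measurable (F n)"
    using measurable_F_mono[OF assms] measurable_F_mono[OF adapted] by auto
qed

lemma weighted_sum_bounded:
  assumes "\<And>k \<omega>. \<omega> \<in> space M \<Longrightarrow> \<bar>H k \<omega>\<bar> \<le> h k" "\<omega> \<in> space M"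
  shows "\<bar>\<Sum>k<n. H k \<omega> * d k \<omega>\<bar> \<le> (\<Sum>k<n. h k * b)"
proof (rule order_trans[OF sum_abs sum_mono])
  fix k
  show "\<bar>H k \<omega> * d k \<omega>\<bar> \<le> h k * b"
    using assms bounded[OF assms(2)] by (intro abs_mult_le)
qed

text \<open>The weights may depend on the past: stopping a sum amounts to replacing weights by 0, which is
  how the maximal inequality uses this identity.\<close>

lemma weighted_sum_second_moment:
  assumes H: "\<And>k. H k \<in> borel_measurable (F k)"
    and h: "\<And>k \<omega>. \<omega> \<in> space M \<Longrightarrow> \<bar>H k \<omega>\<bar> \<le> h k"
  shows "expectation (\<lambda>\<omega>. (\<Sum>k<n. H k \<omega> * d k \<omega>)\<^sup>2) =
    (\<Sum>k<n. expectation (\<lambda>\<omega>. (H k \<omega> * d k \<omega>)\<^sup>2))"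
proof (induction n)
  case (Suc n)
  define S where "S \<omega> = (\<Sum>k<n. H k \<omega> * d k \<omega>)" for \<omega>
  define s where "s = (\<Sum>k<n. h k * b)"
  have SF: "S \<in> borel_measurable (F n)"
    unfolding S_def by (rule weighted_sum_measurable[OF H])
  have [measurable]: "S \<in> borel_measurable M" "H k \<in> borel_measurable M" for k
    using measurable_F_M[OF SF] measurable_F_M[OF H] by auto
  have s: "\<bar>S \<omega>\<bar> \<le> s" if "\<omega> \<in> space M" for \<omega>
    unfolding S_def s_def by (rule weighted_sum_bounded[OF h that])
  have hb: "\<bar>H n \<omega> * d n \<omega>\<bar> \<le> h n * b" if "\<omega> \<in> space M" for \<omega>
    using h[OF that] bounded[OF that] by (intro abs_mult_le)
  have ZB: "\<bar>S \<omega> * H n \<omega>\<bar> \<le> s * h n" if "\<omega> \<in> space M" for \<omega>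
    using h[OF that] s[OF that] by (intro abs_mult_le)
  have i1: "integrable M (\<lambda>\<omega>. (S \<omega>)\<^sup>2)" using s by (intro integrable_square_bounded) auto
  have i2: "integrable M (\<lambda>\<omega>. (H n \<omega> * d n \<omega>)\<^sup>2)" using hb by (intro integrable_square_bounded) auto
  have i3: "integrable M (\<lambda>\<omega>. S \<omega> * H n \<omega> * d n \<omega>)"
  proof (rule integrable_bounded[of _ "(s * h n) * b"])
    fix \<omega> assume "\<omega> \<in> space M"
    then show "norm (S \<omega> * H n \<omega> * d n \<omega>) \<le> s * h n * b"
      unfolding real_norm_def by (intro abs_mult_le[OF ZB bounded])
  qed measurable
  have "expectation (\<lambda>\<omega>. (\<Sum>k<Suc n. H k \<omega> * d k \<omega>)\<^sup>2) =
      expectation (\<lambda>\<omega>. (S \<omega>)\<^sup>2 + 2 * (S \<omega> * H n \<omega> * d n \<omega>) + (H n \<omega> * d n \<omega>)\<^sup>2)"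
    by (intro Bochner_Integration.integral_cong) (auto simp: S_def power2_sum algebra_simps)
  also have "\<dots> = second_moment S + 2 * expectation (\<lambda>\<omega>. S \<omega> * H n \<omega> * d n \<omega>)
      + expectation (\<lambda>\<omega>. (H n \<omega> * d n \<omega>)\<^sup>2)"
    using i1 i2 i3 by simp
  also have "expectation (\<lambda>\<omega>. S \<omega> * H n \<omega> * d n \<omega>) = 0"
    by (rule orthogonal[of "\<lambda>\<omega>. S \<omega> * H n \<omega>" n "s * h n"]) (use SF H ZB in auto)
  finally show ?case using Suc by (simp add: S_def)
qed simp

lemma deterministic_sum_second_moment:
  "expectation (\<lambda>\<omega>. (\<Sum>k<n. w k * d k \<omega>)\<^sup>2) = (\<Sum>k<n. (w k)\<^sup>2 * second_moment (d k))"
  using weighted_sum_second_moment[of "\<lambda>k \<omega>. w k" "\<lambda>k. \<bar>w k\<bar>" n] by (simp add: power_mult_distrib)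

lemma square_integrable_sum: "integrable M (\<lambda>\<omega>. (\<Sum>k<n. w k * d k \<omega>)\<^sup>2)"
  by (rule integrable_square_bounded[OF _ weighted_sum_bounded[of _ "\<lambda>k. \<bar>w k\<bar>"]]) auto

lemma second_moment_nonneg: "second_moment (d k) \<ge> 0"
  by (rule Bochner_Integration.integral_nonneg) simp

lemma second_moment_le: "second_moment (d k) \<le> b\<^sup>2"
proof -
  have "norm ((d k \<omega>)\<^sup>2) \<le> b\<^sup>2" if "\<omega> \<in> space M" for \<omega>
    using bounded[OF that] by (rule norm_square_le)
  then show ?thesis
    using integral_norm_le[of "\<lambda>\<omega>. (d k \<omega>)\<^sup>2" "b\<^sup>2"] second_moment_nonneg[of k] by simp
qed

text \<open>The sum is stopped at the first time when its modulus reaches \<open>e\<close>, by setting all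
  later weights to 0. On the event in question the stopped sum is at least \<open>e\<close> in modulus at time
  \<open>n\<close>, and its second moment is at most that of the original sum, so that Markov's inequality
  applies.\<close>

theorem maximal_inequality:
  assumes e: "e > 0"
  shows "e\<^sup>2 * prob {\<omega> \<in> space M. \<exists>k\<le>n. e \<le> \<bar>\<Sum>j<k. w j * d j \<omega>\<bar>} \<le>
    (\<Sum>k<n. (w k)\<^sup>2 * second_moment (d k))"
proof -
  define S where "S k \<omega> = (\<Sum>j<k. w j * d j \<omega>)" for k \<omega>
  define H where "H k \<omega> = (if \<forall>i\<le>k. \<bar>S i \<omega>\<bar> < e then w k else 0)" for k \<omega>
  define S' where "S' k \<omega> = (\<Sum>j<k. H j \<omega> * d j \<omega>)" for k \<omega>
  have SF: "S i \<in> borel_measurable (F k)" if "i \<le> k" for i k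
    unfolding S_def by (rule measurable_F_mono[OF weighted_sum_measurable that]) simp
  have HF: "H k \<in> borel_measurable (F k)" for k
  proof -
    have "{\<omega> \<in> space (F k). \<forall>i\<in>{..k}. \<bar>S i \<omega>\<bar> < e} \<in> sets (F k)"
    proof (rule sets.sets_Collect_finite_All)
      fix i assume "i \<in> {..k}"
      then have [measurable]: "S i \<in> borel_measurable (F k)" using SF by simp
      show "{\<omega> \<in> space (F k). \<bar>S i \<omega>\<bar> < e} \<in> sets (F k)" by measurable
    qed simp
    then have "{\<omega> \<in> space (F k). \<forall>i\<le>k. \<bar>S i \<omega>\<bar> < e} \<in> sets (F k)"
      by (simp only: Ball_def atMost_iff)
    then show ?thesis unfolding H_def by (intro measurable_If borel_measurable_const)
  qed
  have Hw: "\<bar>H k \<omega>\<bar> \<le> \<bar>w k\<bar>" for k \<omega> by (simp add: H_def)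
  have stopped: "if \<exists>i\<le>k. e \<le> \<bar>S i \<omega>\<bar> then e \<le> \<bar>S' k \<omega>\<bar> else S' k \<omega> = S k \<omega>" for k \<omega>
  proof (induction k)
    case 0
    then show ?case using e by (auto simp: S_def S'_def)
  next
    case (Suc k)
    show ?case
    proof (cases "\<exists>i\<le>k. e \<le> \<bar>S i \<omega>\<bar>")
      case True
      then have "\<not> (\<forall>i\<le>k. \<bar>S i \<omega>\<bar> < e)" by (meson not_le)
      then have "H k \<omega> = 0" unfolding H_def by (rule if_not_P)
      then show ?thesis using Suc True by (auto simp: S'_def le_Suc_eq)
    next
      case False
      then have "\<forall>i\<le>k. \<bar>S i \<omega>\<bar> < e" by (meson not_le)
      then have "H k \<omega> = w k" unfolding H_def by (rule if_P)
      moreover have "S' k \<omega> = S k \<omega>" using Suc False by (simp split: if_splits)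
      ultimately have "S' (Suc k) \<omega> = S (Suc k) \<omega>" by (simp add: S'_def S_def)
      then show ?thesis using False by (auto simp: le_Suc_eq)
    qed
  qed
  have S'F: "S' n \<in> borel_measurable M"
    unfolding S'_def by (rule measurable_F_M[OF weighted_sum_measurable[OF HF]])
  have S'b: "\<bar>S' n \<omega>\<bar> \<le> (\<Sum>k<n. \<bar>w k\<bar> * b)" if "\<omega> \<in> space M" for \<omega>
    unfolding S'_def using Hw that by (intro weighted_sum_bounded) auto
  have iS': "integrable M (\<lambda>\<omega>. (S' n \<omega>)\<^sup>2)" by (rule integrable_square_bounded[OF S'F S'b])
  have "{\<omega> \<in> space M. \<exists>k\<le>n. e \<le> \<bar>S k \<omega>\<bar>} \<subseteq> {\<omega> \<in> space M. e\<^sup>2 \<le> (S' n \<omega>)\<^sup>2}"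
  proof safe
    fix \<omega> k assume "k \<le> n" "e \<le> \<bar>S k \<omega>\<bar>"
    then have "e \<le> \<bar>S' n \<omega>\<bar>" using stopped[of n \<omega>] by (auto split: if_splits)
    then show "e\<^sup>2 \<le> (S' n \<omega>)\<^sup>2" using e abs_le_square_iff[of e "S' n \<omega>"] by simp
  qed
  then have "prob {\<omega> \<in> space M. \<exists>k\<le>n. e \<le> \<bar>S k \<omega>\<bar>} \<le> prob {\<omega> \<in> space M. e\<^sup>2 \<le> (S' n \<omega>)\<^sup>2}"
    using S'F by (intro finite_measure_mono) auto
  also have "\<dots> \<le> second_moment (S' n) / e\<^sup>2"
    using iS' e by (intro integral_Markov_inequality_measure[where A = "{}"]) auto
  also have "second_moment (S' n) = (\<Sum>k<n. expectation (\<lambda>\<omega>. (H k \<omega> * d k \<omega>)\<^sup>2))"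
    unfolding S'_def by (rule weighted_sum_second_moment[OF HF Hw])
  also have "\<dots> \<le> (\<Sum>k<n. (w k)\<^sup>2 * second_moment (d k))"
  proof (rule sum_mono)
    fix k
    have "expectation (\<lambda>\<omega>. (H k \<omega> * d k \<omega>)\<^sup>2) \<le> expectation (\<lambda>\<omega>. (w k * d k \<omega>)\<^sup>2)"
    proof (rule integral_mono')
      show "integrable M (\<lambda>\<omega>. (w k * d k \<omega>)\<^sup>2)"
        by (rule integrable_square_bounded[of _ "\<bar>w k\<bar> * b"]) (auto simp: abs_mult mult_left_mono bounded)
    qed (auto simp: H_def)
    then show "expectation (\<lambda>\<omega>. (H k \<omega> * d k \<omega>)\<^sup>2) \<le> (w k)\<^sup>2 * second_moment (d k)"
      by (simp add: power_mult_distrib)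
  qed
  finally show ?thesis using e by (simp add: S_def pos_le_divide_eq divide_right_mono mult.commute)
qed

text \<open>The maximal inequality, applied to the sums that start at \<open>m\<close>, bounds the probability of an
  oscillation after \<open>m\<close> by a tail of the convergent series; hence almost surely the partial
  sums form a Cauchy sequence. Fatou's lemma bounds the mean square distance to the limit by the
  same tail.\<close>

theorem converges_as_L2_sum:
  assumes v: "summable (\<lambda>k. (w k)\<^sup>2 * second_moment (d k))"
  shows "\<exists>L. converges_as_L2 M (\<lambda>n \<omega>. \<Sum>k<n. w k * d k \<omega>) L"
proof -
  define S where "S n \<omega> = (\<Sum>k<n. w k * d k \<omega>)" for n \<omega>
  define V where "V k = (w k)\<^sup>2 * second_moment (d k)" for k
  define r where "r m = (\<Sum>k. V (k + m))" for m
  have V0: "V k \<ge> 0" for k unfolding V_def by (intro mult_nonneg_nonneg second_moment_nonneg) simp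
  have Vs: "summable (\<lambda>k. V (k + m))" for m
    using v unfolding V_def[symmetric] by (rule summable_ignore_initial_segment)
  have r0: "r \<longlonglongrightarrow> 0" unfolding r_def by (rule suminf_exist_split2) (use v in \<open>simp add: V_def\<close>)
  have [measurable]: "S n \<in> borel_measurable M" for n unfolding S_def by measurable
  have block: "(\<Sum>k<n. (if k < m then 0 else V k)) \<le> r m" for m n
  proof -
    have "(\<Sum>k<n. (if k < m then 0 else V k)) \<le> (\<Sum>k<n + m. (if k < m then 0 else V k))"
      using V0 by (intro sum_mono2) auto
    also have "\<dots> = (\<Sum>k<n. V (k + m))"
      by (induction n) auto
    also have "\<dots> \<le> r m" unfolding r_def using Vs V0 by (intro sum_le_suminf) auto
    finally show ?thesis .
  qed
  have tail: "(\<Sum>j<k. (if j < m then 0 else w j) * d j \<omega>) = S k \<omega> - S m \<omega>" if "m \<le> k" for m k \<omega>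
    using that by (induction k rule: dec_induct) (auto simp: S_def)
  have V': "(if k < m then 0 else w k)\<^sup>2 * second_moment (d k) = (if k < m then 0 else V k)" for k m
    by (simp add: V_def)
  have max: "prob {\<omega> \<in> space M. \<exists>k\<in>{m..n}. e \<le> \<bar>S k \<omega> - S m \<omega>\<bar>} \<le> r m / e\<^sup>2"
    if e: "e > 0" for e m n
  proof -
    have "e\<^sup>2 * prob {\<omega> \<in> space M. \<exists>k\<in>{m..n}. e \<le> \<bar>S k \<omega> - S m \<omega>\<bar>} \<le>
      e\<^sup>2 * prob {\<omega> \<in> space M. \<exists>k\<le>n. e \<le> \<bar>\<Sum>j<k. (if j < m then 0 else w j) * d j \<omega>\<bar>}"
      by (intro mult_left_mono finite_measure_mono) (auto simp flip: tail)
    also have "\<dots> \<le> r m"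
      using maximal_inequality[OF e, of n "\<lambda>j. if j < m then 0 else w j"] block[of m n]
      unfolding V' by linarith
    finally show ?thesis using e by (simp add: pos_le_divide_eq mult.commute)
  qed
  have osc: "prob {\<omega> \<in> space M. \<exists>k\<ge>m. e \<le> \<bar>S k \<omega> - S m \<omega>\<bar>} \<le> r m / e\<^sup>2" if e: "e > 0" for e m
  proof (rule LIMSEQ_le_const2)
    let ?A = "\<lambda>n. {\<omega> \<in> space M. \<exists>k\<in>{m..n}. e \<le> \<bar>S k \<omega> - S m \<omega>\<bar>}"
    have "(\<lambda>n. prob (?A n)) \<longlonglongrightarrow> prob (\<Union>n. ?A n)"
      by (rule finite_Lim_measure_incseq) (auto simp: incseq_def)
    also have "(\<Union>n. ?A n) = {\<omega> \<in> space M. \<exists>k\<ge>m. e \<le> \<bar>S k \<omega> - S m \<omega>\<bar>}"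
      by auto (meson atLeastAtMost_iff order_refl)
    finally show "(\<lambda>n. prob (?A n)) \<longlonglongrightarrow> prob {\<omega> \<in> space M. \<exists>k\<ge>m. e \<le> \<bar>S k \<omega> - S m \<omega>\<bar>}" .
    show "\<exists>N. \<forall>n\<ge>N. prob (?A n) \<le> r m / e\<^sup>2" using max[OF e] by blast
  qed
  have small: "AE \<omega> in M. \<exists>m. \<forall>k\<ge>m. \<bar>S k \<omega> - S m \<omega>\<bar> < e" if e: "e > 0" for e
  proof -
    define N where "N = {\<omega> \<in> space M. \<forall>m. \<exists>k\<ge>m. e \<le> \<bar>S k \<omega> - S m \<omega>\<bar>}"
    have N: "N \<in> sets M" unfolding N_def by measurable
    have "prob N \<le> r m / e\<^sup>2" for m
    proof (rule order_trans[OF finite_measure_mono osc[OF e, of m]])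
      show "{\<omega> \<in> space M. \<exists>k\<ge>m. e \<le> \<bar>S k \<omega> - S m \<omega>\<bar>} \<in> sets M" by measurable
    qed (auto simp: N_def)
    moreover have "(\<lambda>m. r m / e\<^sup>2) \<longlonglongrightarrow> 0 / e\<^sup>2" using e by (intro tendsto_divide r0) auto
    ultimately have "prob N \<le> 0" by (intro LIMSEQ_le_const[of "\<lambda>m. r m / e\<^sup>2"]) auto
    then have "emeasure M N = 0" by (simp add: emeasure_eq_measure measure_le_0_iff)
    then have "AE \<omega> in M. \<omega> \<notin> N" using N by (intro AE_not_in) (auto simp: null_sets_def)
    with AE_space show ?thesis
    proof eventually_elim
      case (elim \<omega>)
      then obtain m where "\<not> (\<exists>k\<ge>m. e \<le> \<bar>S k \<omega> - S m \<omega>\<bar>)" unfolding N_def by blast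
      then show ?case by (meson not_le)
    qed
  qed
  have conv: "AE \<omega> in M. convergent (\<lambda>n. S n \<omega>)"
  proof -
    have "AE \<omega> in M. \<forall>j::nat. \<exists>m. \<forall>k\<ge>m. \<bar>S k \<omega> - S m \<omega>\<bar> < 1 / real (Suc j)"
      unfolding AE_all_countable using small by simp
    then show ?thesis
    proof eventually_elim
      case (elim \<omega>)
      have "Cauchy (\<lambda>n. S n \<omega>)"
      proof (rule CauchyI')
        fix e :: real assume "e > 0"
        then obtain j where j: "1 / real (Suc j) < e / 2" using nat_approx_posE[of "e/2"] by auto
        obtain m where m: "\<And>k. k \<ge> m \<Longrightarrow> \<bar>S k \<omega> - S m \<omega>\<bar> < 1 / real (Suc j)" using elim by blast
        have "dist (S k \<omega>) (S n \<omega>) < e" if "k \<ge> m" "n > k" for k n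
          using m[of k] m[of n] that j by (simp add: dist_real_def)
        then show "\<exists>M. \<forall>m\<ge>M. \<forall>n>m. dist (S m \<omega>) (S n \<omega>) < e" by blast
      qed
      then show ?case by (simp add: Cauchy_convergent_iff)
    qed
  qed
  define L where "L \<omega> = lim (\<lambda>n. S n \<omega>)" for \<omega>
  have [measurable]: "L \<in> borel_measurable M" unfolding L_def by measurable
  have lim: "AE \<omega> in M. (\<lambda>n. S n \<omega>) \<longlonglongrightarrow> L \<omega>"
    using conv by eventually_elim (simp add: L_def convergent_LIMSEQ_iff)
  have nn: "(\<integral>\<^sup>+\<omega>. ennreal ((S m \<omega> - L \<omega>)\<^sup>2) \<partial>M) \<le> ennreal (r m)" for m
  proof -
    have "(\<integral>\<^sup>+\<omega>. ennreal ((S m \<omega> - L \<omega>)\<^sup>2) \<partial>M) = (\<integral>\<^sup>+\<omega>. liminf (\<lambda>n. ennreal ((S m \<omega> - S n \<omega>)\<^sup>2)) \<partial>M)"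
    proof (rule nn_integral_cong_AE)
      show "AE \<omega> in M. ennreal ((S m \<omega> - L \<omega>)\<^sup>2) = liminf (\<lambda>n. ennreal ((S m \<omega> - S n \<omega>)\<^sup>2))"
        using lim
      proof eventually_elim
        case (elim \<omega>)
        then have "(\<lambda>n. ennreal ((S m \<omega> - S n \<omega>)\<^sup>2)) \<longlonglongrightarrow> ennreal ((S m \<omega> - L \<omega>)\<^sup>2)"
          by (intro tendsto_ennrealI tendsto_intros)
        then show ?case by (rule lim_imp_Liminf[OF trivial_limit_sequentially, symmetric])
      qed
    qed
    also have "\<dots> \<le> liminf (\<lambda>n. \<integral>\<^sup>+\<omega>. ennreal ((S m \<omega> - S n \<omega>)\<^sup>2) \<partial>M)"
      by (rule nn_integral_liminf) measurable
    also have "\<dots> \<le> limsup (\<lambda>n. \<integral>\<^sup>+\<omega>. ennreal ((S m \<omega> - S n \<omega>)\<^sup>2) \<partial>M)"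
      by (rule Liminf_le_Limsup) simp
    also have "\<dots> \<le> ennreal (r m)"
    proof (rule Limsup_bounded)
      show "\<forall>\<^sub>F n in sequentially. (\<integral>\<^sup>+\<omega>. ennreal ((S m \<omega> - S n \<omega>)\<^sup>2) \<partial>M) \<le> ennreal (r m)"
        using eventually_ge_at_top[of m]
      proof eventually_elim
        case (elim n)
        have eq: "(S m \<omega> - S n \<omega>)\<^sup>2 = (\<Sum>j<n. (if j < m then 0 else w j) * d j \<omega>)\<^sup>2" for \<omega>
          unfolding tail[OF elim] by (simp add: power2_commute)
        have "(\<integral>\<^sup>+\<omega>. ennreal ((S m \<omega> - S n \<omega>)\<^sup>2) \<partial>M) = ennreal (expectation (\<lambda>\<omega>. (S m \<omega> - S n \<omega>)\<^sup>2))"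
          unfolding eq by (intro nn_integral_eq_integral square_integrable_sum) auto
        also have "expectation (\<lambda>\<omega>. (S m \<omega> - S n \<omega>)\<^sup>2) \<le> r m"
          unfolding eq deterministic_sum_second_moment V' by (rule block)
        finally show ?case by (simp add: ennreal_leI)
      qed
    qed
    finally show ?thesis .
  qed
  have iD: "integrable M (\<lambda>\<omega>. (S m \<omega> - L \<omega>)\<^sup>2)" for m
  proof (rule integrableI_bounded)
    show "(\<integral>\<^sup>+\<omega>. ennreal (norm ((S m \<omega> - L \<omega>)\<^sup>2)) \<partial>M) < \<infinity>"
      using nn[of m] by (simp add: le_less_trans[OF _ ennreal_less_top])
  qed measurable
  have r_nonneg: "r m \<ge> 0" for m unfolding r_def using Vs V0 by (intro suminf_nonneg) auto
  have D: "expectation (\<lambda>\<omega>. (S m \<omega> - L \<omega>)\<^sup>2) \<le> r m" for m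
    using nn[of m] r_nonneg[of m] by (subst (asm) nn_integral_eq_integral[OF iD]) (auto simp: ennreal_le_iff)
  have "(\<lambda>m. expectation (\<lambda>\<omega>. (S m \<omega> - L \<omega>)\<^sup>2)) \<longlonglongrightarrow> 0"
    by (rule tendsto_sandwich[OF _ _ tendsto_const r0]) (use D in auto)
  moreover have "integrable M (\<lambda>\<omega>. (L \<omega>)\<^sup>2)" using iD[of 0] by (simp add: S_def)
  ultimately have "converges_as_L2 M S L"
    unfolding converges_as_L2_def using lim square_integrable_sum[where w=w] by (auto simp: S_def)
  then show ?thesis unfolding S_def by blast
qed

end

section \<open>A central limit theorem\<close>

text \<open>The theorem is proved by comparing characteristic functions one increment at a
  time. This requires that the conditional variances of the increments approach a constant
  \<open>v\<close> in mean. The requirement is expressed by numbers \<open>\<delta> k\<close> that bound the expectation of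
  \<open>Z ((d k)\<^sup>2 - v)\<close> for all \<open>Z\<close> of modulus at most 1 that depend on the past only.\<close>

text \<open>The upper bound follows from \<open>1 + y + y\<^sup>2/2 \<le> exp y\<close> because
  \<open>(1 - y + y\<^sup>2/2) (1 + y + y\<^sup>2/2) = 1 + y\<^sup>4/4\<close>.\<close>

lemma exp_minus_approx:
  fixes y :: real assumes y: "y \<ge> 0"
  shows "\<bar>exp (- y) - 1 + y\<bar> \<le> y\<^sup>2 / 2"
proof -
  have "1 \<le> 1 + (y\<^sup>2)\<^sup>2 / 4" by simp
  also have "\<dots> = (1 - y + y\<^sup>2 / 2) * (1 + y + y\<^sup>2 / 2)"
    by (simp add: power2_eq_square algebra_simps)
  also have "\<dots> \<le> (1 - y + y\<^sup>2 / 2) * exp y"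
  proof (rule mult_left_mono[OF exp_lower_Taylor_quadratic[OF y]])
    have "0 \<le> (1 - y)\<^sup>2 / 2 + 1 / 2" by simp
    then show "0 \<le> 1 - y + y\<^sup>2 / 2" by (simp add: power2_eq_square field_simps)
  qed
  finally have "exp (- y) \<le> 1 - y + y\<^sup>2 / 2" by (simp add: exp_minus field_simps)
  with exp_ge_add_one_self[of "- y"] show ?thesis by linarith
qed

lemma iexp_quadratic_approx:
  "cmod (iexp t - (1 + \<i> * complex_of_real t - complex_of_real (t\<^sup>2 / 2))) \<le> \<bar>t\<bar> ^ 3 / 6"
proof -
  have "(\<Sum>k\<le>2. (\<i> * complex_of_real t) ^ k / fact k) = 1 + \<i> * complex_of_real t - complex_of_real (t\<^sup>2 / 2)"
    by (simp add: numeral_2_eq_2 power2_eq_square complex_eq_iff)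
  then show ?thesis using iexp_approx1[of t 2] by (simp add: eval_nat_numeral)
qed

context prob_space
begin

lemma iexp_times_real:
  fixes f g :: "'a \<Rightarrow> real"
  assumes [measurable]: "f \<in> borel_measurable M" "g \<in> borel_measurable M"
    and g: "\<And>\<omega>. \<omega> \<in> space M \<Longrightarrow> \<bar>g \<omega>\<bar> \<le> B"
  shows "integrable M (\<lambda>\<omega>. iexp (f \<omega>) * complex_of_real (g \<omega>))"
    and "(CLINT \<omega>|M. iexp (f \<omega>) * complex_of_real (g \<omega>)) =
      complex_of_real (expectation (\<lambda>\<omega>. cos (f \<omega>) * g \<omega>))
      + \<i> * complex_of_real (expectation (\<lambda>\<omega>. sin (f \<omega>) * g \<omega>))"
proof -
  show "integrable M (\<lambda>\<omega>. iexp (f \<omega>) * complex_of_real (g \<omega>))"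
    by (rule integrable_bounded[of _ B]) (use g in \<open>auto simp: norm_mult\<close>)
  have c: "integrable M (\<lambda>\<omega>. cos (f \<omega>) * g \<omega>)" and s: "integrable M (\<lambda>\<omega>. sin (f \<omega>) * g \<omega>)"
    using g abs_mult_le[OF abs_cos_le_one] abs_mult_le[OF abs_sin_le_one]
    by (auto intro!: integrable_bounded[of _ "1 * B"])
  have "(CLINT \<omega>|M. iexp (f \<omega>) * complex_of_real (g \<omega>)) =
    (CLINT \<omega>|M. complex_of_real (cos (f \<omega>) * g \<omega>) + \<i> * complex_of_real (sin (f \<omega>) * g \<omega>))"
    by (intro Bochner_Integration.integral_cong)
      (auto simp: cis_conv_exp[symmetric] complex_eq_iff)
  also have "\<dots> = (CLINT \<omega>|M. complex_of_real (cos (f \<omega>) * g \<omega>)) +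
      (CLINT \<omega>|M. \<i> * complex_of_real (sin (f \<omega>) * g \<omega>))"
    using integrable_of_real[OF c, where 'a=complex] integrable_of_real[OF s, where 'a=complex]
    by (intro Bochner_Integration.integral_add integrable_mult_right) auto
  also have "\<dots> = complex_of_real (expectation (\<lambda>\<omega>. cos (f \<omega>) * g \<omega>))
      + \<i> * complex_of_real (expectation (\<lambda>\<omega>. sin (f \<omega>) * g \<omega>))"
    by (simp del: of_real_mult)
  finally show "(CLINT \<omega>|M. iexp (f \<omega>) * complex_of_real (g \<omega>)) =
      complex_of_real (expectation (\<lambda>\<omega>. cos (f \<omega>) * g \<omega>))
      + \<i> * complex_of_real (expectation (\<lambda>\<omega>. sin (f \<omega>) * g \<omega>))" .
qed

end

context bounded_martingale_differences
begin

text \<open>Both factors are expanded to second order. The linear term vanishes by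
  orthogonality. In the quadratic term the square of the increment may be replaced by \<open>v\<close> at
  the cost of \<open>\<delta>\<close> for the cosine part and \<open>\<delta>\<close> for the sine part of \<open>iexp (S \<omega>)\<close>. The
  remainders give the last two summands.\<close>

lemma char_step:
  assumes S: "S \<in> borel_measurable (F k)" and v: "v \<ge> 0"
    and \<delta>: "\<And>Z. Z \<in> borel_measurable (F k) \<Longrightarrow> (\<And>\<omega>. \<omega> \<in> space M \<Longrightarrow> \<bar>Z \<omega>\<bar> \<le> 1) \<Longrightarrow>
      \<bar>expectation (\<lambda>\<omega>. Z \<omega> * ((d k \<omega>)\<^sup>2 - v))\<bar> \<le> \<delta>"
  shows "cmod (CLINT \<omega>|M. iexp (S \<omega>) * (iexp (x * d k \<omega>) - complex_of_real (exp (- (x\<^sup>2 * v / 2)))))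
    \<le> x\<^sup>2 * \<delta> + \<bar>x\<bar> ^ 3 * b ^ 3 / 6 + x ^ 4 * v\<^sup>2 / 8"
proof -
  let ?I = "CLINT \<omega>|M. iexp (S \<omega>) * (iexp (x * d k \<omega>) - complex_of_real (exp (- (x\<^sup>2 * v / 2))))"
  let ?Q = "CLINT \<omega>|M. iexp (S \<omega>) * complex_of_real ((d k \<omega>)\<^sup>2 - v)"
  have [measurable]: "S \<in> borel_measurable M" by (rule measurable_F_M[OF S])
  have cS: "(\<lambda>\<omega>. cos (S \<omega>)) \<in> borel_measurable (F k)" "(\<lambda>\<omega>. sin (S \<omega>)) \<in> borel_measurable (F k)"
    using S by measurable
  define y where "y = x\<^sup>2 * v / 2"
  define r where "r \<omega> = (iexp (x * d k \<omega>) - (1 + \<i> * complex_of_real (x * d k \<omega>) - complex_of_real ((x * d k \<omega>)\<^sup>2 / 2)))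
      - complex_of_real (exp (- y) - 1 + y)" for \<omega>
  have [measurable]: "r \<in> borel_measurable M" unfolding r_def by measurable
  have r: "cmod (r \<omega>) \<le> \<bar>x\<bar> ^ 3 * b ^ 3 / 6 + x ^ 4 * v\<^sup>2 / 8" if "\<omega> \<in> space M" for \<omega>
  proof -
    have "\<bar>x * d k \<omega>\<bar> ^ 3 / 6 \<le> (\<bar>x\<bar> * b) ^ 3 / 6"
      using bounded[OF that] by (intro divide_right_mono power_mono) (auto simp: abs_mult mult_left_mono)
    moreover have "y\<^sup>2 / 2 = x ^ 4 * v\<^sup>2 / 8" by (simp add: y_def eval_nat_numeral)
    moreover have "cmod (complex_of_real (exp (- y) - 1 + y)) \<le> y\<^sup>2 / 2"
      unfolding norm_of_real using v by (intro exp_minus_approx) (simp add: y_def)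
    ultimately show ?thesis
      unfolding r_def using iexp_quadratic_approx[of "x * d k \<omega>"]
      by (intro order_trans[OF norm_triangle_ineq4]) (simp add: power_mult_distrib)
  qed
  have b2: "\<bar>(d k \<omega>)\<^sup>2 - v\<bar> \<le> b\<^sup>2 + v" if "\<omega> \<in> space M" for \<omega>
    using norm_square_le[OF bounded[OF that, of k]] zero_le_power2[of b] zero_le_power2[of "d k \<omega>"] v
    unfolding abs_le_iff real_norm_def abs_power2 by linarith
  note L = iexp_times_real[of S "d k" b] and Q = iexp_times_real[of S "\<lambda>\<omega>. (d k \<omega>)\<^sup>2 - v" "b\<^sup>2 + v"]
  have i3: "integrable M (\<lambda>\<omega>. iexp (S \<omega>) * r \<omega>)"
    by (rule integrable_bounded[of _ "\<bar>x\<bar> ^ 3 * b ^ 3 / 6 + x ^ 4 * v\<^sup>2 / 8"]) (use r in \<open>auto simp: norm_mult\<close>)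
  have "?I =
      (CLINT \<omega>|M. \<i> * complex_of_real x * (iexp (S \<omega>) * complex_of_real (d k \<omega>))
       + - complex_of_real (x\<^sup>2 / 2) * (iexp (S \<omega>) * complex_of_real ((d k \<omega>)\<^sup>2 - v)) + iexp (S \<omega>) * r \<omega>)"
    by (intro Bochner_Integration.integral_cong)
      (auto simp: r_def y_def algebra_simps power_mult_distrib)
  also have "\<dots> = \<i> * complex_of_real x * (CLINT \<omega>|M. iexp (S \<omega>) * complex_of_real (d k \<omega>))
       + - complex_of_real (x\<^sup>2 / 2) * ?Q
       + (CLINT \<omega>|M. iexp (S \<omega>) * r \<omega>)"
    using L(1)[OF _ _ bounded] Q(1)[OF _ _ b2] i3 by simp
  also have "(CLINT \<omega>|M. iexp (S \<omega>) * complex_of_real (d k \<omega>)) = 0"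
    using L(2)[OF _ _ bounded] orthogonal[OF cS(1), of 1] orthogonal[OF cS(2), of 1] by simp
  finally have eq: "?I =
      - complex_of_real (x\<^sup>2 / 2) * ?Q
       + (CLINT \<omega>|M. iexp (S \<omega>) * r \<omega>)" by simp
  have "?Q =
      complex_of_real (expectation (\<lambda>\<omega>. cos (S \<omega>) * ((d k \<omega>)\<^sup>2 - v)))
      + \<i> * complex_of_real (expectation (\<lambda>\<omega>. sin (S \<omega>) * ((d k \<omega>)\<^sup>2 - v)))"
    by (rule Q(2)) (use b2 in auto)
  also have "cmod \<dots> \<le> \<bar>expectation (\<lambda>\<omega>. cos (S \<omega>) * ((d k \<omega>)\<^sup>2 - v))\<bar>
      + \<bar>expectation (\<lambda>\<omega>. sin (S \<omega>) * ((d k \<omega>)\<^sup>2 - v))\<bar>"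
    by (rule order_trans[OF norm_triangle_ineq]) (simp add: norm_mult del: of_real_diff of_real_mult)
  also have "\<dots> \<le> \<delta> + \<delta>"
    by (intro add_mono \<delta> cS) auto
  finally have "cmod ?Q \<le> \<delta> + \<delta>" .
  then have "cmod (- complex_of_real (x\<^sup>2 / 2) * ?Q)
      \<le> x\<^sup>2 / 2 * (\<delta> + \<delta>)"
    unfolding norm_mult by (intro mult_mono) (auto simp: norm_power)
  moreover have "cmod (CLINT \<omega>|M. iexp (S \<omega>) * r \<omega>) \<le> \<bar>x\<bar> ^ 3 * b ^ 3 / 6 + x ^ 4 * v\<^sup>2 / 8"
    by (rule integral_norm_le) (use r in \<open>auto simp: norm_mult\<close>)
  ultimately show ?thesis unfolding eq by (intro order_trans[OF norm_triangle_ineq]) simp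
qed

text \<open>When one more increment is taken into account, the error made so far is multiplied by a Gaussian
  factor, which is at most 1, and the error of one step is added.\<close>

lemma char_weighted_sum_error:
  fixes c :: "nat \<Rightarrow> real"
  assumes v: "v \<ge> 0"
    and \<delta>: "\<And>k Z. Z \<in> borel_measurable (F k) \<Longrightarrow> (\<And>\<omega>. \<omega> \<in> space M \<Longrightarrow> \<bar>Z \<omega>\<bar> \<le> 1) \<Longrightarrow>
      \<bar>expectation (\<lambda>\<omega>. Z \<omega> * ((d k \<omega>)\<^sup>2 - v))\<bar> \<le> \<delta> k"
  shows "cmod ((CLINT \<omega>|M. iexp (\<Sum>k<n. c k * d k \<omega>)) - complex_of_real (exp (- ((\<Sum>k<n. (c k)\<^sup>2) * v / 2))))
    \<le> (\<Sum>k<n. (c k)\<^sup>2 * \<delta> k + \<bar>c k\<bar> ^ 3 * b ^ 3 / 6 + c k ^ 4 * v\<^sup>2 / 8)"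
proof (induction n)
  case 0
  then show ?case by (simp add: prob_space)
next
  case (Suc n)
  let ?G = "complex_of_real (exp (- ((\<Sum>k<n. (c k)\<^sup>2) * v / 2)))"
  define S where "S \<omega> = (\<Sum>k<n. c k * d k \<omega>)" for \<omega>
  have S: "S \<in> borel_measurable (F n)"
    unfolding S_def by (rule weighted_sum_measurable) simp
  have [measurable]: "S \<in> borel_measurable M" by (rule measurable_F_M[OF S])
  define q where "q = exp (- ((c n)\<^sup>2 * v / 2))"
  have q: "0 \<le> q" "q \<le> 1" using v by (auto simp: q_def)
  have i: "integrable M (\<lambda>\<omega>. iexp (f \<omega>))" if "f \<in> borel_measurable M" for f :: "'a \<Rightarrow> real"
    using that by (intro integrable_bounded[of _ 1]) auto
  have i': "integrable M (\<lambda>\<omega>. iexp (S \<omega>) * complex_of_real q)" using i[of S] by simp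
  have "(CLINT \<omega>|M. iexp (\<Sum>k<Suc n. c k * d k \<omega>)) =
      (CLINT \<omega>|M. iexp (S \<omega>) * (iexp (c n * d n \<omega>) - complex_of_real q) + iexp (S \<omega>) * complex_of_real q)"
    by (intro Bochner_Integration.integral_cong) (auto simp: S_def algebra_simps exp_add)
  also have "\<dots> = (CLINT \<omega>|M. iexp (S \<omega>) * (iexp (c n * d n \<omega>) - complex_of_real q))
      + (CLINT \<omega>|M. iexp (S \<omega>)) * complex_of_real q"
  proof (subst Bochner_Integration.integral_add[OF _ i'])
    have "integrable M (\<lambda>\<omega>. iexp (S \<omega> + c n * d n \<omega>) - iexp (S \<omega>) * complex_of_real q)"
      using i[of "\<lambda>\<omega>. S \<omega> + c n * d n \<omega>"] i' by (intro Bochner_Integration.integrable_diff) auto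
    then show "integrable M (\<lambda>\<omega>. iexp (S \<omega>) * (iexp (c n * d n \<omega>) - complex_of_real q))"
      by (simp add: algebra_simps exp_add)
  qed simp
  finally have "(CLINT \<omega>|M. iexp (\<Sum>k<Suc n. c k * d k \<omega>))
      - complex_of_real (exp (- ((\<Sum>k<Suc n. (c k)\<^sup>2) * v / 2))) =
    (CLINT \<omega>|M. iexp (S \<omega>) * (iexp (c n * d n \<omega>) - complex_of_real q)) +
    ((CLINT \<omega>|M. iexp (S \<omega>)) - ?G) * complex_of_real q"
    by (simp add: q_def algebra_simps add_divide_distrib flip: exp_add exp_of_real)
  also have "cmod \<dots> \<le> cmod (CLINT \<omega>|M. iexp (S \<omega>) * (iexp (c n * d n \<omega>) - complex_of_real q)) +
    cmod ((CLINT \<omega>|M. iexp (S \<omega>)) - ?G) * q"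
    using q by (intro order_trans[OF norm_triangle_ineq]) (simp add: norm_mult)
  also have "\<dots> \<le> ((c n)\<^sup>2 * \<delta> n + \<bar>c n\<bar> ^ 3 * b ^ 3 / 6 + c n ^ 4 * v\<^sup>2 / 8) +
    cmod ((CLINT \<omega>|M. iexp (S \<omega>)) - ?G) * 1"
    unfolding q_def by (intro add_mono mult_left_mono char_step[OF S v \<delta>]) (use v in auto)
  finally show ?case using Suc by (simp add: S_def)
qed

text \<open>The errors of the single steps add up to a null sequence: with the sum of the
  squared weights bounded, the cubic and quartic terms are controlled by the largest weight, and
  the terms with \<open>\<delta> k\<close> are small because \<open>\<delta> k\<close> is small for large \<open>k\<close> while each single
  weight tends to 0.\<close>

theorem char_weighted_sums_tendsto:
  fixes c :: "nat \<Rightarrow> nat \<Rightarrow> real"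
  assumes v: "v \<ge> 0"
    and \<delta>: "\<And>k Z. Z \<in> borel_measurable (F k) \<Longrightarrow> (\<And>\<omega>. \<omega> \<in> space M \<Longrightarrow> \<bar>Z \<omega>\<bar> \<le> 1) \<Longrightarrow>
      \<bar>expectation (\<lambda>\<omega>. Z \<omega> * ((d k \<omega>)\<^sup>2 - v))\<bar> \<le> \<delta> k"
    and \<delta>0: "\<delta> \<longlonglongrightarrow> 0"
    and m: "\<And>n k. k < n \<Longrightarrow> \<bar>c n k\<bar> \<le> m n" "m \<longlonglongrightarrow> 0"
    and \<tau>: "(\<lambda>n. \<Sum>k<n. (c n k)\<^sup>2) \<longlonglongrightarrow> \<tau>"
  shows "(\<lambda>n. CLINT \<omega>|M. iexp (u * (\<Sum>k<n. c n k * d k \<omega>))) \<longlonglongrightarrow> complex_of_real (exp (- (u\<^sup>2 * \<tau> * v / 2)))"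
proof -
  define T where "T n = (\<Sum>k<n. (c n k)\<^sup>2)" for n
  have T: "T \<longlonglongrightarrow> \<tau>" using \<tau> unfolding T_def[abs_def] .
  have \<delta>_nonneg: "\<delta> k \<ge> 0" for k using \<delta>[of "\<lambda>_. 0" k] by simp
  obtain A where A: "\<And>n. \<bar>T n\<bar> \<le> A"
    using T convergent_imp_Bseq[OF convergentI] by (force elim: BseqE)
  have TA: "(\<Sum>k<n. (c n k)\<^sup>2) \<le> A" for n using A[of n] by (simp add: T_def)
  have A0: "A \<ge> 0" using A[of 0] by simp
  have small: "(\<lambda>n. \<Sum>k<n. (c n k)\<^sup>2 * \<delta> k) \<longlonglongrightarrow> 0"
  proof (rule LIMSEQ_I)
    fix e :: real assume e: "e > 0"
    define e' where "e' = e / (2 * (A + 1))"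
    have e': "e' > 0" "A * e' < e / 2" using e A0 by (auto simp: e'_def field_simps)
    obtain N where N: "\<And>k. k \<ge> N \<Longrightarrow> \<delta> k < e'" using LIMSEQ_D[OF \<delta>0 e'(1)] \<delta>_nonneg by auto
    have "(\<lambda>n. (m n)\<^sup>2 * (\<Sum>k<N. \<delta> k)) \<longlonglongrightarrow> 0\<^sup>2 * (\<Sum>k<N. \<delta> k)" by (intro tendsto_intros m)
    then have "(\<lambda>n. (m n)\<^sup>2 * (\<Sum>k<N. \<delta> k)) \<longlonglongrightarrow> 0" by simp
    from LIMSEQ_D[OF this, of "e/2"] e obtain N' where N': "\<And>n. n \<ge> N' \<Longrightarrow> (m n)\<^sup>2 * (\<Sum>k<N. \<delta> k) < e / 2"
      using \<delta>_nonneg by (auto simp: abs_mult sum_nonneg)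
    have "norm ((\<Sum>k<n. (c n k)\<^sup>2 * \<delta> k) - 0) < e" if n: "n \<ge> N'" for n
    proof -
      have "(\<Sum>k<n. (c n k)\<^sup>2 * \<delta> k) \<le> (\<Sum>k<n. (if k < N then (m n)\<^sup>2 * \<delta> k else 0) + (c n k)\<^sup>2 * e')"
      proof (rule sum_mono)
        fix k assume k: "k \<in> {..<n}"
        show "(c n k)\<^sup>2 * \<delta> k \<le> (if k < N then (m n)\<^sup>2 * \<delta> k else 0) + (c n k)\<^sup>2 * e'"
        proof (cases "k < N")
          case True
          have "(c n k)\<^sup>2 * \<delta> k \<le> (m n)\<^sup>2 * \<delta> k"
            using norm_square_le[OF m(1)] k \<delta>_nonneg by (intro mult_right_mono) auto
          then show ?thesis using True e' by (simp add: add_increasing2)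
        next
          case False
          then show ?thesis using N[of k] by (simp add: mult_left_mono less_imp_le)
        qed
      qed
      also have "\<dots> = (\<Sum>k<n. (if k < N then (m n)\<^sup>2 * \<delta> k else 0)) + (\<Sum>k<n. (c n k)\<^sup>2) * e'"
        by (simp add: sum.distrib sum_distrib_right)
      also have "(\<Sum>k<n. (if k < N then (m n)\<^sup>2 * \<delta> k else 0)) = (\<Sum>k\<in>{..<n} \<inter> {..<N}. (m n)\<^sup>2 * \<delta> k)"
        by (subst sum.inter_restrict) auto
      also have "\<dots> \<le> (\<Sum>k<N. (m n)\<^sup>2 * \<delta> k)" using \<delta>_nonneg by (intro sum_mono2) auto
      also have "\<dots> < e / 2" using N'[OF n] by (simp add: sum_distrib_left)
      also have "(\<Sum>k<n. (c n k)\<^sup>2) * e' \<le> A * e'" using TA e' by (intro mult_right_mono) auto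
      also note e'(2)
      finally show ?thesis using \<delta>_nonneg by (simp add: sum_nonneg)
    qed
    then show "\<exists>no. \<forall>n\<ge>no. norm ((\<Sum>k<n. (c n k)\<^sup>2 * \<delta> k) - 0) < e" by blast
  qed
  define err where "err n = u\<^sup>2 * (\<Sum>k<n. (c n k)\<^sup>2 * \<delta> k) + \<bar>u\<bar> ^ 3 * b ^ 3 / 6 * (\<bar>m n\<bar> * A)
      + u ^ 4 * v\<^sup>2 / 8 * ((m n)\<^sup>2 * A)" for n
  have "err \<longlonglongrightarrow> u\<^sup>2 * 0 + \<bar>u\<bar> ^ 3 * b ^ 3 / 6 * (\<bar>0\<bar> * A) + u ^ 4 * v\<^sup>2 / 8 * (0\<^sup>2 * A)"
    unfolding err_def by (intro tendsto_intros small m)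
  then have err0: "err \<longlonglongrightarrow> 0" by simp
  have err: "cmod ((CLINT \<omega>|M. iexp (u * (\<Sum>k<n. c n k * d k \<omega>))) - complex_of_real (exp (- (u\<^sup>2 * T n * v / 2)))) \<le> err n" for n
  proof -
    have "cmod ((CLINT \<omega>|M. iexp (u * (\<Sum>k<n. c n k * d k \<omega>))) - complex_of_real (exp (- (u\<^sup>2 * T n * v / 2))))
      \<le> (\<Sum>k<n. (u * c n k)\<^sup>2 * \<delta> k + \<bar>u * c n k\<bar> ^ 3 * b ^ 3 / 6 + (u * c n k) ^ 4 * v\<^sup>2 / 8)"
      using char_weighted_sum_error[OF v \<delta>, where n = n and c = "\<lambda>k. u * c n k"]
      by (simp add: T_def sum_distrib_left power_mult_distrib mult.assoc)
    also have "\<dots> \<le> (\<Sum>k<n. u\<^sup>2 * ((c n k)\<^sup>2 * \<delta> k) + \<bar>u\<bar> ^ 3 * b ^ 3 / 6 * (\<bar>m n\<bar> * (c n k)\<^sup>2)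
      + u ^ 4 * v\<^sup>2 / 8 * ((m n)\<^sup>2 * (c n k)\<^sup>2))"
    proof (intro sum_mono add_mono)
      fix k assume "k \<in> {..<n}"
      then have k: "\<bar>c n k\<bar> \<le> \<bar>m n\<bar>" using m(1)[of k n] by simp
      have "\<bar>c n k\<bar> ^ 3 \<le> \<bar>m n\<bar> * (c n k)\<^sup>2"
        using mult_right_mono[OF k, of "(c n k)\<^sup>2"] by (simp add: eval_nat_numeral)
      from mult_left_mono[OF this, of "\<bar>u\<bar> ^ 3 * b ^ 3 / 6"]
      show "\<bar>u * c n k\<bar> ^ 3 * b ^ 3 / 6 \<le> \<bar>u\<bar> ^ 3 * b ^ 3 / 6 * (\<bar>m n\<bar> * (c n k)\<^sup>2)"
        using b_nonneg by (simp add: abs_mult power_mult_distrib mult_ac)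
      have "c n k ^ 4 \<le> (m n)\<^sup>2 * (c n k)\<^sup>2"
        using mult_right_mono[OF norm_square_le[OF k], of "(c n k)\<^sup>2"] by (simp add: eval_nat_numeral mult_ac)
      from mult_left_mono[OF this, of "u ^ 4 * v\<^sup>2 / 8"]
      show "(u * c n k) ^ 4 * v\<^sup>2 / 8 \<le> u ^ 4 * v\<^sup>2 / 8 * ((m n)\<^sup>2 * (c n k)\<^sup>2)"
        by (simp add: power_mult_distrib mult_ac)
    qed (simp add: power_mult_distrib)
    also have "\<dots> = u\<^sup>2 * (\<Sum>k<n. (c n k)\<^sup>2 * \<delta> k) + \<bar>u\<bar> ^ 3 * b ^ 3 / 6 * (\<bar>m n\<bar> * (\<Sum>k<n. (c n k)\<^sup>2))
      + u ^ 4 * v\<^sup>2 / 8 * ((m n)\<^sup>2 * (\<Sum>k<n. (c n k)\<^sup>2))"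
      by (simp add: sum.distrib sum_distrib_left)
    also have "\<dots> \<le> err n"
      unfolding err_def using b_nonneg TA by (intro add_mono mult_left_mono order_refl) auto
    finally show ?thesis .
  qed
  have "(\<lambda>n. (CLINT \<omega>|M. iexp (u * (\<Sum>k<n. c n k * d k \<omega>))) - complex_of_real (exp (- (u\<^sup>2 * T n * v / 2)))) \<longlonglongrightarrow> 0"
    by (rule Lim_null_comparison[OF always_eventually err0]) (intro allI err)
  moreover have "(\<lambda>n. complex_of_real (exp (- (u\<^sup>2 * T n * v / 2)))) \<longlonglongrightarrow> complex_of_real (exp (- (u\<^sup>2 * \<tau> * v / 2)))"
    by (intro tendsto_intros T) auto
  ultimately show ?thesis
    using tendsto_add by fastforce
qed

end

lemma char_normal_law:
  assumes "v \<ge> 0"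
  shows "char (normal_law 0 v) t = complex_of_real (exp (- (t\<^sup>2 * v / 2)))"
proof (cases "v = 0")
  case True
  have "char (return borel 0) t = 1"
    unfolding char_def by (subst integral_return) auto
  with True show ?thesis by (simp add: normal_law_def)
next
  case False
  interpret N: prob_space "density lborel std_normal_density" by (rule prob_space_normal_density) simp
  have "distributed (density lborel std_normal_density) lborel (\<lambda>x. x) std_normal_density"
    by (auto simp: distributed_def distr_id2 sets_eq_imp_space_eq[of lborel])
  from N.normal_density_affine[OF this, of "sqrt v" 0] False assms
  have "distributed (density lborel std_normal_density) lborel (\<lambda>x. sqrt v * x) (normal_density 0 (sqrt v))"
    by simp
  then have "density lborel (normal_density 0 (sqrt v)) = distr (density lborel std_normal_density) lborel (\<lambda>x. sqrt v * x)"
    by (simp add: distributed_def)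
  then have "char (normal_law 0 v) t = char std_normal_distribution (t * sqrt v)"
    using False unfolding char_def normal_law_def by (simp add: integral_distr mult.assoc)
  then show ?thesis
    using assms by (simp add: char_std_normal_distribution power_mult_distrib)
qed

lemma real_distribution_normal_law:
  assumes "v \<ge> 0" shows "real_distribution (normal_law 0 v)"
proof (cases "v = 0")
  case True
  have "real_distribution (return borel (0::real))"
    by (intro real_distribution.intro prob_space_return real_distribution_axioms.intro) simp_all
  then show ?thesis using True by (simp add: normal_law_def)
next
  case False
  then have "real_distribution (density lborel (normal_density 0 (sqrt v)))"
    using assms
    by (intro real_distribution.intro prob_space_normal_density real_distribution_axioms.intro) simp_all
  then show ?thesis using False by (simp add: normal_law_def)
qed

text \<open>Since \<open>iexp\<close> is Lipschitz continuous, replacing \<open>Y n\<close> by \<open>X n\<close> changes the characteristic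
  function at \<open>u\<close> by at most \<open>\<bar>u\<bar>\<close> times their distance in mean; the continuity theorem of Levy
  then gives the result.\<close>

lemma (in prob_space) weak_conv_normal_law:
  fixes X Y :: "nat \<Rightarrow> 'a \<Rightarrow> real"
  assumes X[measurable]: "\<And>n. X n \<in> borel_measurable M" and Y[measurable]: "\<And>n. Y n \<in> borel_measurable M"
    and char: "\<And>u. (\<lambda>n. CLINT \<omega>|M. iexp (u * Y n \<omega>)) \<longlonglongrightarrow> complex_of_real (exp (- (u\<^sup>2 * v / 2)))"
    and int: "\<And>n. integrable M (\<lambda>\<omega>. X n \<omega> - Y n \<omega>)"
    and close: "(\<lambda>n. expectation (\<lambda>\<omega>. \<bar>X n \<omega> - Y n \<omega>\<bar>)) \<longlonglongrightarrow> 0"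
    and v: "v \<ge> 0"
  shows "weak_conv_m (\<lambda>n. distr M borel (X n)) (normal_law 0 v)"
proof (rule levy_continuity)
  show "real_distribution (distr M borel (X n))" for n by (rule real_distribution_distr) measurable
  show "real_distribution (normal_law 0 v)" by (rule real_distribution_normal_law[OF v])
  fix u
  let ?D = "\<lambda>n. norm ((CLINT \<omega>|M. iexp (u * X n \<omega>)) - (CLINT \<omega>|M. iexp (u * Y n \<omega>)))"
  have i: "integrable M (\<lambda>\<omega>. iexp (f \<omega>))" if "f \<in> borel_measurable M" for f :: "'a \<Rightarrow> real"
    using that by (intro integrable_bounded[of _ 1]) auto
  have "(\<lambda>n. (CLINT \<omega>|M. iexp (u * X n \<omega>)) - (CLINT \<omega>|M. iexp (u * Y n \<omega>))) \<longlonglongrightarrow> 0"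
  proof (rule Lim_null_comparison)
    have "(\<lambda>n. \<bar>u\<bar> * expectation (\<lambda>\<omega>. \<bar>X n \<omega> - Y n \<omega>\<bar>)) \<longlonglongrightarrow> \<bar>u\<bar> * 0"
      by (intro tendsto_intros close)
    then show "(\<lambda>n. \<bar>u\<bar> * expectation (\<lambda>\<omega>. \<bar>X n \<omega> - Y n \<omega>\<bar>)) \<longlonglongrightarrow> 0" by simp
    have "?D n
      \<le> \<bar>u\<bar> * expectation (\<lambda>\<omega>. \<bar>X n \<omega> - Y n \<omega>\<bar>)" for n
    proof -
      have "?D n
        = norm (CLINT \<omega>|M. iexp (u * X n \<omega>) - iexp (u * Y n \<omega>))"
        using i[of "\<lambda>\<omega>. u * X n \<omega>"] i[of "\<lambda>\<omega>. u * Y n \<omega>"] by simp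
      also have "\<dots> \<le> expectation (\<lambda>\<omega>. norm (iexp (u * X n \<omega>) - iexp (u * Y n \<omega>)))"
        by (rule integral_norm_bound)
      also have "\<dots> \<le> expectation (\<lambda>\<omega>. \<bar>u\<bar> * \<bar>X n \<omega> - Y n \<omega>\<bar>)"
      proof (rule integral_mono')
        show "integrable M (\<lambda>\<omega>. \<bar>u\<bar> * \<bar>X n \<omega> - Y n \<omega>\<bar>)" using int by simp
        fix \<omega>
        have "iexp (u * X n \<omega>) - iexp (u * Y n \<omega>) = iexp (u * Y n \<omega>) * (iexp (u * (X n \<omega> - Y n \<omega>)) - 1)"
          by (simp add: algebra_simps flip: exp_add)
        then have "norm (iexp (u * X n \<omega>) - iexp (u * Y n \<omega>)) = norm (iexp (u * (X n \<omega> - Y n \<omega>)) - 1)"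
          by (simp add: norm_mult)
        also have "\<dots> \<le> \<bar>u * (X n \<omega> - Y n \<omega>)\<bar>"
          using iexp_approx1[of "u * (X n \<omega> - Y n \<omega>)" 0] by simp
        finally show "norm (iexp (u * X n \<omega>) - iexp (u * Y n \<omega>)) \<le> \<bar>u\<bar> * \<bar>X n \<omega> - Y n \<omega>\<bar>"
          by (simp add: abs_mult)
      qed auto
      finally show ?thesis by simp
    qed
    then show "\<forall>\<^sub>F n in sequentially. ?D n
      \<le> \<bar>u\<bar> * expectation (\<lambda>\<omega>. \<bar>X n \<omega> - Y n \<omega>\<bar>)" by simp
  qed
  from tendsto_add[OF this char[of u]]
  have "(\<lambda>n. CLINT \<omega>|M. iexp (u * X n \<omega>)) \<longlonglongrightarrow> complex_of_real (exp (- (u\<^sup>2 * v / 2)))" by simp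
  then show "(\<lambda>n. char (distr M borel (X n)) u) \<longlonglongrightarrow> char (normal_law 0 v) u"
    unfolding char_normal_law[OF v] by (simp add: char_def integral_distr)
qed

section \<open>Linear functionals of the urn\<close>

context urn_process
begin

lemma R_carrier: "R \<in> carrier_mat K K"
  using stochastic_R by (simp add: stochastic_mat_def)

lemma R_row: "i < K \<Longrightarrow> probability_vec K (row R i)"
  using stochastic_R by (simp add: stochastic_mat_def)

lemma D_less: "\<omega> \<in> space M \<Longrightarrow> D (Suc n) \<omega> < K"
  using measurable_space[OF adapted_D, of \<omega> n] by (simp add: space_F)

lemma C_carrier: "\<omega> \<in> space M \<Longrightarrow> C n \<omega> \<in> carrier_vec K"
proof (induction n)
  case 0
  then show ?case using C_0 probability_c0 by (simp add: probability_vec_def)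
next
  case (Suc n)
  then show ?case using C_Suc[of \<omega> n] R_carrier by (auto simp: row_def)
qed

lemma C_Suc_nth:
  assumes "\<omega> \<in> space M" "i < K"
  shows "C (Suc n) \<omega> $ i = C n \<omega> $ i + row R (D (Suc n) \<omega>) $ i"
  using C_Suc[OF assms(1)] assms(2) R_carrier by simp

lemma C_nonneg: "\<omega> \<in> space M \<Longrightarrow> i < K \<Longrightarrow> C n \<omega> $ i \<ge> 0"
proof (induction n)
  case 0
  then show ?case using C_0 probability_c0 by (simp add: probability_vec_def)
next
  case (Suc n)
  then show ?case using C_Suc_nth[of \<omega> i n] R_row[OF D_less, of \<omega> n] by (simp add: probability_vec_def)
qed

lemma C_total: "\<omega> \<in> space M \<Longrightarrow> (\<Sum>i<K. C n \<omega> $ i) = real (Suc n)"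
proof (induction n)
  case 0
  then show ?case using C_0 probability_c0 by (simp add: probability_vec_def)
next
  case (Suc n)
  have "(\<Sum>i<K. C (Suc n) \<omega> $ i) = (\<Sum>i<K. C n \<omega> $ i + row R (D (Suc n) \<omega>) $ i)"
    using C_Suc_nth Suc by (intro sum.cong) auto
  also have "\<dots> = real (Suc n) + 1"
    using R_row[OF D_less, of \<omega> n] Suc by (simp add: sum.distrib probability_vec_def)
  finally show ?case by simp
qed

lemma C_measurable_F:
  assumes i: "i < K"
  shows "(\<lambda>\<omega>. C n \<omega> $ i) \<in> borel_measurable (F n)"
proof (induction n)
  case 0
  have "(\<lambda>\<omega>. C 0 \<omega> $ i) \<in> borel_measurable (F 0) \<longleftrightarrow> (\<lambda>\<omega>. c0 $ i) \<in> borel_measurable (F 0)"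
    by (rule measurable_cong) (simp add: space_F C_0)
  then show ?case by simp
next
  case (Suc n)
  have "(\<lambda>\<omega>. C n \<omega> $ i) \<in> borel_measurable (F (Suc n))"
    using Suc by (rule measurable_from_subalg[rotated])
      (use sets_F_mono[of n "Suc n"] in \<open>auto simp: subalgebra_def space_F\<close>)
  moreover have "(\<lambda>\<omega>. row R (D (Suc n) \<omega>) $ i) \<in> borel_measurable (F (Suc n))"
    by (rule measurable_compose[OF adapted_D]) simp
  ultimately have "(\<lambda>\<omega>. C n \<omega> $ i + row R (D (Suc n) \<omega>) $ i) \<in> borel_measurable (F (Suc n))"
    by (rule borel_measurable_add)
  also have "?this \<longleftrightarrow> (\<lambda>\<omega>. C (Suc n) \<omega> $ i) \<in> borel_measurable (F (Suc n))"
    by (rule measurable_cong) (simp add: space_F C_Suc_nth i)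
  finally show ?case .
qed

lemma C_prod: "x \<in> carrier_vec K \<Longrightarrow> C n \<omega> \<bullet> x = (\<Sum>i<K. C n \<omega> $ i * x $ i)"
  by (simp add: scalar_prod_def atLeast0LessThan)

lemma C_prod_measurable_F:
  "x \<in> carrier_vec K \<Longrightarrow> (\<lambda>\<omega>. C n \<omega> \<bullet> x) \<in> borel_measurable (F n)"
  using C_measurable_F by (auto simp: C_prod intro!: borel_measurable_sum borel_measurable_times)

lemma C_prod_measurable [measurable]:
  "x \<in> carrier_vec K \<Longrightarrow> (\<lambda>\<omega>. C n \<omega> \<bullet> x) \<in> borel_measurable M"
  by (rule measurable_from_subalg[OF subalgebra_F C_prod_measurable_F])

definition coord_bound :: "real vec \<Rightarrow> real" where
  "coord_bound x = (\<Sum>i<K. \<bar>x $ i\<bar>)"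

lemma coord_bound: "i < K \<Longrightarrow> \<bar>x $ i\<bar> \<le> coord_bound x"
  unfolding coord_bound_def by (rule member_le_sum[of i "{..<K}" "\<lambda>i. \<bar>x $ i\<bar>"]) auto

lemma C_prod_le:
  assumes x: "x \<in> carrier_vec K" and y: "y \<in> carrier_vec K" and \<omega>: "\<omega> \<in> space M"
    and le: "\<And>i. i < K \<Longrightarrow> \<bar>x $ i\<bar> \<le> y $ i"
  shows "\<bar>C n \<omega> \<bullet> x\<bar> \<le> C n \<omega> \<bullet> y"
proof -
  have "\<bar>C n \<omega> \<bullet> x\<bar> \<le> (\<Sum>i<K. \<bar>C n \<omega> $ i * x $ i\<bar>)"
    unfolding C_prod[OF x] by (rule sum_abs)
  also have "\<dots> \<le> (\<Sum>i<K. C n \<omega> $ i * y $ i)"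
    using C_nonneg[OF \<omega>] le by (intro sum_mono) (auto simp: abs_mult intro!: mult_left_mono)
  finally show ?thesis unfolding C_prod[OF y] .
qed

lemma C_prod_bounded:
  assumes x: "x \<in> carrier_vec K" and \<omega>: "\<omega> \<in> space M"
  shows "\<bar>C n \<omega> \<bullet> x\<bar> \<le> real (Suc n) * coord_bound x"
proof -
  have "\<bar>C n \<omega> \<bullet> x\<bar> \<le> C n \<omega> \<bullet> vec K (\<lambda>i. coord_bound x)"
    using x \<omega> by (intro C_prod_le) (auto intro: coord_bound)
  also have "\<dots> = (\<Sum>i<K. C n \<omega> $ i) * coord_bound x"
    by (subst C_prod) (auto simp: sum_distrib_right)
  finally show ?thesis using C_total[OF \<omega>] by simp
qed

lemma proportion_bounded:
  assumes "x \<in> carrier_vec K" "\<omega> \<in> space M"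
  shows "\<bar>C n \<omega> \<bullet> x / real (Suc n)\<bar> \<le> coord_bound x"
  using C_prod_bounded[OF assms, of n] by (simp add: abs_divide divide_le_eq mult.commute del: of_nat_Suc)

lemma C_prod_integrable: "x \<in> carrier_vec K \<Longrightarrow> integrable M (\<lambda>\<omega>. C n \<omega> \<bullet> x)"
  by (rule integrable_bounded[of _ "real (Suc n) * coord_bound x"], measurable)
    (unfold real_norm_def, rule C_prod_bounded)

text \<open>This identity contains all that is used about the law of the draws. It is obtained by
  splitting according to the drawn color and applying the conditional probability of each color.\<close>

lemma expectation_draw:
  assumes Z: "Z \<in> borel_measurable (F n)" and B: "\<And>\<omega>. \<omega> \<in> space M \<Longrightarrow> \<bar>Z \<omega>\<bar> \<le> B"
    and x: "x \<in> carrier_vec K"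
  shows "expectation (\<lambda>\<omega>. Z \<omega> * x $ D (Suc n) \<omega>) = expectation (\<lambda>\<omega>. Z \<omega> * (C n \<omega> \<bullet> x / real (Suc n)))"
proof -
  interpret FS: finite_measure_subalgebra M "F n"
    by unfold_locales (rule subalgebra_F)
  define A where "A i = {\<omega> \<in> space M. D (Suc n) \<omega> = i}" for i
  have [measurable]: "Z \<in> borel_measurable M" by (rule measurable_from_subalg[OF subalgebra_F Z])
  have A: "A i \<in> sets M" for i
  proof -
    have "A i \<in> sets (F (Suc n))"
    proof (cases "i < K")
      case True
      have "D (Suc n) -` {i} \<inter> space (F (Suc n)) \<in> sets (F (Suc n))"
        by (rule measurable_sets[OF adapted_D]) (use True in auto)
      also have "D (Suc n) -` {i} \<inter> space (F (Suc n)) = A i" by (auto simp: A_def space_F)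
      finally show ?thesis .
    next
      case False
      then have "A i = {}" using D_less by (auto simp: A_def)
      then show ?thesis by simp
    qed
    then show ?thesis using subalgebra_F[of "Suc n"] by (auto simp: subalgebra_def)
  qed
  have ind[measurable]: "(indicator (A i) :: 'a \<Rightarrow> real) \<in> borel_measurable M" for i
    using A by simp
  have iZ: "integrable M (\<lambda>\<omega>. Z \<omega> * indicator (A i) \<omega>)" for i
  proof (rule integrable_bounded[of _ "B * 1"])
    fix \<omega> assume "\<omega> \<in> space M"
    then show "norm (Z \<omega> * indicator (A i) \<omega>) \<le> B * 1"
      unfolding real_norm_def by (intro abs_mult_le B) (auto simp: indicator_def)
  qed measurable
  have iC: "integrable M (\<lambda>\<omega>. Z \<omega> * (C n \<omega> $ i / real (Suc n)))" if "i < K" for i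
  proof (rule integrable_bounded[of _ "B * 1"])
    show "(\<lambda>\<omega>. Z \<omega> * (C n \<omega> $ i / real (Suc n))) \<in> borel_measurable M"
      using measurable_from_subalg[OF subalgebra_F C_measurable_F[OF that]] by measurable
    fix \<omega> assume \<omega>: "\<omega> \<in> space M"
    have "C n \<omega> $ i \<le> (\<Sum>i<K. C n \<omega> $ i)"
      using C_nonneg[OF \<omega>] that by (intro member_le_sum) auto
    then show "norm (Z \<omega> * (C n \<omega> $ i / real (Suc n))) \<le> B * 1"
      unfolding real_norm_def using C_nonneg[OF \<omega> that, of n] C_total[OF \<omega>, of n]
      by (intro abs_mult_le B[OF \<omega>]) (auto simp: divide_le_eq)
  qed
  have step: "expectation (\<lambda>\<omega>. Z \<omega> * indicator (A i) \<omega>) = expectation (\<lambda>\<omega>. Z \<omega> * (C n \<omega> $ i / real (Suc n)))"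
    if i: "i < K" for i
  proof -
    have "expectation (\<lambda>\<omega>. Z \<omega> * indicator (A i) \<omega>) = expectation (\<lambda>\<omega>. Z \<omega> * real_cond_exp M (F n) (indicator (A i)) \<omega>)"
      by (rule FS.real_cond_exp_intg(2)[OF iZ Z ind, symmetric])
    also have "\<dots> = expectation (\<lambda>\<omega>. Z \<omega> * (C n \<omega> $ i / real (Suc n)))"
    proof (rule integral_cong_AE)
      show "(\<lambda>\<omega>. Z \<omega> * real_cond_exp M (F n) (indicator (A i)) \<omega>) \<in> borel_measurable M" by measurable
      show "(\<lambda>\<omega>. Z \<omega> * (C n \<omega> $ i / real (Suc n))) \<in> borel_measurable M" using iC[OF i] by simp
      show "AE \<omega> in M. Z \<omega> * real_cond_exp M (F n) (indicator (A i)) \<omega> = Z \<omega> * (C n \<omega> $ i / real (Suc n))"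
        using draw[OF i, of n] unfolding A_def by eventually_elim simp
    qed
    finally show ?thesis .
  qed
  have "expectation (\<lambda>\<omega>. Z \<omega> * x $ D (Suc n) \<omega>) = expectation (\<lambda>\<omega>. \<Sum>i<K. x $ i * (Z \<omega> * indicator (A i) \<omega>))"
  proof (rule Bochner_Integration.integral_cong)
    fix \<omega> assume \<omega>: "\<omega> \<in> space M"
    have "(\<Sum>i<K. x $ i * (Z \<omega> * indicator (A i) \<omega>)) = (\<Sum>i<K. if i = D (Suc n) \<omega> then Z \<omega> * x $ i else 0)"
      using \<omega> by (intro sum.cong) (auto simp: A_def indicator_def)
    then show "Z \<omega> * x $ D (Suc n) \<omega> = (\<Sum>i<K. x $ i * (Z \<omega> * indicator (A i) \<omega>))"
      using D_less[OF \<omega>] by simp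
  qed simp
  also have "\<dots> = (\<Sum>i<K. x $ i * expectation (\<lambda>\<omega>. Z \<omega> * (C n \<omega> $ i / real (Suc n))))"
    using iZ step by simp
  also have "\<dots> = expectation (\<lambda>\<omega>. \<Sum>i<K. x $ i * (Z \<omega> * (C n \<omega> $ i / real (Suc n))))"
    using iC by (subst Bochner_Integration.integral_sum) (simp_all del: of_nat_Suc times_divide_eq_right)
  also have "\<dots> = expectation (\<lambda>\<omega>. Z \<omega> * (C n \<omega> \<bullet> x / real (Suc n)))"
    by (intro Bochner_Integration.integral_cong)
      (auto simp: C_prod[OF x] sum_distrib_left sum_divide_distrib mult_ac simp del: of_nat_Suc)
  finally show ?thesis .
qed

text \<open>The deviation of the coordinate of the drawn color from its conditional mean.\<close>

definition noise :: "real vec \<Rightarrow> nat \<Rightarrow> 'a \<Rightarrow> real" where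
  "noise x n \<omega> = x $ D (Suc n) \<omega> - C n \<omega> \<bullet> x / real (Suc n)"

lemma drawn_coord_measurable_F: "(\<lambda>\<omega>. x $ D (Suc n) \<omega>) \<in> borel_measurable (F (Suc n))"
  by (rule measurable_compose[OF adapted_D]) simp

lemma drawn_coord_measurable [measurable]: "(\<lambda>\<omega>. x $ D (Suc n) \<omega>) \<in> borel_measurable M"
  by (rule measurable_from_subalg[OF subalgebra_F drawn_coord_measurable_F])

lemma integrable_times_drawn:
  fixes x :: "real vec"
  assumes Z: "Z \<in> borel_measurable M" "\<And>\<omega>. \<omega> \<in> space M \<Longrightarrow> \<bar>Z \<omega>\<bar> \<le> B"
  shows "integrable M (\<lambda>\<omega>. Z \<omega> * x $ D (Suc n) \<omega>)"
proof (rule integrable_bounded[of _ "B * coord_bound x"])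
  fix \<omega> assume "\<omega> \<in> space M"
  then show "norm (Z \<omega> * x $ D (Suc n) \<omega>) \<le> B * coord_bound x"
    unfolding real_norm_def by (intro abs_mult_le Z coord_bound D_less)
qed (use Z in measurable)

lemma integrable_times_proportion:
  assumes Z: "Z \<in> borel_measurable M" "\<And>\<omega>. \<omega> \<in> space M \<Longrightarrow> \<bar>Z \<omega>\<bar> \<le> B" and x: "x \<in> carrier_vec K"
  shows "integrable M (\<lambda>\<omega>. Z \<omega> * (C n \<omega> \<bullet> x / real (Suc n)))"
proof (rule integrable_bounded[of _ "B * coord_bound x"])
  fix \<omega> assume "\<omega> \<in> space M"
  then show "norm (Z \<omega> * (C n \<omega> \<bullet> x / real (Suc n))) \<le> B * coord_bound x"
    unfolding real_norm_def using x by (intro abs_mult_le Z proportion_bounded)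
qed (use Z x in measurable)

lemma noise_martingale_differences:
  assumes x: "x \<in> carrier_vec K"
  shows "bounded_martingale_differences M F (noise x) (2 * coord_bound x)"
proof
  fix n
  show "subalgebra M (F n)" by (rule subalgebra_F)
  have "(\<lambda>\<omega>. C n \<omega> \<bullet> x) \<in> borel_measurable (F (Suc n))"
    using C_prod_measurable_F[OF x, of n] by (rule measurable_from_subalg[rotated])
      (use sets_F_mono[of n "Suc n"] in \<open>auto simp: subalgebra_def space_F\<close>)
  then show "noise x n \<in> borel_measurable (F (Suc n))"
    unfolding noise_def by (intro borel_measurable_diff borel_measurable_divide drawn_coord_measurable_F) auto
  show "\<bar>noise x n \<omega>\<bar> \<le> 2 * coord_bound x" if "\<omega> \<in> space M" for \<omega>
    unfolding noise_def using coord_bound[OF D_less[OF that], of x n] proportion_bounded[OF x that, of n] by linarith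
  fix Z B assume Z: "Z \<in> borel_measurable (F n)" and B: "\<And>\<omega>. \<omega> \<in> space M \<Longrightarrow> \<bar>Z \<omega>\<bar> \<le> (B::real)"
  have Z': "Z \<in> borel_measurable M" by (rule measurable_from_subalg[OF subalgebra_F Z])
  have "expectation (\<lambda>\<omega>. Z \<omega> * noise x n \<omega>) =
      expectation (\<lambda>\<omega>. Z \<omega> * x $ D (Suc n) \<omega> - Z \<omega> * (C n \<omega> \<bullet> x / real (Suc n)))"
    by (simp add: noise_def algebra_simps)
  also have "\<dots> = 0"
    using expectation_draw[OF Z B x] integrable_times_drawn[OF Z' B, where x = x and n = n]
      integrable_times_proportion[OF Z' B x, where n = n] by simp
  finally show "expectation (\<lambda>\<omega>. Z \<omega> * noise x n \<omega>) = 0" .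
qed

lemma noise_measurable [measurable]: "x \<in> carrier_vec K \<Longrightarrow> noise x n \<in> borel_measurable M"
  unfolding noise_def by measurable

abbreviation square_vec :: "real vec \<Rightarrow> real vec" where
  "square_vec \<equiv> map_vec (\<lambda>t. t\<^sup>2)"

text \<open>The conditional variance of a coordinate at the drawn color is the difference between its
  conditional second moment and the square of its conditional mean.\<close>

lemma noise_conditional_second_moment:
  assumes x: "x \<in> carrier_vec K" and Z: "Z \<in> borel_measurable (F n)"
    and B: "\<And>\<omega>. \<omega> \<in> space M \<Longrightarrow> \<bar>Z \<omega>\<bar> \<le> B"
  shows "expectation (\<lambda>\<omega>. Z \<omega> * (noise x n \<omega>)\<^sup>2) =
    expectation (\<lambda>\<omega>. Z \<omega> * (C n \<omega> \<bullet> square_vec x / real (Suc n) - (C n \<omega> \<bullet> x / real (Suc n))\<^sup>2))"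
proof -
  define m where "m \<omega> = C n \<omega> \<bullet> x / real (Suc n)" for \<omega>
  have x2: "square_vec x \<in> carrier_vec K" using x by simp
  have Z': "Z \<in> borel_measurable M" by (rule measurable_from_subalg[OF subalgebra_F Z])
  have m: "m \<in> borel_measurable (F n)"
    unfolding m_def by (intro borel_measurable_divide C_prod_measurable_F x) simp
  have Zm: "(\<lambda>\<omega>. Z \<omega> * m \<omega>) \<in> borel_measurable (F n)" using Z m by (rule borel_measurable_times)
  have Zm': "(\<lambda>\<omega>. Z \<omega> * m \<omega>) \<in> borel_measurable M" by (rule measurable_from_subalg[OF subalgebra_F Zm])
  have ZmB: "\<bar>Z \<omega> * m \<omega>\<bar> \<le> B * coord_bound x" if "\<omega> \<in> space M" for \<omega>
    unfolding m_def by (intro abs_mult_le B proportion_bounded x that)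
  note i1 = integrable_times_drawn[OF Z' B, where x = "square_vec x" and n = n]
    and i2 = integrable_times_drawn[OF Zm' ZmB, where x = x and n = n]
    and i3 = integrable_times_proportion[OF Zm' ZmB x, where n = n]
    and i4 = integrable_times_proportion[OF Z' B x2, where n = n]
  have "expectation (\<lambda>\<omega>. Z \<omega> * (noise x n \<omega>)\<^sup>2) = expectation (\<lambda>\<omega>. Z \<omega> * square_vec x $ D (Suc n) \<omega>
      - 2 * (Z \<omega> * m \<omega> * x $ D (Suc n) \<omega>) + Z \<omega> * m \<omega> * (C n \<omega> \<bullet> x / real (Suc n)))"
  proof (rule Bochner_Integration.integral_cong)
    fix \<omega> assume "\<omega> \<in> space M"
    then have "square_vec x $ D (Suc n) \<omega> = (x $ D (Suc n) \<omega>)\<^sup>2" using D_less x by simp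
    then show "Z \<omega> * (noise x n \<omega>)\<^sup>2 = Z \<omega> * square_vec x $ D (Suc n) \<omega>
      - 2 * (Z \<omega> * m \<omega> * x $ D (Suc n) \<omega>) + Z \<omega> * m \<omega> * (C n \<omega> \<bullet> x / real (Suc n))"
      unfolding noise_def m_def[symmetric] by (simp add: power2_diff) (simp add: algebra_simps power2_eq_square)
  qed simp
  also have "\<dots> = expectation (\<lambda>\<omega>. Z \<omega> * square_vec x $ D (Suc n) \<omega>)
      - 2 * expectation (\<lambda>\<omega>. Z \<omega> * m \<omega> * x $ D (Suc n) \<omega>)
      + expectation (\<lambda>\<omega>. Z \<omega> * m \<omega> * (C n \<omega> \<bullet> x / real (Suc n)))"
    using i1 i2 i3 by simp
  also have "\<dots> = expectation (\<lambda>\<omega>. Z \<omega> * (C n \<omega> \<bullet> square_vec x / real (Suc n)))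
      - expectation (\<lambda>\<omega>. Z \<omega> * m \<omega> * (C n \<omega> \<bullet> x / real (Suc n)))"
    using expectation_draw[OF Z B x2] expectation_draw[OF Zm ZmB x] by simp
  also have "\<dots> = expectation (\<lambda>\<omega>. Z \<omega> * (C n \<omega> \<bullet> square_vec x / real (Suc n))
      - Z \<omega> * m \<omega> * (C n \<omega> \<bullet> x / real (Suc n)))"
    using i3 i4 by simp
  finally show ?thesis by (simp add: m_def algebra_simps power2_eq_square)
qed

lemma noise_second_moment_le:
  assumes x: "x \<in> carrier_vec K"
  shows "second_moment (noise x n) \<le> expectation (\<lambda>\<omega>. C n \<omega> \<bullet> square_vec x) / real (Suc n)"
proof -
  have "second_moment (noise x n) =
      expectation (\<lambda>\<omega>. C n \<omega> \<bullet> square_vec x / real (Suc n) - (C n \<omega> \<bullet> x / real (Suc n))\<^sup>2)"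
    using noise_conditional_second_moment[OF x, of "\<lambda>_. 1" n 1] by simp
  also have "\<dots> \<le> expectation (\<lambda>\<omega>. C n \<omega> \<bullet> square_vec x / real (Suc n))"
  proof (rule integral_mono)
    have i: "integrable M (\<lambda>\<omega>. C n \<omega> \<bullet> square_vec x / real (Suc n))"
      using C_prod_integrable[of "square_vec x" n] x by simp
    then show "integrable M (\<lambda>\<omega>. C n \<omega> \<bullet> square_vec x / real (Suc n))" .
    have "integrable M (\<lambda>\<omega>. (C n \<omega> \<bullet> x / real (Suc n))\<^sup>2)"
      by (rule integrable_square_bounded[OF _ proportion_bounded[OF x]]) (use x in measurable)
    with i show "integrable M (\<lambda>\<omega>. C n \<omega> \<bullet> square_vec x / real (Suc n) - (C n \<omega> \<bullet> x / real (Suc n))\<^sup>2)"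
      by (rule Bochner_Integration.integrable_diff)
  qed simp
  also have "\<dots> = expectation (\<lambda>\<omega>. C n \<omega> \<bullet> square_vec x) / real (Suc n)" by simp
  finally show ?thesis .
qed

lemma C_prod_Suc:
  assumes x: "x \<in> carrier_vec K" and \<omega>: "\<omega> \<in> space M"
  shows "C (Suc n) \<omega> \<bullet> x = C n \<omega> \<bullet> x + C n \<omega> \<bullet> (R *\<^sub>v x) / real (Suc n) + noise (R *\<^sub>v x) n \<omega>"
proof -
  have "C (Suc n) \<omega> \<bullet> x = C n \<omega> \<bullet> x + row R (D (Suc n) \<omega>) \<bullet> x"
    unfolding C_Suc[OF \<omega>] using C_carrier[OF \<omega>, of n] x R_carrier
    by (intro add_scalar_prod_distrib[of _ K]) auto
  moreover have "row R (D (Suc n) \<omega>) \<bullet> x = (R *\<^sub>v x) $ D (Suc n) \<omega>"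
    using D_less[OF \<omega>, of n] R_carrier by simp
  ultimately show ?thesis by (simp add: noise_def)
qed

abbreviation drift_sum :: "real vec \<Rightarrow> real \<Rightarrow> nat \<Rightarrow> 'a \<Rightarrow> real" where
  "drift_sum y \<theta> n \<omega> \<equiv> \<Sum>k<n. C k \<omega> \<bullet> y / (real (Suc k) * growth \<theta> (Suc k))"

abbreviation noise_sum :: "real vec \<Rightarrow> real \<Rightarrow> nat \<Rightarrow> 'a \<Rightarrow> real" where
  "noise_sum z \<theta> n \<omega> \<equiv> \<Sum>k<n. 1 / growth \<theta> (Suc k) * noise z k \<omega>"

text \<open>By the recursion for \<open>C n \<bullet> x\<close> one trial multiplies by \<open>1 + \<theta> / (n + 1)\<close> and adds a drift
  from \<open>y\<close> and a noise term; division by the growth factor leaves a sum.\<close>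

lemma C_prod_decomposition:
  assumes x: "x \<in> carrier_vec K" and y: "y \<in> carrier_vec K" and R: "R *\<^sub>v x = \<theta> \<cdot>\<^sub>v x + y"
    and \<theta>: "\<theta> > -1" and \<omega>: "\<omega> \<in> space M"
  shows "C n \<omega> \<bullet> x = growth \<theta> n * (c0 \<bullet> x
    + drift_sum y \<theta> n \<omega>
    + noise_sum (R *\<^sub>v x) \<theta> n \<omega>)"
proof (induction n)
  case 0
  then show ?case using C_0[OF \<omega>] by simp
next
  case (Suc n)
  define A where "A = c0 \<bullet> x
    + drift_sum y \<theta> n \<omega>
    + noise_sum (R *\<^sub>v x) \<theta> n \<omega>"
  have g: "growth \<theta> (Suc n) > 0" by (rule growth_pos[OF \<theta>])
  have Rx: "C n \<omega> \<bullet> (R *\<^sub>v x) = \<theta> * (C n \<omega> \<bullet> x) + C n \<omega> \<bullet> y"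
    unfolding R using x y C_carrier[OF \<omega>, of n] by (simp add: scalar_prod_add_distrib)
  have "C (Suc n) \<omega> \<bullet> x = (1 + \<theta> / real (Suc n)) * (C n \<omega> \<bullet> x) + C n \<omega> \<bullet> y / real (Suc n) + noise (R *\<^sub>v x) n \<omega>"
    unfolding C_prod_Suc[OF x \<omega>] Rx by (simp add: algebra_simps add_divide_distrib del: of_nat_Suc)
  also have "C n \<omega> \<bullet> x = growth \<theta> n * A" using Suc by (simp add: A_def)
  also have "(1 + \<theta> / real (Suc n)) * (growth \<theta> n * A) = growth \<theta> (Suc n) * A"
    by (simp add: growth_Suc mult_ac)
  also have "growth \<theta> (Suc n) * A + C n \<omega> \<bullet> y / real (Suc n) + noise (R *\<^sub>v x) n \<omega> =
    growth \<theta> (Suc n) * (A + C n \<omega> \<bullet> y / (real (Suc n) * growth \<theta> (Suc n))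
      + 1 / growth \<theta> (Suc n) * noise (R *\<^sub>v x) n \<omega>)"
    using g by (simp add: field_simps del: of_nat_Suc)
  finally show ?case by (simp add: A_def add_ac)
qed

lemma C_eigenvector_decomposition:
  assumes x: "x \<in> carrier_vec K" and R: "R *\<^sub>v x = \<theta> \<cdot>\<^sub>v x"
    and \<theta>: "\<theta> > -1" and \<omega>: "\<omega> \<in> space M"
  shows "C n \<omega> \<bullet> x = growth \<theta> n * (c0 \<bullet> x + noise_sum (R *\<^sub>v x) \<theta> n \<omega>)"
proof -
  have "R *\<^sub>v x = \<theta> \<cdot>\<^sub>v x + 0\<^sub>v K" using x R by simp
  from C_prod_decomposition[OF x _ this \<theta> \<omega>, of n]
  show ?thesis using C_carrier[OF \<omega>] by simp
qed

lemma expectation_eigenvector: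
  assumes x: "x \<in> carrier_vec K" and R: "R *\<^sub>v x = \<theta> \<cdot>\<^sub>v x" and \<theta>: "\<theta> > -1"
  shows "expectation (\<lambda>\<omega>. C n \<omega> \<bullet> x) = growth \<theta> n * (c0 \<bullet> x)"
proof -
  have Rx: "R *\<^sub>v x \<in> carrier_vec K" using R x by simp
  interpret N: bounded_martingale_differences M F "noise (R *\<^sub>v x)" "2 * coord_bound (R *\<^sub>v x)"
    by (rule noise_martingale_differences[OF Rx])
  have i: "integrable M (noise (R *\<^sub>v x) k)" for k
    by (rule integrable_bounded[of _ "2 * coord_bound (R *\<^sub>v x)"]) (use N.bounded in auto)
  have zero: "expectation (noise (R *\<^sub>v x) k) = 0" for k
    using N.orthogonal[of "\<lambda>_. 1" k 1] by simp
  have "expectation (\<lambda>\<omega>. C n \<omega> \<bullet> x) =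
    expectation (\<lambda>\<omega>. growth \<theta> n * (c0 \<bullet> x + noise_sum (R *\<^sub>v x) \<theta> n \<omega>))"
    by (intro Bochner_Integration.integral_cong refl C_eigenvector_decomposition[OF x R \<theta>])
  also have "\<dots> = growth \<theta> n * (c0 \<bullet> x + (\<Sum>k<n. 1 / growth \<theta> (Suc k) * expectation (noise (R *\<^sub>v x) k)))"
    using i by (simp add: prob_space)
  finally show ?thesis using zero by simp
qed

end

section \<open>Limit theorems for eigenvectors and Jordan chains\<close>

context urn_process
begin

abbreviation mean_abs :: "real vec \<Rightarrow> nat \<Rightarrow> real" where
  "mean_abs x n \<equiv> expectation (\<lambda>\<omega>. \<bar>C n \<omega> \<bullet> x\<bar>)"

lemma normalized_noise_second_moment:
  assumes z: "z \<in> carrier_vec K" and \<theta>: "\<theta> > -1"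
    and v: "\<And>k. second_moment (noise z k) \<le> c * real (Suc k) powr (p - 1)"
  shows "\<exists>c'\<ge>0. \<forall>k. (1 / growth \<theta> (Suc k))\<^sup>2 * second_moment (noise z k)
    \<le> c' * real (Suc k) powr (p - 1 - 2 * \<theta>)"
proof -
  interpret N: bounded_martingale_differences M F "noise z" "2 * coord_bound z"
    by (rule noise_martingale_differences[OF z])
  have c: "c \<ge> 0" using order_trans[OF N.second_moment_nonneg v[of 0]] by simp
  obtain g where g: "g > 0" "\<And>n. n > 0 \<Longrightarrow> 1 / growth \<theta> n \<le> g * real n powr (-\<theta>)"
    using growth_bounds[OF \<theta>] by blast
  have "(1 / growth \<theta> (Suc k))\<^sup>2 * second_moment (noise z k)
      \<le> (g\<^sup>2 * c) * real (Suc k) powr (p - 1 - 2 * \<theta>)" for k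
  proof -
    have "(1 / growth \<theta> (Suc k))\<^sup>2 \<le> (g * real (Suc k) powr (-\<theta>))\<^sup>2"
      using g(2)[of "Suc k"] growth_pos[OF \<theta>, of "Suc k"] by (intro power_mono) auto
    then have "(1 / growth \<theta> (Suc k))\<^sup>2 * second_moment (noise z k)
      \<le> (g * real (Suc k) powr (-\<theta>))\<^sup>2 * (c * real (Suc k) powr (p - 1))"
      by (intro mult_mono v N.second_moment_nonneg) auto
    also have "\<dots> = g\<^sup>2 * c * (real (Suc k) powr (-\<theta>) * real (Suc k) powr (-\<theta>) * real (Suc k) powr (p - 1))"
      by (simp add: power2_eq_square)
    also have "real (Suc k) powr (-\<theta>) * real (Suc k) powr (-\<theta>) * real (Suc k) powr (p - 1) = real (Suc k) powr (p - 1 - 2 * \<theta>)"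
      unfolding powr_add[symmetric] by (simp add: algebra_simps)
    finally show ?thesis .
  qed
  then show ?thesis using c by (intro exI[of _ "g\<^sup>2 * c"]) auto
qed

text \<open>The normalized functional is a martingale whose \<open>k\<close>-th increment has a second moment of order
  \<open>k\<^bsup>p - 1 - 2 \<theta>\<^esup>\<close>, which is summable for \<open>p < 2 \<theta>\<close>.\<close>

lemma eigenvector_converges:
  assumes x: "x \<in> carrier_vec K" and R: "R *\<^sub>v x = \<theta> \<cdot>\<^sub>v x" and \<theta>: "\<theta> > -1"
    and p: "p < 2 * \<theta>"
    and v: "\<And>k. second_moment (noise (R *\<^sub>v x) k) \<le> c * real (Suc k) powr (p - 1)"
  shows "\<exists>L. converges_as_L2 M (\<lambda>n \<omega>. C n \<omega> \<bullet> x / growth \<theta> n) L"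
proof -
  let ?z = "R *\<^sub>v x"
  have Rx: "?z \<in> carrier_vec K" using R x by simp
  interpret N: bounded_martingale_differences M F "noise ?z" "2 * coord_bound ?z"
    by (rule noise_martingale_differences[OF Rx])
  obtain c' where c': "c' \<ge> 0" "\<And>k. (1 / growth \<theta> (Suc k))\<^sup>2 * second_moment (noise ?z k)
      \<le> c' * real (Suc k) powr (p - 1 - 2 * \<theta>)"
    using normalized_noise_second_moment[OF Rx \<theta> v] by blast
  have "summable (\<lambda>k. (1 / growth \<theta> (Suc k))\<^sup>2 * second_moment (noise ?z k))"
  proof (rule summable_comparison_test')
    have "summable (\<lambda>k. real (Suc k) powr (p - 1 - 2 * \<theta>))"
      using p summable_Suc_iff[of "\<lambda>k. real k powr (p - 1 - 2 * \<theta>)"] by (simp add: summable_real_powr_iff)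
    then show "summable (\<lambda>k. c' * real (Suc k) powr (p - 1 - 2 * \<theta>))" by (rule summable_mult)
    show "norm ((1 / growth \<theta> (Suc k))\<^sup>2 * second_moment (noise ?z k))
        \<le> c' * real (Suc k) powr (p - 1 - 2 * \<theta>)" for k
      using c'(2)[of k] N.second_moment_nonneg[of k] by simp
  qed
  from N.converges_as_L2_sum[OF this] obtain L where
    L: "converges_as_L2 M (\<lambda>n \<omega>. noise_sum ?z \<theta> n \<omega>) L" by blast
  have "converges_as_L2 M (\<lambda>n \<omega>. c0 \<bullet> x + noise_sum ?z \<theta> n \<omega>) (\<lambda>\<omega>. c0 \<bullet> x + L \<omega>)"
    by (intro converges_as_L2_add converges_as_L2_const L tendsto_const)
  also have "?this \<longleftrightarrow> converges_as_L2 M (\<lambda>n \<omega>. C n \<omega> \<bullet> x / growth \<theta> n) (\<lambda>\<omega>. c0 \<bullet> x + L \<omega>)"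
    by (rule converges_as_L2_cong)
      (use growth_pos[OF \<theta>] C_eigenvector_decomposition[OF x R \<theta>] in \<open>simp add: less_imp_neq[symmetric]\<close>)
  finally show ?thesis by blast
qed

text \<open>In the decomposition of \<open>C n \<bullet> x / growth \<theta> n\<close> the drift is a sum of the terms
  \<open>C k \<bullet> y / growth \<theta> k\<close> with weights asymptotic to \<open>1 / k\<close>. Since these terms converge to \<open>L\<close>
  and the weights sum up to about \<open>ln n\<close>, the drift divided by \<open>ln n\<close> converges to \<open>L\<close>. The
  noise is negligible on this scale: for \<open>\<theta> \<ge> 1/2\<close> the squares of \<open>1 / growth \<theta> k\<close> are at most of
  order \<open>1 / k\<close>, so that after division by \<open>ln k\<close> the noise terms have a convergent sum, and
  Kronecker's lemma applies.\<close>

lemma jordan_chain_converges: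
  assumes x: "x \<in> carrier_vec K" and y: "y \<in> carrier_vec K" and R: "R *\<^sub>v x = \<theta> \<cdot>\<^sub>v x + y"
    and \<theta>: "\<theta> \<ge> 1/2"
    and L: "converges_as_L2 M (\<lambda>n \<omega>. C n \<omega> \<bullet> y / growth \<theta> n) L"
  shows "converges_as_L2 M (\<lambda>n \<omega>. C n \<omega> \<bullet> x / (growth \<theta> n * ln (real n))) L"
proof -
  let ?z = "R *\<^sub>v x"
  have \<theta>1: "\<theta> > -1" using \<theta> by simp
  have Rx: "?z \<in> carrier_vec K" using R x y by simp
  interpret N: bounded_martingale_differences M F "noise ?z" "2 * coord_bound ?z"
    by (rule noise_martingale_differences[OF Rx])
  obtain g where g: "g > 0" "\<And>n. n > 0 \<Longrightarrow> 1 / growth \<theta> n \<le> g * real n powr (-\<theta>)"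
    using growth_bounds[OF \<theta>1] by blast
  (* The shift by 2 keeps h positive from index 0 on. *)
  define h where "h k = ln (real (k + 2))" for k
  have h: "incseq h" "\<And>k. h k > 0" by (auto simp: h_def incseq_def)
  have hF: "filterlim h at_top sequentially" unfolding h_def by real_asymp
  define w where "w k = 1 / (real (Suc k) + \<theta>)" for k
  have w: "w k \<ge> 0" for k using \<theta> by (simp add: w_def)
  let ?drift = "\<lambda>n \<omega>. \<Sum>k<n. w k * (C k \<omega> \<bullet> y / growth \<theta> k)"
  let ?W = "\<lambda>n. \<Sum>k<n. w k"
  let ?B = "\<lambda>k. g\<^sup>2 * (2 * coord_bound ?z)\<^sup>2 * (1 / (real (Suc k) * (ln (real (k + 2)))\<^sup>2))"
  let ?sum = "\<lambda>n \<omega>. c0 \<bullet> x / ln (real n)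
      + ?W n / ln (real n) * (?drift n \<omega> / ?W n)
      + h n / ln (real n) * (noise_sum ?z \<theta> n \<omega> / h n)"
  have wh: "(\<lambda>n. ?W n / ln (real n)) \<longlonglongrightarrow> 1"
  proof -
    (* The weights are compared with the increments of h, whose sums telescope. *)
    define w' where "w' k = h (Suc k) - h k" for k
    have w': "w' k > 0" for k by (simp add: w'_def h_def)
    have W': "(\<Sum>k<n. w' k) = h n - h 0" for n unfolding w'_def by (rule sum_lessThan_telescope)
    have F': "filterlim (\<lambda>n. \<Sum>k<n. w' k) at_top sequentially"
      unfolding W' h_def by real_asymp
    have "(\<lambda>k. w k / w' k) \<longlonglongrightarrow> 1" unfolding w_def w'_def h_def by real_asymp
    from toeplitz_mean_tendsto[OF less_imp_le[OF w'] F' this]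
    have "(\<lambda>n. (\<Sum>k<n. w' k * (w k / w' k)) / (h n - h 0)) \<longlonglongrightarrow> 1" unfolding W' .
    then have "(\<lambda>n. ?W n / (h n - h 0)) \<longlonglongrightarrow> 1" using w' by (simp add: less_imp_neq[symmetric])
    moreover have "(\<lambda>n. (h n - h 0) / ln (real n)) \<longlonglongrightarrow> 1" unfolding h_def by real_asymp
    ultimately have "(\<lambda>n. ?W n / (h n - h 0) * ((h n - h 0) / ln (real n))) \<longlonglongrightarrow> 1 * 1"
      by (rule tendsto_mult)
    then have "(\<lambda>n. ?W n / (h n - h 0) * ((h n - h 0) / ln (real n))) \<longlonglongrightarrow> 1"
      by (simp only: mult_1_right)
    moreover have "\<forall>\<^sub>F n in sequentially. ?W n / (h n - h 0) * ((h n - h 0) / ln (real n)) = ?W n / ln (real n)"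
      using eventually_gt_at_top[of 0] by eventually_elim (simp add: h_def)
    ultimately show ?thesis by (rule Lim_transform_eventually)
  qed
  have lnF: "filterlim (\<lambda>n. ln (real n)) at_top sequentially" by real_asymp
  have WF: "filterlim (\<lambda>n. \<Sum>k<n. w k) at_top sequentially"
  proof -
    have "filterlim (\<lambda>n. ?W n / ln (real n) * ln (real n)) at_top sequentially"
      by (rule filterlim_tendsto_pos_mult_at_top[OF wh _ lnF]) simp
    moreover have "\<forall>\<^sub>F n in sequentially. ?W n / ln (real n) * ln (real n) = ?W n"
      using eventually_gt_at_top[of 1] by eventually_elim simp
    ultimately show ?thesis by (rule filterlim_cong[OF refl refl, THEN iffD1, rotated])
  qed
  have drift: "converges_as_L2 M
     (\<lambda>n \<omega>. ?W n / ln (real n) * (?drift n \<omega> / ?W n)) (\<lambda>\<omega>. 1 * L \<omega>)"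
    by (intro converges_as_L2_scale[OF _ wh] converges_as_L2_toeplitz L w WF)
  have v: "summable (\<lambda>k. (1 / growth \<theta> (Suc k) / h k)\<^sup>2 * second_moment (noise ?z k))"
  proof (rule summable_comparison_test)
    show "summable (\<lambda>k. ?B k)"
      by (intro summable_mult summable_inverse_square_log)
    have "norm ((1 / growth \<theta> (Suc k) / h k)\<^sup>2 * second_moment (noise ?z k))
       \<le> ?B k" for k
    proof -
      have "1 / growth \<theta> (Suc k) \<le> g * real (Suc k) powr (-\<theta>)" by (rule g) simp
      also have "\<dots> \<le> g * real (Suc k) powr (-1/2)" using \<theta> g by (intro mult_left_mono powr_mono) auto
      finally have "(1 / growth \<theta> (Suc k))\<^sup>2 \<le> (g * real (Suc k) powr (-1/2))\<^sup>2"
        using growth_pos[OF \<theta>1, of "Suc k"] by (intro power_mono) auto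
      also have "\<dots> = g\<^sup>2 * (real (Suc k) powr (-1/2) * real (Suc k) powr (-1/2))"
        by (simp add: power2_eq_square)
      also have "\<dots> = g\<^sup>2 / real (Suc k)"
        unfolding powr_add[symmetric] by (simp add: powr_minus_divide del: of_nat_Suc)
      finally have "(1 / growth \<theta> (Suc k))\<^sup>2 / (h k)\<^sup>2 * second_moment (noise ?z k)
          \<le> g\<^sup>2 / real (Suc k) / (h k)\<^sup>2 * (2 * coord_bound ?z)\<^sup>2"
        by (intro mult_mono divide_right_mono N.second_moment_le N.second_moment_nonneg) auto
      also have "\<dots> = ?B k"
        by (simp add: h_def)
      finally show ?thesis using N.second_moment_nonneg[of k] by (simp add: power_divide power_mult_distrib)
    qed
    then show "\<exists>N. \<forall>k\<ge>N. norm ((1 / growth \<theta> (Suc k) / h k)\<^sup>2 * second_moment (noise ?z k))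
       \<le> ?B k" by blast
  qed
  obtain L' where "converges_as_L2 M (\<lambda>n \<omega>. \<Sum>k<n. 1 / growth \<theta> (Suc k) / h k * noise ?z k \<omega>) L'"
    using N.converges_as_L2_sum[OF v] by blast
  then have "converges_as_L2 M (\<lambda>n \<omega>. \<Sum>k<n. (1 / growth \<theta> (Suc k) * noise ?z k \<omega>) / h k) L'" by simp
  from converges_as_L2_kronecker[OF this h hF]
  have kr: "converges_as_L2 M (\<lambda>n \<omega>. noise_sum ?z \<theta> n \<omega> / h n) (\<lambda>\<omega>. 0)" .
  have hl: "(\<lambda>n. h n / ln (real n)) \<longlonglongrightarrow> 1" unfolding h_def by real_asymp
  have mart: "converges_as_L2 M
     (\<lambda>n \<omega>. h n / ln (real n) * (noise_sum ?z \<theta> n \<omega> / h n)) (\<lambda>\<omega>. 1 * 0)"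
    by (rule converges_as_L2_scale[OF kr hl])
  have "(\<lambda>n. c0 \<bullet> x / ln (real n)) \<longlonglongrightarrow> 0" by real_asymp
  from converges_as_L2_add[OF converges_as_L2_add[OF converges_as_L2_const[OF this] drift] mart]
  have "converges_as_L2 M (\<lambda>n \<omega>. ?sum n \<omega>) L"
    by simp
  also have "?this \<longleftrightarrow> converges_as_L2 M (\<lambda>n \<omega>. C n \<omega> \<bullet> x / (growth \<theta> n * ln (real n))) L"
  proof (rule converges_as_L2_cong)
    fix n \<omega> assume \<omega>: "\<omega> \<in> space M"
    have "real (Suc k) * growth \<theta> (Suc k) = growth \<theta> k * (real (Suc k) + \<theta>)" for k
      by (simp add: growth_Suc field_simps)
    then have drift_eq: "?drift n \<omega> = drift_sum y \<theta> n \<omega>"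
      by (simp add: w_def mult_ac del: of_nat_Suc)
    have Wn: "?drift n \<omega> = 0" if "?W n = 0"
    proof -
      have "w k \<noteq> 0" for k using \<theta> by (simp add: w_def)
      moreover have "\<forall>k\<in>{..<n}. w k = 0" using that w by (subst (asm) sum_nonneg_eq_0_iff) auto
      ultimately have "n = 0" by (metis lessThan_iff neq0_conv)
      then show ?thesis by simp
    qed
    have "C n \<omega> \<bullet> x / (growth \<theta> n * ln (real n)) = (c0 \<bullet> x
      + ?drift n \<omega>
      + noise_sum ?z \<theta> n \<omega>) / ln (real n)"
      unfolding drift_eq C_prod_decomposition[OF x y R \<theta>1 \<omega>, of n] using growth_pos[OF \<theta>1, of n] by simp
    also have "\<dots> = ?sum n \<omega>"
    proof -
      have "?W n / ln (real n) * (?drift n \<omega> / ?W n)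
        = ?drift n \<omega> / ln (real n)"
        using Wn by (cases "?W n = 0") simp_all
      moreover have "h n / ln (real n) * (noise_sum ?z \<theta> n \<omega> / h n)
        = noise_sum ?z \<theta> n \<omega> / ln (real n)"
        using h(2)[of n] by simp
      ultimately show ?thesis by (simp only: add_divide_distrib)
    qed
    finally show "?sum n \<omega>
      = C n \<omega> \<bullet> x / (growth \<theta> n * ln (real n))" ..
  qed
  finally show ?thesis .
qed

text \<open>The second moment of the martingale \<open>C n \<bullet> x / growth \<theta> n\<close> is a constant plus a sum of terms
  at most of order \<open>k\<^bsup>p - 1 - 2 \<theta>\<^esup>\<close>. Enlarging \<open>p\<close> to \<open>2 q\<close> with \<open>q > \<theta>\<close> makes the exponent larger
  than \<open>-1\<close>, so that the sum is at most of order \<open>n\<^bsup>2 q - 2 \<theta>\<^esup>\<close>.\<close>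

lemma eigenvector_second_moment:
  assumes x: "x \<in> carrier_vec K" and R: "R *\<^sub>v x = \<theta> \<cdot>\<^sub>v x" and \<theta>: "\<theta> > -1"
    and q: "\<theta> < q" "0 \<le> q" "p \<le> 2 * q"
    and v: "\<And>k. second_moment (noise (R *\<^sub>v x) k) \<le> c * real (Suc k) powr (p - 1)"
  shows "\<exists>c'. \<forall>n. expectation (\<lambda>\<omega>. (C n \<omega> \<bullet> x)\<^sup>2) \<le> c' * real (Suc n) powr (2 * q)"
proof -
  let ?z = "R *\<^sub>v x"
  have Rx: "?z \<in> carrier_vec K" using R x by simp
  interpret N: bounded_martingale_differences M F "noise ?z" "2 * coord_bound ?z"
    by (rule noise_martingale_differences[OF Rx])
  obtain g where g: "g > 0" "\<And>n. n > 0 \<Longrightarrow> growth \<theta> n \<le> g * real n powr \<theta>"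
    using growth_bounds[OF \<theta>] by blast
  obtain c' where c': "c' \<ge> 0" "\<And>k. (1 / growth \<theta> (Suc k))\<^sup>2 * second_moment (noise ?z k)
      \<le> c' * real (Suc k) powr (p - 1 - 2 * \<theta>)"
    using normalized_noise_second_moment[OF Rx \<theta> v] by blast
  have "2 * (q - \<theta>) > 0" using q by simp
  from power_sum_bounded[OF this, of c'] obtain c1 where
    c1: "c1 \<ge> 0" "\<And>n. (\<Sum>k<n. c' * real (Suc k) powr (2 * (q - \<theta>) - 1)) \<le> c1 * real n powr (2 * (q - \<theta>))"
    by blast
  define e where "e = 2 * (c0 \<bullet> x)\<^sup>2"
  have e: "e \<ge> 0" by (simp add: e_def)
  have bound: "expectation (\<lambda>\<omega>. (C n \<omega> \<bullet> x)\<^sup>2) \<le> (g\<^sup>2 * (e + 2 * c1)) * real n powr (2 * q)" if n: "n > 0" for n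
  proof -
    define S where "S \<omega> = noise_sum ?z \<theta> n \<omega>" for \<omega>
    have ES: "second_moment S \<le> c1 * real n powr (2 * (q - \<theta>))"
    proof -
      have "second_moment S = (\<Sum>k<n. (1 / growth \<theta> (Suc k))\<^sup>2 * second_moment (noise ?z k))"
        unfolding S_def by (rule N.deterministic_sum_second_moment)
      also have "\<dots> \<le> (\<Sum>k<n. c' * real (Suc k) powr (2 * (q - \<theta>) - 1))"
        using c' q by (intro sum_mono order_trans[OF c'(2)] mult_left_mono powr_mono) auto
      also note c1(2)
      finally show ?thesis .
    qed
    have "expectation (\<lambda>\<omega>. (C n \<omega> \<bullet> x)\<^sup>2) = expectation (\<lambda>\<omega>. (growth \<theta> n)\<^sup>2 * (c0 \<bullet> x + S \<omega>)\<^sup>2)"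
      by (intro Bochner_Integration.integral_cong refl)
        (simp add: C_eigenvector_decomposition[OF x R \<theta>] S_def power_mult_distrib)
    also have "\<dots> = (growth \<theta> n)\<^sup>2 * expectation (\<lambda>\<omega>. (c0 \<bullet> x + S \<omega>)\<^sup>2)" by simp
    also have "expectation (\<lambda>\<omega>. (c0 \<bullet> x + S \<omega>)\<^sup>2) \<le> 2 * expectation (\<lambda>\<omega>. (c0 \<bullet> x)\<^sup>2) + 2 * second_moment S"
      unfolding S_def by (intro integral_square_add_le N.square_integrable_sum) auto
    also have "\<dots> \<le> e + 2 * (c1 * real n powr (2 * (q - \<theta>)))"
      using ES by (simp add: e_def prob_space)
    also have "\<dots> \<le> (e + 2 * c1) * real n powr (2 * (q - \<theta>))"
    proof -
      have "e * 1 \<le> e * real n powr (2 * (q - \<theta>))"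
        using n q e by (intro mult_left_mono ge_one_powr_ge_zero) auto
      then show ?thesis by (simp add: algebra_simps)
    qed
    also have "(growth \<theta> n)\<^sup>2 * ((e + 2 * c1) * real n powr (2 * (q - \<theta>))) \<le>
        (g * real n powr \<theta>)\<^sup>2 * ((e + 2 * c1) * real n powr (2 * (q - \<theta>)))"
      using g(2)[OF n] growth_pos[OF \<theta>, of n] e c1 by (intro mult_right_mono power_mono) auto
    also have "\<dots> = (g\<^sup>2 * (e + 2 * c1)) * (real n powr \<theta> * real n powr \<theta> * real n powr (2 * (q - \<theta>)))"
      by (simp add: power2_eq_square)
    also have "real n powr \<theta> * real n powr \<theta> * real n powr (2 * (q - \<theta>)) = real n powr (2 * q)"
      unfolding powr_add[symmetric] by (simp add: algebra_simps)
    finally show ?thesis by (simp add: mult_left_mono)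
  qed
  define B where "B = \<bar>g\<^sup>2 * (e + 2 * c1)\<bar> + (c0 \<bullet> x)\<^sup>2"
  have "expectation (\<lambda>\<omega>. (C n \<omega> \<bullet> x)\<^sup>2) \<le> B * real (Suc n) powr (2 * q)" for n
  proof (cases "n = 0")
    case True
    have "expectation (\<lambda>\<omega>. (C 0 \<omega> \<bullet> x)\<^sup>2) = expectation (\<lambda>\<omega>. (c0 \<bullet> x)\<^sup>2)"
      by (intro Bochner_Integration.integral_cong) (auto simp: C_0)
    with True show ?thesis by (simp add: prob_space B_def)
  next
    case False
    then have "expectation (\<lambda>\<omega>. (C n \<omega> \<bullet> x)\<^sup>2) \<le> (g\<^sup>2 * (e + 2 * c1)) * real n powr (2 * q)"
      by (intro bound) simp
    also have "\<dots> \<le> B * real (Suc n) powr (2 * q)"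
    proof (intro mult_mono powr_mono2)
      show "g\<^sup>2 * (e + 2 * c1) \<le> B"
        unfolding B_def using abs_ge_self[of "g\<^sup>2 * (e + 2 * c1)"] zero_le_power2[of "c0 \<bullet> x"] by linarith
    qed (use q in \<open>auto simp: B_def\<close>)
    finally show ?thesis .
  qed
  then show ?thesis by blast
qed

text \<open>For \<open>\<theta> < 1/2\<close> the noise in a Jordan chain is of order \<open>sqrt n\<close>. If \<open>C k \<bullet> y\<close> is of
  order \<open>k\<^sup>\<eta>\<close> in mean, with \<open>\<theta> < \<eta> < 1/2\<close>, then so is the contribution of the drift, which is therefore
  negligible.\<close>

context
  fixes x y :: "real vec" and \<theta> \<eta> c :: real
  assumes x: "x \<in> carrier_vec K" and y: "y \<in> carrier_vec K" and R: "R *\<^sub>v x = \<theta> \<cdot>\<^sub>v x + y"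
    and \<theta>: "-1 < \<theta>" "\<theta> < 1/2"
    and \<eta>: "\<theta> < \<eta>" "\<eta> < 1/2"
    and Ey: "\<And>k. mean_abs y k \<le> c * real (Suc k) powr \<eta>"
begin

abbreviation (input) drift :: "nat \<Rightarrow> 'a \<Rightarrow> real" where
  "drift n \<omega> \<equiv> growth \<theta> n * (c0 \<bullet> x + drift_sum y \<theta> n \<omega>)"

abbreviation (input) weight :: "nat \<Rightarrow> nat \<Rightarrow> real" where
  "weight n k \<equiv> growth \<theta> n / (sqrt (real n) * growth \<theta> (Suc k))"

lemma scaled_drift_tendsto_0:
  shows "integrable M (\<lambda>\<omega>. drift n \<omega> / sqrt (real n))"
    and "(\<lambda>n. expectation (\<lambda>\<omega>. \<bar>drift n \<omega> / sqrt (real n)\<bar>)) \<longlonglongrightarrow> 0"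
proof -
  let ?a = "\<lambda>k \<omega>. C k \<omega> \<bullet> y / (real (Suc k) * growth \<theta> (Suc k))"
  obtain g where g: "g > 0" "\<And>n. n > 0 \<Longrightarrow> growth \<theta> n \<le> g * real n powr \<theta>"
    "\<And>n. n > 0 \<Longrightarrow> 1 / growth \<theta> n \<le> g * real n powr (-\<theta>)"
    using growth_bounds[OF \<theta>(1)] by blast
  have "\<eta> - \<theta> > 0" using \<eta> by simp
  from power_sum_bounded[OF this, of "c * g"] obtain c1 where
    c1: "c1 \<ge> 0" "\<And>n. (\<Sum>k<n. c * g * real (Suc k) powr (\<eta> - \<theta> - 1)) \<le> c1 * real n powr (\<eta> - \<theta>)"
    by blast
  have iC: "integrable M (\<lambda>\<omega>. ?a k \<omega>)" for k
    using C_prod_integrable[OF y] by (rule integrable_divide)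
  then have i: "integrable M (\<lambda>\<omega>. drift n \<omega>)" for n
    by (intro integrable_mult_right Bochner_Integration.integrable_add
        Bochner_Integration.integrable_sum) auto
  then show "integrable M (\<lambda>\<omega>. drift n \<omega> / sqrt (real n))" for n by (rule integrable_divide)
  define A where "A = g * (\<bar>c0 \<bullet> x\<bar> + c1)"
  have bound: "expectation (\<lambda>\<omega>. \<bar>drift n \<omega>\<bar>) \<le> A * real n powr \<eta>" if n: "n > 0" for n
  proof -
    have "expectation (\<lambda>\<omega>. \<bar>drift n \<omega>\<bar>) \<le> expectation (\<lambda>\<omega>. growth \<theta> n *
        (\<bar>c0 \<bullet> x\<bar> + (\<Sum>k<n. \<bar>?a k \<omega>\<bar>)))"
    proof (rule integral_mono)
      show "integrable M (\<lambda>\<omega>. \<bar>drift n \<omega>\<bar>)" using i by simp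
      show "integrable M (\<lambda>\<omega>. growth \<theta> n * (\<bar>c0 \<bullet> x\<bar> + (\<Sum>k<n. \<bar>?a k \<omega>\<bar>)))"
        using iC by (intro integrable_mult_right Bochner_Integration.integrable_add
          Bochner_Integration.integrable_sum integrable_abs) auto
      fix \<omega>
      have "\<bar>c0 \<bullet> x + drift_sum y \<theta> n \<omega>\<bar>
          \<le> \<bar>c0 \<bullet> x\<bar> + (\<Sum>k<n. \<bar>?a k \<omega>\<bar>)"
        by (intro order_trans[OF abs_triangle_ineq] add_mono sum_abs order_refl)
      then show "\<bar>drift n \<omega>\<bar> \<le> growth \<theta> n * (\<bar>c0 \<bullet> x\<bar> + (\<Sum>k<n. \<bar>?a k \<omega>\<bar>))"
        unfolding abs_mult using growth_pos[OF \<theta>(1), of n] by (simp add: mult_left_mono)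
    qed
    also have "\<dots> = growth \<theta> n * (\<bar>c0 \<bullet> x\<bar> + (\<Sum>k<n. expectation (\<lambda>\<omega>. \<bar>?a k \<omega>\<bar>)))"
      using integrable_abs[OF iC] by (simp add: prob_space)
    also have "\<dots> \<le> growth \<theta> n * (\<bar>c0 \<bullet> x\<bar> + (\<Sum>k<n. c * g * real (Suc k) powr (\<eta> - \<theta> - 1)))"
    proof (intro mult_left_mono add_mono sum_mono order_refl)
      fix k
      have gp: "growth \<theta> (Suc k) > 0" by (rule growth_pos[OF \<theta>(1)])
      have "expectation (\<lambda>\<omega>. \<bar>?a k \<omega>\<bar>)
          = mean_abs y k * (1 / growth \<theta> (Suc k)) * (1 / real (Suc k))"
        using gp by (simp add: abs_divide abs_mult)
      also have "\<dots> \<le> (c * real (Suc k) powr \<eta>) * (g * real (Suc k) powr (-\<theta>)) * (1 / real (Suc k))"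
        using Ey[of k] g(3)[of "Suc k"] gp
        by (intro mult_right_mono mult_mono order_trans[OF _ Ey[of k]]) auto
      also have "1 / real (Suc k) = real (Suc k) powr (-1)" by (simp add: powr_minus_divide)
      also have "(c * real (Suc k) powr \<eta>) * (g * real (Suc k) powr (-\<theta>)) * real (Suc k) powr (-1)
          = c * g * (real (Suc k) powr \<eta> * real (Suc k) powr (-\<theta>) * real (Suc k) powr (-1))" by simp
      also have "real (Suc k) powr \<eta> * real (Suc k) powr (-\<theta>) * real (Suc k) powr (-1) = real (Suc k) powr (\<eta> - \<theta> - 1)"
        unfolding powr_add[symmetric] by (simp add: algebra_simps)
      finally show "expectation (\<lambda>\<omega>. \<bar>?a k \<omega>\<bar>)
          \<le> c * g * real (Suc k) powr (\<eta> - \<theta> - 1)" .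
    qed (use growth_pos[OF \<theta>(1), of n] in simp)
    also have "\<dots> \<le> growth \<theta> n * (\<bar>c0 \<bullet> x\<bar> * real n powr (\<eta> - \<theta>) + c1 * real n powr (\<eta> - \<theta>))"
    proof (intro mult_left_mono add_mono c1)
      have "\<bar>c0 \<bullet> x\<bar> * 1 \<le> \<bar>c0 \<bullet> x\<bar> * real n powr (\<eta> - \<theta>)"
        using n \<eta> by (intro mult_left_mono ge_one_powr_ge_zero) auto
      then show "\<bar>c0 \<bullet> x\<bar> \<le> \<bar>c0 \<bullet> x\<bar> * real n powr (\<eta> - \<theta>)" by simp
    qed (use growth_pos[OF \<theta>(1), of n] in simp)
    also have "\<dots> \<le> (g * real n powr \<theta>) * (\<bar>c0 \<bullet> x\<bar> * real n powr (\<eta> - \<theta>) + c1 * real n powr (\<eta> - \<theta>))"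
      using c1 by (intro mult_right_mono g n) auto
    also have "\<dots> = A * (real n powr \<theta> * real n powr (\<eta> - \<theta>))" by (simp add: A_def algebra_simps)
    also have "real n powr \<theta> * real n powr (\<eta> - \<theta>) = real n powr \<eta>" by (simp flip: powr_add)
    finally show ?thesis .
  qed
  show "(\<lambda>n. expectation (\<lambda>\<omega>. \<bar>drift n \<omega> / sqrt (real n)\<bar>)) \<longlonglongrightarrow> 0"
  proof (rule tendsto_sandwich[OF _ _ tendsto_const])
    show "(\<lambda>n. A * real n powr \<eta> / sqrt (real n)) \<longlonglongrightarrow> 0" using \<eta> by real_asymp
    show "\<forall>\<^sub>F n in sequentially. expectation (\<lambda>\<omega>. \<bar>drift n \<omega> / sqrt (real n)\<bar>) \<le> A * real n powr \<eta> / sqrt (real n)"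
      using eventually_gt_at_top[of 0]
      by eventually_elim (use bound in \<open>simp add: abs_divide divide_right_mono\<close>)
  qed (auto intro!: always_eventually Bochner_Integration.integral_nonneg)
qed

text \<open>The squares of the weights behave like \<open>n\<^bsup>2 \<theta> - 1\<^esup> k\<^bsup>-2 \<theta>\<^esup>\<close>; the constants in the
  asymptotics of the two growth factors cancel.\<close>

lemma weights_square_sum_tendsto:
  "(\<lambda>n. \<Sum>k<n. (weight n k)\<^sup>2) \<longlonglongrightarrow> 1 / (1 - 2 * \<theta>)"
proof -
  obtain g where g: "g > 0" "(\<lambda>n. growth \<theta> n / real n powr \<theta>) \<longlonglongrightarrow> g"
    using growth_asymptotics[OF \<theta>(1)] by blast
  define f where "f k = (1 / growth \<theta> (Suc k))\<^sup>2" for k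
  have "(\<lambda>k. inverse ((growth \<theta> (Suc k) / real (Suc k) powr \<theta>)\<^sup>2)) \<longlonglongrightarrow> inverse (g\<^sup>2)"
    using g by (intro tendsto_inverse tendsto_power LIMSEQ_Suc) auto
  also have "(\<lambda>k. inverse ((growth \<theta> (Suc k) / real (Suc k) powr \<theta>)\<^sup>2)) =
      (\<lambda>k. f k / real (Suc k) powr ((1 - 2 * \<theta>) - 1))"
  proof
    fix k
    have eq: "real (Suc k) powr ((1 - 2 * \<theta>) - 1) = inverse ((real (Suc k) powr \<theta>)\<^sup>2)"
      by (simp add: powr_minus power2_eq_square flip: powr_add)
    show "inverse ((growth \<theta> (Suc k) / real (Suc k) powr \<theta>)\<^sup>2) = f k / real (Suc k) powr ((1 - 2 * \<theta>) - 1)"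
      unfolding eq f_def by (simp add: power_divide divide_simps)
  qed
  finally have "(\<lambda>k. f k / real (Suc k) powr ((1 - 2 * \<theta>) - 1)) \<longlonglongrightarrow> inverse (g\<^sup>2)" .
  then have "(\<lambda>n. (\<Sum>k<n. f k) / real n powr (1 - 2 * \<theta>)) \<longlonglongrightarrow> inverse (g\<^sup>2) / (1 - 2 * \<theta>)"
    using \<theta> by (intro power_sum_tendsto) auto
  from tendsto_mult[OF tendsto_power[OF g(2), of 2] this]
  have "(\<lambda>n. (growth \<theta> n / real n powr \<theta>)\<^sup>2 * ((\<Sum>k<n. f k) / real n powr (1 - 2 * \<theta>))) \<longlonglongrightarrow> 1 / (1 - 2 * \<theta>)"
    using g(1) by simp
  moreover have "\<forall>\<^sub>F n in sequentially. (growth \<theta> n / real n powr \<theta>)\<^sup>2 * ((\<Sum>k<n. f k) / real n powr (1 - 2 * \<theta>))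
     = (\<Sum>k<n. (weight n k)\<^sup>2)"
    using eventually_gt_at_top[of 0]
  proof eventually_elim
    case (elim n)
    have "(real n powr \<theta>)\<^sup>2 * real n powr (1 - 2 * \<theta>) = real n"
      using elim by (simp add: power2_eq_square flip: powr_add)
    then have "(growth \<theta> n / real n powr \<theta>)\<^sup>2 * ((\<Sum>k<n. f k) / real n powr (1 - 2 * \<theta>)) =
        (growth \<theta> n)\<^sup>2 * (\<Sum>k<n. f k) / real n"
      by (simp add: power_divide)
    also have "\<dots> = (\<Sum>k<n. (weight n k)\<^sup>2)"
      by (simp add: f_def sum_distrib_left sum_divide_distrib power_divide power_mult_distrib mult_ac)
    finally show ?case .
  qed
  ultimately show ?thesis by (rule Lim_transform_eventually)
qed

lemma scaled_decomposition:
  assumes \<omega>: "\<omega> \<in> space M"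
  shows "C n \<omega> \<bullet> x / sqrt (real n) =
    drift n \<omega> / sqrt (real n)
    + (\<Sum>k<n. weight n k * noise (R *\<^sub>v x) k \<omega>)"
proof -
  have "(\<Sum>k<n. weight n k * noise (R *\<^sub>v x) k \<omega>) =
      growth \<theta> n * noise_sum (R *\<^sub>v x) \<theta> n \<omega> / sqrt (real n)"
    by (simp add: sum_distrib_left sum_divide_distrib mult_ac)
  then show ?thesis
    unfolding C_prod_decomposition[OF x y R \<theta>(1) \<omega>, of n] by (simp add: add_divide_distrib distrib_left)
qed

text \<open>A law of large numbers: the functional is of order \<open>sqrt n\<close> in mean, because the drift is
  negligible and the noise has bounded second moment on this scale.\<close>

lemma jordan_chain_mean_tendsto_0:
  "(\<lambda>n. mean_abs x n / real (Suc n)) \<longlonglongrightarrow> 0"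
proof -
  have Rx: "R *\<^sub>v x \<in> carrier_vec K" using R x y by simp
  interpret N: bounded_martingale_differences M F "noise (R *\<^sub>v x)" "2 * coord_bound (R *\<^sub>v x)"
    by (rule noise_martingale_differences[OF Rx])
  define S where "S n \<omega> = (\<Sum>k<n. weight n k * noise (R *\<^sub>v x) k \<omega>)" for n \<omega>
  define B where "B = (2 * coord_bound (R *\<^sub>v x))\<^sup>2"
  define X where "X n \<omega> = drift n \<omega> / sqrt (real n)" for n \<omega>
  have dr: "integrable M (X n)" for n unfolding X_def by (rule scaled_drift_tendsto_0(1))
  have dr0: "(\<lambda>n. expectation (\<lambda>\<omega>. \<bar>X n \<omega>\<bar>)) \<longlonglongrightarrow> 0" unfolding X_def by (rule scaled_drift_tendsto_0(2))
  define bd where "bd n = expectation (\<lambda>\<omega>. \<bar>X n \<omega>\<bar>) + (1 + B * (\<Sum>k<n. (weight n k)\<^sup>2))" for n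
  have bd: "bd \<longlonglongrightarrow> 0 + (1 + B * (1 / (1 - 2 * \<theta>)))"
    unfolding bd_def by (intro tendsto_intros dr0 weights_square_sum_tendsto)
  have le: "mean_abs x n \<le> sqrt (real n) * bd n" if n: "n > 0" for n
  proof -
    have S2: "integrable M (\<lambda>\<omega>. (S n \<omega>)\<^sup>2)" unfolding S_def by (rule N.square_integrable_sum)
    have "mean_abs x n \<le> expectation (\<lambda>\<omega>. sqrt (real n) * (\<bar>X n \<omega>\<bar> + (1 + (S n \<omega>)\<^sup>2)))"
    proof (rule integral_mono)
      show "integrable M (\<lambda>\<omega>. \<bar>C n \<omega> \<bullet> x\<bar>)" using C_prod_integrable[OF x] by simp
      show "integrable M (\<lambda>\<omega>. sqrt (real n) * (\<bar>X n \<omega>\<bar> + (1 + (S n \<omega>)\<^sup>2)))" using dr S2 by auto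
      fix \<omega> assume \<omega>: "\<omega> \<in> space M"
      have "C n \<omega> \<bullet> x = sqrt (real n) * (C n \<omega> \<bullet> x / sqrt (real n))" using n by simp
      also have "C n \<omega> \<bullet> x / sqrt (real n) = X n \<omega> + S n \<omega>"
        unfolding scaled_decomposition[OF \<omega>] S_def X_def ..
      finally have "\<bar>C n \<omega> \<bullet> x\<bar> = sqrt (real n) * \<bar>X n \<omega> + S n \<omega>\<bar>" by (simp add: abs_mult)
      moreover have "\<bar>S n \<omega>\<bar> \<le> 1 + (S n \<omega>)\<^sup>2"
      proof -
        have "0 \<le> (\<bar>S n \<omega>\<bar> - 1)\<^sup>2" by simp
        then show ?thesis by (simp add: power2_diff)
      qed
      ultimately show "\<bar>C n \<omega> \<bullet> x\<bar> \<le> sqrt (real n) * (\<bar>X n \<omega>\<bar> + (1 + (S n \<omega>)\<^sup>2))"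
        by (auto intro!: mult_left_mono order_trans[OF abs_triangle_ineq] add_mono)
    qed
    also have "\<dots> = sqrt (real n) * (expectation (\<lambda>\<omega>. \<bar>X n \<omega>\<bar>) + (1 + second_moment (S n)))"
      using dr S2 by (simp add: prob_space)
    also have "second_moment (S n) \<le> B * (\<Sum>k<n. (weight n k)\<^sup>2)"
      unfolding S_def N.deterministic_sum_second_moment sum_distrib_left B_def
      by (intro sum_mono, subst mult.commute, intro mult_right_mono N.second_moment_le) auto
    finally show ?thesis unfolding bd_def using n by simp
  qed
  have "(\<lambda>n. sqrt (real n) / real (Suc n)) \<longlonglongrightarrow> 0" by real_asymp
  from tendsto_mult[OF this bd] have lim: "(\<lambda>n. sqrt (real n) / real (Suc n) * bd n) \<longlonglongrightarrow> 0" by simp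
  show ?thesis
  proof (rule tendsto_sandwich[OF _ _ tendsto_const lim])
    show "\<forall>\<^sub>F n in sequentially. mean_abs x n / real (Suc n) \<le> sqrt (real n) / real (Suc n) * bd n"
      using eventually_gt_at_top[of 0] by eventually_elim (use le in \<open>simp add: divide_right_mono\<close>)
  qed (auto intro!: always_eventually Bochner_Integration.integral_nonneg divide_nonneg_nonneg)
qed

lemma jordan_chain_weak_convergence:
  assumes v: "v \<ge> 0"
    and var: "(\<lambda>n. expectation (\<lambda>\<omega>. \<bar>C n \<omega> \<bullet> square_vec (R *\<^sub>v x) / real (Suc n)
        - (C n \<omega> \<bullet> (R *\<^sub>v x) / real (Suc n))\<^sup>2 - v\<bar>)) \<longlonglongrightarrow> 0"
  shows "weak_conv_m (\<lambda>n. distr M borel (\<lambda>\<omega>. C n \<omega> \<bullet> x / sqrt (real n))) (normal_law 0 (v / (1 - 2 * \<theta>)))"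
proof -
  let ?z = "R *\<^sub>v x"
  have Rx: "?z \<in> carrier_vec K" using R x y by simp
  have Rx2: "square_vec ?z \<in> carrier_vec K" using Rx by simp
  interpret N: bounded_martingale_differences M F "noise ?z" "2 * coord_bound ?z"
    by (rule noise_martingale_differences[OF Rx])
  define S where "S n \<omega> = (\<Sum>k<n. weight n k * noise ?z k \<omega>)" for n \<omega>
  define V where "V n \<omega> = C n \<omega> \<bullet> square_vec ?z / real (Suc n) - (C n \<omega> \<bullet> ?z / real (Suc n))\<^sup>2" for n \<omega>
  have V: "V n \<in> borel_measurable M" for n
    unfolding V_def using Rx Rx2 by measurable
  have Vb: "\<bar>V n \<omega>\<bar> \<le> coord_bound (square_vec ?z) + (coord_bound ?z)\<^sup>2" if "\<omega> \<in> space M" for n \<omega>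
    using proportion_bounded[OF Rx2 that, of n] norm_square_le[OF proportion_bounded[OF Rx that, of n]]
    unfolding V_def real_norm_def abs_power2 by (intro order_trans[OF abs_triangle_ineq4] add_mono) auto
  have decomp: "C n \<omega> \<bullet> x / sqrt (real n) - S n \<omega> = drift n \<omega> / sqrt (real n)" if "\<omega> \<in> space M" for n \<omega>
    unfolding scaled_decomposition[OF that] S_def by simp
  have \<delta>: "\<bar>expectation (\<lambda>\<omega>. Z \<omega> * ((noise ?z k \<omega>)\<^sup>2 - v))\<bar> \<le> expectation (\<lambda>\<omega>. \<bar>V k \<omega> - v\<bar>)"
    if Z: "Z \<in> borel_measurable (F k)" "\<And>\<omega>. \<omega> \<in> space M \<Longrightarrow> \<bar>Z \<omega>\<bar> \<le> 1" for k Z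
  proof -
    have [measurable]: "Z \<in> borel_measurable M" by (rule N.measurable_F_M[OF Z(1)])
    note [measurable] = V noise_measurable[OF Rx]
    have iZ: "integrable M Z" by (rule integrable_bounded[of _ 1]) (use Z in auto)
    have iV: "integrable M (V k)"
      by (rule integrable_bounded[of _ "coord_bound (square_vec ?z) + (coord_bound ?z)\<^sup>2"])
        (use Vb in auto)
    have iZV: "integrable M (\<lambda>\<omega>. Z \<omega> * V k \<omega>)"
      by (rule integrable_bounded[of _ "1 * (coord_bound (square_vec ?z) + (coord_bound ?z)\<^sup>2)"], measurable)
        (unfold real_norm_def, intro abs_mult_le Z Vb)
    have iZN: "integrable M (\<lambda>\<omega>. Z \<omega> * (noise ?z k \<omega>)\<^sup>2)"
      by (rule integrable_bounded[of _ "1 * (2 * coord_bound ?z)\<^sup>2"], measurable)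
        (unfold real_norm_def, intro abs_mult_le Z norm_square_le[unfolded real_norm_def] N.bounded)
    have "expectation (\<lambda>\<omega>. Z \<omega> * ((noise ?z k \<omega>)\<^sup>2 - v)) =
        expectation (\<lambda>\<omega>. Z \<omega> * (noise ?z k \<omega>)\<^sup>2) - v * expectation Z"
      using iZN iZ by (simp add: algebra_simps)
    also have "expectation (\<lambda>\<omega>. Z \<omega> * (noise ?z k \<omega>)\<^sup>2) = expectation (\<lambda>\<omega>. Z \<omega> * V k \<omega>)"
      unfolding V_def by (rule noise_conditional_second_moment[OF Rx Z])
    also have "expectation (\<lambda>\<omega>. Z \<omega> * V k \<omega>) - v * expectation Z = expectation (\<lambda>\<omega>. Z \<omega> * (V k \<omega> - v))"
      using iZV iZ by (simp add: algebra_simps)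
    also have "\<bar>\<dots>\<bar> \<le> expectation (\<lambda>\<omega>. \<bar>Z \<omega> * (V k \<omega> - v)\<bar>)" by (rule integral_abs_bound)
    also have "\<dots> \<le> expectation (\<lambda>\<omega>. \<bar>V k \<omega> - v\<bar>)"
    proof (rule integral_mono')
      show "integrable M (\<lambda>\<omega>. \<bar>V k \<omega> - v\<bar>)" using iV by simp
      show "\<bar>Z \<omega> * (V k \<omega> - v)\<bar> \<le> \<bar>V k \<omega> - v\<bar>" if "\<omega> \<in> space M" for \<omega>
        using abs_mult_le[OF Z(2)[OF that] order_refl] by simp
    qed simp
    finally show ?thesis .
  qed
  show ?thesis
  proof (rule weak_conv_normal_law[where Y = S])
    show "(\<lambda>\<omega>. C n \<omega> \<bullet> x / sqrt (real n)) \<in> borel_measurable M" for n using x by measurable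
    show "S n \<in> borel_measurable M" for n unfolding S_def by measurable
    show "integrable M (\<lambda>\<omega>. C n \<omega> \<bullet> x / sqrt (real n) - S n \<omega>)" for n
    proof -
      have "integrable M (\<lambda>\<omega>. drift n \<omega> / sqrt (real n))" by (rule scaled_drift_tendsto_0(1))
      also have "?this \<longleftrightarrow> integrable M (\<lambda>\<omega>. C n \<omega> \<bullet> x / sqrt (real n) - S n \<omega>)"
        by (rule Bochner_Integration.integrable_cong) (simp_all add: decomp)
      finally show ?thesis .
    qed
    have "expectation (\<lambda>\<omega>. \<bar>C n \<omega> \<bullet> x / sqrt (real n) - S n \<omega>\<bar>) = expectation (\<lambda>\<omega>. \<bar>drift n \<omega> / sqrt (real n)\<bar>)" for n
      by (rule Bochner_Integration.integral_cong) (simp_all add: decomp)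
    then show "(\<lambda>n. expectation (\<lambda>\<omega>. \<bar>C n \<omega> \<bullet> x / sqrt (real n) - S n \<omega>\<bar>)) \<longlonglongrightarrow> 0"
      using scaled_drift_tendsto_0(2) by simp
    show "v / (1 - 2 * \<theta>) \<ge> 0" using v \<theta> by simp
    fix u
    have "(\<lambda>n. CLINT \<omega>|M. iexp (u * S n \<omega>)) \<longlonglongrightarrow> complex_of_real (exp (- (u\<^sup>2 * (1 / (1 - 2 * \<theta>)) * v / 2)))"
      unfolding S_def
    proof (rule N.char_weighted_sums_tendsto[OF v \<delta>])
      show "(\<lambda>k. expectation (\<lambda>\<omega>. \<bar>V k \<omega> - v\<bar>)) \<longlonglongrightarrow> 0" unfolding V_def by (rule var)
      show "(\<lambda>n. \<Sum>k<n. (weight n k)\<^sup>2) \<longlonglongrightarrow> 1 / (1 - 2 * \<theta>)" by (rule weights_square_sum_tendsto)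
      show "\<bar>weight n k\<bar> \<le> max 1 (growth \<theta> n) / sqrt (real n)" if "k < n" for n k
      proof -
        have "\<bar>weight n k\<bar> = growth \<theta> n / growth \<theta> (Suc k) / sqrt (real n)"
          using growth_pos[OF \<theta>(1)] by (simp add: abs_mult abs_divide less_imp_le)
        also have "\<dots> \<le> max 1 (growth \<theta> n) / sqrt (real n)"
          using that by (intro divide_right_mono growth_ratio_le \<theta>) auto
        finally show ?thesis .
      qed
      obtain g where g: "g > 0" "(\<lambda>n. growth \<theta> n / real n powr \<theta>) \<longlonglongrightarrow> g"
        using growth_asymptotics[OF \<theta>(1)] by blast
      have "(\<lambda>n. real n powr \<theta> / sqrt (real n)) \<longlonglongrightarrow> 0" using \<theta> by real_asymp
      from tendsto_mult[OF g(2) this]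
      have "(\<lambda>n. growth \<theta> n / real n powr \<theta> * (real n powr \<theta> / sqrt (real n))) \<longlonglongrightarrow> 0" by simp
      moreover have "\<forall>\<^sub>F n in sequentially. growth \<theta> n / real n powr \<theta> * (real n powr \<theta> / sqrt (real n)) = growth \<theta> n / sqrt (real n)"
        using eventually_gt_at_top[of 0] by eventually_elim simp
      ultimately have 1: "(\<lambda>n. growth \<theta> n / sqrt (real n)) \<longlonglongrightarrow> 0" by (rule Lim_transform_eventually)
      have "(\<lambda>n. 1 / sqrt (real n)) \<longlonglongrightarrow> 0" by real_asymp
      from tendsto_max[OF this 1] have "(\<lambda>n. max (1 / sqrt (real n)) (growth \<theta> n / sqrt (real n))) \<longlonglongrightarrow> 0" by simp
      also have "(\<lambda>n. max (1 / sqrt (real n)) (growth \<theta> n / sqrt (real n))) = (\<lambda>n. max 1 (growth \<theta> n) / sqrt (real n))"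
        by (auto simp: max_def divide_le_cancel fun_eq_iff)
      finally show "(\<lambda>n. max 1 (growth \<theta> n) / sqrt (real n)) \<longlonglongrightarrow> 0" .
    qed
    then show "(\<lambda>n. CLINT \<omega>|M. iexp (u * S n \<omega>)) \<longlonglongrightarrow> complex_of_real (exp (- (u\<^sup>2 * (v / (1 - 2 * \<theta>)) / 2)))"
      by simp
  qed
qed

end

end

section \<open>Functionals dominated by an eigenvector\<close>

context urn_process
begin

lemma converges_rescaled:
  assumes L: "converges_as_L2 M (\<lambda>n \<omega>. C n \<omega> \<bullet> x / (growth \<theta> n * f n)) L"
    and g: "(\<lambda>n. growth \<theta> n / real n powr \<theta>) \<longlonglongrightarrow> g" and \<theta>: "\<theta> > -1"
  shows "converges_as_L2 M (\<lambda>n \<omega>. C n \<omega> \<bullet> x / (real n powr \<theta> * f n)) (\<lambda>\<omega>. g * L \<omega>)"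
  using converges_as_L2_scale[OF L g] growth_pos[OF \<theta>]
  by (subst converges_as_L2_cong[where Y = "\<lambda>n \<omega>. growth \<theta> n / real n powr \<theta> * (C n \<omega> \<bullet> x / (growth \<theta> n * f n))"])
    (simp_all add: less_imp_neq[symmetric])

text \<open>The vector \<open>w\<close> will be the indicator of the colors that die out relative to the total.
  Then \<open>C n \<bullet> w\<close> is the number of balls of these colors, whose mean is at most of order
  \<open>n\<^sup>s\<close>. A vector supported on these colors contributes only if one of them is drawn, which
  has probability at most of order \<open>n\<^bsup>s - 1\<^esup>\<close>; this bounds the second moment of its noise.\<close>

context
  fixes w :: "real vec" and s :: real
  assumes w: "w \<in> carrier_vec K" and Rw: "R *\<^sub>v w = s \<cdot>\<^sub>v w" and s: "s > 0"
begin

lemma expectation_dominating_le: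
  "\<exists>c\<ge>0. \<forall>k. expectation (\<lambda>\<omega>. C k \<omega> \<bullet> w) \<le> c * real (Suc k) powr s"
proof -
  have s1: "s > -1" using s by simp
  obtain g where g: "g > 0" "\<And>n. n > 0 \<Longrightarrow> growth s n \<le> g * real n powr s"
    using growth_bounds[OF s1] by blast
  have "expectation (\<lambda>\<omega>. C k \<omega> \<bullet> w) \<le> (g * \<bar>c0 \<bullet> w\<bar>) * real (Suc k) powr s" for k
  proof -
    have "growth s k \<le> growth s (Suc k)"
      unfolding growth_Suc using growth_pos[OF s1, of k] s by (simp add: algebra_simps)
    also have "\<dots> \<le> g * real (Suc k) powr s" by (rule g) simp
    finally have "growth s k * (c0 \<bullet> w) \<le> (g * real (Suc k) powr s) * \<bar>c0 \<bullet> w\<bar>"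
      using growth_pos[OF s1, of k] by (intro order_trans[OF mult_left_mono[OF abs_ge_self] mult_right_mono]) auto
    then show ?thesis unfolding expectation_eigenvector[OF w Rw s1] by (simp add: mult_ac)
  qed
  then show ?thesis using g by (intro exI[of _ "g * \<bar>c0 \<bullet> w\<bar>"]) auto
qed

lemma dominated_noise_second_moment:
  assumes z: "z \<in> carrier_vec K" and dom: "\<And>i. i < K \<Longrightarrow> (z $ i)\<^sup>2 \<le> B * w $ i" and B: "B \<ge> 0"
  shows "\<exists>c\<ge>0. \<forall>k. second_moment (noise z k) \<le> c * real (Suc k) powr (s - 1)"
proof -
  obtain c where c: "c \<ge> 0" "\<And>k. expectation (\<lambda>\<omega>. C k \<omega> \<bullet> w) \<le> c * real (Suc k) powr s"
    using expectation_dominating_le by blast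
  have "second_moment (noise z k) \<le> (B * c) * real (Suc k) powr (s - 1)" for k
  proof -
    have "second_moment (noise z k) \<le> expectation (\<lambda>\<omega>. C k \<omega> \<bullet> square_vec z) / real (Suc k)"
      by (rule noise_second_moment_le[OF z])
    also have "expectation (\<lambda>\<omega>. C k \<omega> \<bullet> square_vec z) \<le> expectation (\<lambda>\<omega>. B * (C k \<omega> \<bullet> w))"
    proof (rule integral_mono)
      show "integrable M (\<lambda>\<omega>. C k \<omega> \<bullet> square_vec z)" using z by (intro C_prod_integrable) simp
      show "integrable M (\<lambda>\<omega>. B * (C k \<omega> \<bullet> w))" using w by (intro integrable_mult_right C_prod_integrable)
      fix \<omega> assume \<omega>: "\<omega> \<in> space M"
      have "\<bar>C k \<omega> \<bullet> square_vec z\<bar> \<le> C k \<omega> \<bullet> (B \<cdot>\<^sub>v w)"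
        using z w dom \<omega> by (intro C_prod_le) auto
      then show "C k \<omega> \<bullet> square_vec z \<le> B * (C k \<omega> \<bullet> w)"
        using w C_carrier[OF \<omega>, of k] by simp
    qed
    also have "\<dots> = B * expectation (\<lambda>\<omega>. C k \<omega> \<bullet> w)" by simp
    also have "\<dots> \<le> B * (c * real (Suc k) powr s)" using c B by (intro mult_left_mono) auto
    also have "B * (c * real (Suc k) powr s) / real (Suc k) = (B * c) * real (Suc k) powr (s - 1)"
      by (simp add: powr_diff)
    finally show ?thesis by (simp add: divide_right_mono del: of_nat_Suc)
  qed
  then show ?thesis using c B by (intro exI[of _ "B * c"]) auto
qed

end

end

section \<open>Block matrices and Jordan chains\<close>

lemma smult_mult_vec:
  fixes A :: "real mat"
  shows "A \<in> carrier_mat n m \<Longrightarrow> x \<in> carrier_vec m \<Longrightarrow> (k \<cdot>\<^sub>m A) *\<^sub>v x = k \<cdot>\<^sub>v (A *\<^sub>v x)"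
  by (auto intro!: eq_vecI)

lemma block_upper_eigenvector:
  fixes A :: "real mat"
  assumes "A \<in> carrier_mat n n" "B \<in> carrier_mat n m" "D \<in> carrier_mat m m"
    and "x \<in> carrier_vec n" "A *\<^sub>v x = c \<cdot>\<^sub>v x"
  shows "four_block_mat A B (0\<^sub>m m n) D *\<^sub>v (x @\<^sub>v 0\<^sub>v m) = c \<cdot>\<^sub>v (x @\<^sub>v 0\<^sub>v m)"
proof -
  have "B *\<^sub>v 0\<^sub>v m = 0\<^sub>v n" "D *\<^sub>v 0\<^sub>v m = 0\<^sub>v m" "0\<^sub>m m n *\<^sub>v x = 0\<^sub>v m"
    using assms by (auto intro!: eq_vecI scalar_prod_right_zero scalar_prod_left_zero)
  with assms show ?thesis
    by (subst four_block_mat_mult_vec[of _ n n _ m _ m]) (auto intro!: eq_vecI)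
qed

lemma block_lower_mult_vec:
  fixes A :: "real mat"
  assumes "A \<in> carrier_mat n n" "B \<in> carrier_mat n m" "D \<in> carrier_mat m m" "t \<in> carrier_vec (n + m)"
  shows "vec_last (four_block_mat A B (0\<^sub>m m n) D *\<^sub>v t) m = D *\<^sub>v vec_last t m"
proof -
  have "four_block_mat A B (0\<^sub>m m n) D *\<^sub>v (vec_first t n @\<^sub>v vec_last t m) =
    (A *\<^sub>v vec_first t n + B *\<^sub>v vec_last t m) @\<^sub>v (0\<^sub>m m n *\<^sub>v vec_first t n + D *\<^sub>v vec_last t m)"
    using assms by (intro four_block_mat_mult_vec[of _ n n _ m _ m]) auto
  also have "vec_first t n @\<^sub>v vec_last t m = t" using assms by simp
  also have "0\<^sub>m m n *\<^sub>v vec_first t n = 0\<^sub>v m"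
    by (auto intro!: eq_vecI)
  finally have "four_block_mat A B (0\<^sub>m m n) D *\<^sub>v t =
    (A *\<^sub>v vec_first t n + B *\<^sub>v vec_last t m) @\<^sub>v (0\<^sub>v m + D *\<^sub>v vec_last t m)" .
  then show ?thesis
    using assms by (simp only:) (auto simp: vec_last_def simp del: index_mult_mat_vec intro!: eq_vecI)
qed

lemma stochastic_mult_ones:
  assumes "stochastic_mat n A"
  shows "A *\<^sub>v vec n (\<lambda>_. 1) = 1 \<cdot>\<^sub>v vec n (\<lambda>_. 1)"
proof (rule eq_vecI)
  fix i assume "i < dim_vec (1 \<cdot>\<^sub>v vec n (\<lambda>_. 1 :: real))"
  then have i: "i < n" by simp
  have A: "A \<in> carrier_mat n n" and r: "(\<Sum>j<n. row A i $ j) = 1"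
    using assms i by (auto simp: stochastic_mat_def probability_vec_def)
  have "(A *\<^sub>v vec n (\<lambda>_. 1)) $ i = (\<Sum>j<n. row A i $ j)"
    using A i by (simp add: scalar_prod_def atLeast0LessThan)
  then show "(A *\<^sub>v vec n (\<lambda>_. 1)) $ i = (1 \<cdot>\<^sub>v vec n (\<lambda>_. 1)) $ i" using r i by simp
qed (use assms in \<open>auto simp: stochastic_mat_def\<close>)

lemma jordan_chain_columns:
  fixes A :: "real mat"
  assumes A: "A \<in> carrier_mat 4 4"
    and t: "t\<^sub>1 \<in> carrier_vec 4" "t\<^sub>2 \<in> carrier_vec 4" "t\<^sub>3 \<in> carrier_vec 4" "t\<^sub>4 \<in> carrier_vec 4"
    and T: "T = mat_of_cols 4 [t\<^sub>1, t\<^sub>2, t\<^sub>3, t\<^sub>4]"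
    and jordan: "A * T = T * jordan_matrix [(1, \<alpha>), (2, \<beta>), (1, 1)]"
  shows "A *\<^sub>v t\<^sub>2 = \<beta> \<cdot>\<^sub>v t\<^sub>2" and "A *\<^sub>v t\<^sub>3 = \<beta> \<cdot>\<^sub>v t\<^sub>3 + t\<^sub>2"
proof -
  define J where "J = jordan_matrix [(1, \<alpha>), (2, \<beta>), (1, 1)]"
  have J: "J \<in> carrier_mat 4 4" by (intro carrier_matI) (simp_all add: J_def)
  have TC: "T \<in> carrier_mat 4 4" unfolding T by (intro carrier_matI) simp_all
  have Je: "J $$ (0, 1) = 0" "J $$ (1, 1) = \<beta>" "J $$ (2, 1) = 0" "J $$ (3, 1) = 0"
    "J $$ (0, 2) = 0" "J $$ (1, 2) = 1" "J $$ (2, 2) = \<beta>" "J $$ (3, 2) = 0"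
    by (simp_all add: J_def jordan_matrix_def four_block_mat_def Let_def jordan_block_def)
  have col: "col T 1 = t\<^sub>2" "col T 2 = t\<^sub>3"
    unfolding T using t by (auto simp: numeral_2_eq_2)
  have Te: "T $$ (i, 1) = t\<^sub>2 $ i" "T $$ (i, 2) = t\<^sub>3 $ i" if "i < 4" for i
    using TC that by (simp_all flip: col)
  have sum4: "(\<Sum>k<4. f k) = f 0 + f 1 + f 2 + f 3" for f :: "nat \<Rightarrow> real"
    by (simp add: numeral_eq_Suc)
  have TJ: "col (T * J) j $ i = (\<Sum>k<4. T $$ (i, k) * J $$ (k, j))" if "i < 4" "j < 4" for i j
    using TC J that by (simp add: scalar_prod_def atLeast0LessThan)
  have "A *\<^sub>v t\<^sub>2 = col (A * T) 1" "A *\<^sub>v t\<^sub>3 = col (A * T) 2"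
    by (subst col_mult2[OF A TC], simp, simp only: col)+
  moreover have "col (T * J) 1 = \<beta> \<cdot>\<^sub>v t\<^sub>2" "col (T * J) 2 = \<beta> \<cdot>\<^sub>v t\<^sub>3 + t\<^sub>2"
  proof -
    have "col (T * J) 1 $ i = \<beta> * t\<^sub>2 $ i" "col (T * J) 2 $ i = \<beta> * t\<^sub>3 $ i + t\<^sub>2 $ i" if "i < 4" for i
      using that TJ[of i 1] TJ[of i 2] unfolding sum4 Je Te[OF that] by simp_all
    then show "col (T * J) 1 = \<beta> \<cdot>\<^sub>v t\<^sub>2" "col (T * J) 2 = \<beta> \<cdot>\<^sub>v t\<^sub>3 + t\<^sub>2"
      using TC t by (auto intro!: eq_vecI simp del: index_col)
  qed
  ultimately show "A *\<^sub>v t\<^sub>2 = \<beta> \<cdot>\<^sub>v t\<^sub>2" "A *\<^sub>v t\<^sub>3 = \<beta> \<cdot>\<^sub>v t\<^sub>3 + t\<^sub>2"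
    using jordan unfolding J_def[symmetric] by simp_all
qed

lemma invertible_rows_distinct:
  fixes T :: "real mat"
  assumes T: "T \<in> carrier_mat n n" and inv: "invertible_mat T" and ij: "i < n" "j < n" "i \<noteq> j"
  shows "row T i \<noteq> row T j"
proof
  assume eq: "row T i = row T j"
  obtain B where B: "T * B = 1\<^sub>m n"
    using inv T by (auto simp: invertible_mat_def inverts_mat_def)
  have dB: "dim_col B = n" using arg_cong[OF B, of dim_col] by simp
  have "(T * B) $$ (i, i) = (T * B) $$ (j, i)"
    using T ij dB by (simp add: eq)
  then show False using B ij by simp
qed

text \<open>Both coordinates of \<open>\<nu>\<close> satisfy \<open>t\<^sup>2 = (\<nu>\<^sub>0 + \<nu>\<^sub>1) t - \<nu>\<^sub>0 \<nu>\<^sub>1\<close>, and \<open>\<pi>\<close> annihilates \<open>\<nu>\<close>, since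
  \<open>\<pi> \<nu> = \<pi> P \<nu> = \<beta> \<pi> \<nu>\<close>.\<close>

lemma stationary_square_moment:
  assumes P: "P \<in> carrier_mat 2 2" and \<pi>: "stationary_distribution P \<pi>"
    and \<nu>: "\<nu> \<in> carrier_vec 2" "P *\<^sub>v \<nu> = \<beta> \<cdot>\<^sub>v \<nu>" and \<beta>: "\<beta> \<noteq> 1"
  shows "\<pi> \<bullet> map_vec (\<lambda>x. x\<^sup>2) \<nu> = - (\<nu> $ 0 * \<nu> $ 1)" and "\<pi> \<bullet> map_vec (\<lambda>x. x\<^sup>2) \<nu> \<ge> 0"
proof -
  have \<pi>c: "\<pi> \<in> carrier_vec 2" and \<pi>p: "\<pi> $ 0 \<ge> 0" "\<pi> $ 1 \<ge> 0" and \<pi>s: "\<pi> $ 0 + \<pi> $ 1 = 1"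
    and st: "transpose_mat P *\<^sub>v \<pi> = \<pi>"
    using \<pi> P by (auto simp: stationary_distribution_def probability_vec_def numeral_2_eq_2)
  have "\<pi> \<bullet> \<nu> = \<pi> \<bullet> (P *\<^sub>v \<nu>)"
    using transpose_vec_mult_scalar[OF P \<nu>(1) \<pi>c] st by simp
  also have "\<dots> = \<beta> * (\<pi> \<bullet> \<nu>)" using \<nu> \<pi>c by simp
  finally have "\<pi> \<bullet> \<nu> = 0" using \<beta> by auto
  then have 0: "\<pi> $ 0 * \<nu> $ 0 + \<pi> $ 1 * \<nu> $ 1 = 0"
    using \<nu> by (simp add: scalar_prod_def numeral_2_eq_2)
  have eq: "\<pi> \<bullet> map_vec (\<lambda>x. x\<^sup>2) \<nu> = \<pi> $ 0 * (\<nu> $ 0)\<^sup>2 + \<pi> $ 1 * (\<nu> $ 1)\<^sup>2"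
    using \<nu> by (simp add: scalar_prod_def numeral_2_eq_2)
  then show "\<pi> \<bullet> map_vec (\<lambda>x. x\<^sup>2) \<nu> \<ge> 0" using \<pi>p by simp
  have "\<pi> $ 0 * (\<nu> $ 0)\<^sup>2 + \<pi> $ 1 * (\<nu> $ 1)\<^sup>2 =
      (\<nu> $ 0 + \<nu> $ 1) * (\<pi> $ 0 * \<nu> $ 0 + \<pi> $ 1 * \<nu> $ 1) - (\<pi> $ 0 + \<pi> $ 1) * (\<nu> $ 0 * \<nu> $ 1)"
    by (simp add: algebra_simps power2_eq_square)
  then show "\<pi> \<bullet> map_vec (\<lambda>x. x\<^sup>2) \<nu> = - (\<nu> $ 0 * \<nu> $ 1)" unfolding eq 0 \<pi>s by simp
qed

section \<open>The four-color urn\<close>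

theorem proposition4p4:
  fixes M :: "'a measure" and F :: "nat \<Rightarrow> 'a measure"
    and P Q E R T :: "real mat"
    and c0 \<pi>\<^sub>P \<xi> v\<^sub>1 v\<^sub>2 t\<^sub>1 t\<^sub>2 t\<^sub>3 t\<^sub>4 \<nu> :: "real vec"
    and D :: "nat \<Rightarrow> 'a \<Rightarrow> nat" and C :: "nat \<Rightarrow> 'a \<Rightarrow> real vec"
    and s lam \<alpha> \<beta> :: real
  assumes urn: "urn_process M F 4 R c0 D C"
    and E: "E \<in> carrier_mat 2 2"
    and R: "R = four_block_mat (s \<cdot>\<^sub>m Q) E (0\<^sub>m 2 2) P"
    and s: "0 < s" "s < 1"
    and P: "stochastic_mat 2 P" "irreducible_mat P"
    and Q: "stochastic_mat 2 Q" "irreducible_mat Q"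
    and \<pi>\<^sub>P: "stationary_distribution P \<pi>\<^sub>P"
    and eigenvalues_Q: "spectrum Q = {lam, 1}" "\<bar>lam\<bar> < 1"
    and eigenvalues_P: "spectrum P = {\<beta>, 1}" "\<bar>\<beta>\<bar> < 1"
    and c0: "c0 $ 0 + c0 $ 1 > 0"
    and \<xi>: "eigenvector Q \<xi> lam"
    and v\<^sub>1: "v\<^sub>1 = vec_of_list [1, 1, 0, 0]"
    and v\<^sub>2: "v\<^sub>2 = \<xi> @\<^sub>v 0\<^sub>v 2"
    and not_diagonalizable: "\<not> diagonalizable_mat R"
    and \<alpha>: "\<alpha> = (if \<beta> = s then s * lam else s)"
    and T: "T = mat_of_cols 4 [t\<^sub>1, t\<^sub>2, t\<^sub>3, t\<^sub>4]" "invertible_mat T"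
    and t\<^sub>1: "t\<^sub>1 = (if \<beta> = s then v\<^sub>2 else v\<^sub>1)"
    and t\<^sub>2: "t\<^sub>2 = (if \<beta> = s then v\<^sub>1 else v\<^sub>2)"
    and t\<^sub>3: "t\<^sub>3 \<in> carrier_vec 4"
    and t\<^sub>4: "t\<^sub>4 = vec_of_list [1, 1, 1, 1]"
    and jordan: "R * T = T * jordan_matrix [(1, \<alpha>), (2, \<beta>), (1, 1)]"
    and \<nu>: "\<nu> = vec_last t\<^sub>3 2"
  shows "eigenvector R v\<^sub>1 s \<and> eigenvector R v\<^sub>2 (s * lam) \<and>
    \<beta> \<in> {s, s * lam} \<and> eigenvector P \<nu> \<beta> \<and>
    (\<beta> < 1/2 \<longrightarrow>
       weak_conv_m (\<lambda>n. distr M borel (\<lambda>\<omega>. (C n \<omega> \<bullet> t\<^sub>3) / sqrt (real n)))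
         (normal_law 0 (\<beta>\<^sup>2 / (1 - 2 * \<beta>) * (\<pi>\<^sub>P \<bullet> map_vec (\<lambda>x. x\<^sup>2) \<nu>)))) \<and>
    (\<beta> = s * lam \<and> \<beta> \<ge> 1/2 \<longrightarrow> lam > 1/2) \<and>
    (\<exists>U V.
       converges_as_L2 M (\<lambda>n \<omega>. (C n \<omega> \<bullet> v\<^sub>1) / real n powr s) U \<and>
       (lam > 1/2 \<longrightarrow>
          converges_as_L2 M (\<lambda>n \<omega>. (C n \<omega> \<bullet> v\<^sub>2) / real n powr (s * lam)) V) \<and>
       (\<beta> \<ge> 1/2 \<longrightarrow>
          converges_as_L2 M (\<lambda>n \<omega>. (C n \<omega> \<bullet> t\<^sub>3) / (real n powr \<beta> * ln (real n)))
            (if \<beta> = s then U else V)))"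
proof -
  interpret urn_process M F 4 R c0 D C by (rule urn)
  have Pc: "P \<in> carrier_mat 2 2" and Qc: "Q \<in> carrier_mat 2 2"
    using P Q by (auto simp: stochastic_mat_def)
  have sQ: "s \<cdot>\<^sub>m Q \<in> carrier_mat 2 2" using Qc by simp
  have Rc: "R \<in> carrier_mat 4 4" by (rule R_carrier)
  have less4: "i < 4 \<longleftrightarrow> i = 0 \<or> i = 1 \<or> i = 2 \<or> i = 3" for i :: nat by auto
  have \<xi>c: "\<xi> \<in> carrier_vec 2" and \<xi>0: "\<xi> \<noteq> 0\<^sub>v 2" and Q\<xi>: "Q *\<^sub>v \<xi> = lam \<cdot>\<^sub>v \<xi>"
    using \<xi> Qc by (auto simp: eigenvector_def)
  have v1: "v\<^sub>1 = vec 2 (\<lambda>_. 1) @\<^sub>v 0\<^sub>v 2"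
    unfolding v\<^sub>1 by (rule eq_vecI) (auto simp: less4 vec_of_list_index numeral_eq_Suc less_Suc_eq)
  have v1c: "v\<^sub>1 \<in> carrier_vec 4" and v2c: "v\<^sub>2 \<in> carrier_vec 4"
    unfolding v1 v\<^sub>2 using \<xi>c by (auto intro: carrier_vecI)
  have v1e: "v\<^sub>1 $ 0 = 1" "v\<^sub>1 $ 1 = 1" "v\<^sub>1 $ 2 = 0" "v\<^sub>1 $ 3 = 0" by (simp_all add: v1)
  have v2e: "v\<^sub>2 $ 0 = \<xi> $ 0" "v\<^sub>2 $ 1 = \<xi> $ 1" "v\<^sub>2 $ 2 = 0" "v\<^sub>2 $ 3 = 0" using \<xi>c by (simp_all add: v\<^sub>2)
  have Rv1: "R *\<^sub>v v\<^sub>1 = s \<cdot>\<^sub>v v\<^sub>1"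
    unfolding R v1 using stochastic_mult_ones[OF Q(1)] Qc
    by (intro block_upper_eigenvector[OF sQ E Pc]) (auto simp: smult_mult_vec)
  have Rv2: "R *\<^sub>v v\<^sub>2 = (s * lam) \<cdot>\<^sub>v v\<^sub>2"
    unfolding R v\<^sub>2 using Q\<xi> Qc \<xi>c
    by (intro block_upper_eigenvector[OF sQ E Pc]) (auto simp: smult_mult_vec smult_smult_assoc)
  have v1_nz: "v\<^sub>1 \<noteq> 0\<^sub>v 4" using v1e(1) by auto
  have v2_nz: "v\<^sub>2 \<noteq> 0\<^sub>v 4"
  proof
    assume "v\<^sub>2 = 0\<^sub>v 4"
    then have "\<xi> $ 0 = 0" "\<xi> $ 1 = 0" using v2e(1,2) by simp_all
    then have "\<xi> = 0\<^sub>v 2" using \<xi>c by (intro eq_vecI) (auto simp: less_2_cases_iff)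
    with \<xi>0 show False by simp
  qed
  have ev1: "eigenvector R v\<^sub>1 s" and ev2: "eigenvector R v\<^sub>2 (s * lam)"
    using Rc v1c v2c v1_nz v2_nz Rv1 Rv2 by (auto simp: eigenvector_def)
  have t1c: "t\<^sub>1 \<in> carrier_vec 4" and t2c: "t\<^sub>2 \<in> carrier_vec 4" and t4c: "t\<^sub>4 \<in> carrier_vec 4"
    unfolding t\<^sub>1 t\<^sub>2 t\<^sub>4 using v1c v2c by (auto intro: carrier_vecI)
  note chain = jordan_chain_columns[OF Rc t1c t2c t\<^sub>3 t4c T(1) jordan]
  (* If \<beta> is not s, then t\<^sub>2 is v\<^sub>2, which the Jordan relation and the block structure show to be an
     eigenvector for both \<beta> and s * lam. *)
  have \<beta>: "\<beta> \<in> {s, s * lam}"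
  proof (cases "\<beta> = s")
    case False
    then have "\<beta> \<cdot>\<^sub>v v\<^sub>2 = (s * lam) \<cdot>\<^sub>v v\<^sub>2" using chain(1) Rv2 by (simp add: t\<^sub>2)
    moreover obtain i where "i < 4" "v\<^sub>2 $ i \<noteq> 0"
      using v2_nz v2c by (metis carrier_vecD eq_vecI index_zero_vec)
    ultimately have "\<beta> = s * lam" using v2c
      by (metis carrier_vecD index_smult_vec(1) mult_right_cancel)
    then show ?thesis by simp
  qed simp
  have upper: "t\<^sub>2 $ 2 = 0" "t\<^sub>2 $ 3 = 0" using v1e v2e by (simp_all add: t\<^sub>2)
  have \<nu>c: "\<nu> \<in> carrier_vec 2" by (simp add: \<nu>)
  have \<nu>e: "\<nu> $ 0 = t\<^sub>3 $ 2" "\<nu> $ 1 = t\<^sub>3 $ 3" using t\<^sub>3 by (simp_all add: \<nu> vec_last_def numeral_2_eq_2 numeral_3_eq_3)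
  have P\<nu>: "P *\<^sub>v \<nu> = \<beta> \<cdot>\<^sub>v \<nu>"
  proof -
    have "P *\<^sub>v \<nu> = vec_last (R *\<^sub>v t\<^sub>3) 2"
      unfolding \<nu> R using t\<^sub>3 by (subst block_lower_mult_vec[OF sQ E Pc]) auto
    also have "\<dots> = \<beta> \<cdot>\<^sub>v \<nu>"
      unfolding chain(2) \<nu> using t\<^sub>3 t2c upper
      by (intro eq_vecI) (auto simp: vec_last_def numeral_eq_Suc less_Suc_eq)
    finally show ?thesis .
  qed
  have Tc: "T \<in> carrier_mat 4 4" unfolding T by (intro carrier_matI) simp_all
  (* Otherwise the last two rows of T would both be (0, 0, 0, 1). *)
  have \<nu>_nz: "\<nu> \<noteq> 0\<^sub>v 2"
  proof
    assume "\<nu> = 0\<^sub>v 2"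
    then have "t\<^sub>3 $ 2 = 0" "t\<^sub>3 $ 3 = 0" using \<nu>e by simp_all
    moreover have "t\<^sub>1 $ 2 = 0" "t\<^sub>1 $ 3 = 0" using v1e v2e by (simp_all add: t\<^sub>1)
    moreover have "t\<^sub>4 $ 2 = 1" "t\<^sub>4 $ 3 = 1" by (simp_all add: t\<^sub>4 vec_of_list_index numeral_eq_Suc)
    ultimately have "row T 2 = row T 3"
      using upper unfolding T
      by (intro eq_vecI) (auto simp: mat_of_cols_index less4 numeral_eq_Suc less_Suc_eq)
    with invertible_rows_distinct[OF Tc T(2), of 2 3] show False by simp
  qed
  have ev\<nu>: "eigenvector P \<nu> \<beta>" using Pc \<nu>c \<nu>_nz P\<nu> by (auto simp: eigenvector_def)

  have \<theta>1: "s > -1" "s * lam > -1" "\<beta> > -1"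
  proof -
    have "s * \<bar>lam\<bar> < 1 * 1" using s eigenvalues_Q(2) by (intro mult_strict_mono) auto
    then show "s * lam > -1" using s abs_ge_minus_self[of "s * lam"] by (simp add: abs_mult)
    show "s > -1" "\<beta> > -1" using s eigenvalues_P(2) by auto
  qed
  have noise_upper: "\<exists>c\<ge>0. \<forall>k. second_moment (noise z k) \<le> c * real (Suc k) powr (s - 1)"
    if z: "z \<in> carrier_vec 4" "z $ 2 = 0" "z $ 3 = 0" for z
  proof (rule dominated_noise_second_moment[OF v1c Rv1 s(1) z(1)])
    fix i :: nat assume i: "i < 4"
    have "(z $ i)\<^sup>2 \<le> (coord_bound z)\<^sup>2" using norm_square_le[OF coord_bound[OF i]] by simp
    with i show "(z $ i)\<^sup>2 \<le> (coord_bound z)\<^sup>2 * v\<^sub>1 $ i" using z v1e by (auto simp: less4)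
  qed simp
  obtain gs where gs: "(\<lambda>n. growth s n / real n powr s) \<longlonglongrightarrow> gs"
    using growth_asymptotics[OF \<theta>1(1)] by blast
  obtain gl where gl: "(\<lambda>n. growth (s * lam) n / real n powr (s * lam)) \<longlonglongrightarrow> gl"
    using growth_asymptotics[OF \<theta>1(2)] by blast
  have "R *\<^sub>v v\<^sub>1 \<in> carrier_vec 4" "(R *\<^sub>v v\<^sub>1) $ 2 = 0" "(R *\<^sub>v v\<^sub>1) $ 3 = 0"
    unfolding Rv1 using v1c v1e by simp_all
  then obtain cu where "\<And>k. second_moment (noise (R *\<^sub>v v\<^sub>1) k) \<le> cu * real (Suc k) powr (s - 1)"
    using noise_upper by blast
  from eigenvector_converges[OF v1c Rv1 \<theta>1(1) _ this] s obtain U where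
    U: "converges_as_L2 M (\<lambda>n \<omega>. C n \<omega> \<bullet> v\<^sub>1 / growth s n) U" by auto
  have U': "converges_as_L2 M (\<lambda>n \<omega>. C n \<omega> \<bullet> v\<^sub>1 / real n powr s) (\<lambda>\<omega>. gs * U \<omega>)"
    using converges_rescaled[of v\<^sub>1 s "\<lambda>_. 1" U gs] U gs \<theta>1 by simp
  have "R *\<^sub>v v\<^sub>2 \<in> carrier_vec 4" "(R *\<^sub>v v\<^sub>2) $ 2 = 0" "(R *\<^sub>v v\<^sub>2) $ 3 = 0"
    unfolding Rv2 using v2c v2e by simp_all
  then obtain cv where cv: "\<And>k. second_moment (noise (R *\<^sub>v v\<^sub>2) k) \<le> cv * real (Suc k) powr (s - 1)"
    using noise_upper by blast
  have "\<exists>V. lam > 1/2 \<longrightarrow> converges_as_L2 M (\<lambda>n \<omega>. C n \<omega> \<bullet> v\<^sub>2 / growth (s * lam) n) V"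
  proof (cases "lam > 1/2")
    case True
    then have "s < 2 * (s * lam)" using s by simp
    from eigenvector_converges[OF v2c Rv2 \<theta>1(2) this cv] show ?thesis by blast
  qed simp
  then obtain V where V: "lam > 1/2 \<Longrightarrow> converges_as_L2 M (\<lambda>n \<omega>. C n \<omega> \<bullet> v\<^sub>2 / growth (s * lam) n) V" by blast
  have V': "converges_as_L2 M (\<lambda>n \<omega>. C n \<omega> \<bullet> v\<^sub>2 / real n powr (s * lam)) (\<lambda>\<omega>. gl * V \<omega>)" if "lam > 1/2"
    using converges_rescaled[of v\<^sub>2 "s * lam" "\<lambda>_. 1" V gl] V[OF that] gl \<theta>1 by simp
  have lam: "lam > 1/2" if "\<beta> = s * lam" "\<beta> \<ge> 1/2"
  proof (rule ccontr)
    assume "\<not> lam > 1/2"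
    then have "s * lam \<le> s * (1/2)" using s by (intro mult_left_mono) auto
    with that s show False by simp
  qed
  have ii: "converges_as_L2 M (\<lambda>n \<omega>. C n \<omega> \<bullet> t\<^sub>3 / (real n powr \<beta> * ln (real n)))
      (if \<beta> = s then (\<lambda>\<omega>. gs * U \<omega>) else (\<lambda>\<omega>. gl * V \<omega>))" if ge: "\<beta> \<ge> 1/2"
  proof (cases "\<beta> = s")
    case True
    then have "converges_as_L2 M (\<lambda>n \<omega>. C n \<omega> \<bullet> t\<^sub>2 / growth \<beta> n) U" using U by (simp add: t\<^sub>2)
    from jordan_chain_converges[OF t\<^sub>3 t2c chain(2) ge this] show ?thesis
      using converges_rescaled gs \<theta>1 True by simp
  next
    case False
    then have eq: "\<beta> = s * lam" using \<beta> by simp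
    then have "converges_as_L2 M (\<lambda>n \<omega>. C n \<omega> \<bullet> t\<^sub>2 / growth \<beta> n) V"
      using V lam ge False by (simp add: t\<^sub>2)
    from jordan_chain_converges[OF t\<^sub>3 t2c chain(2) ge this] show ?thesis
      using converges_rescaled gl \<theta>1 eq False by simp
  qed
  have i: "weak_conv_m (\<lambda>n. distr M borel (\<lambda>\<omega>. (C n \<omega> \<bullet> t\<^sub>3) / sqrt (real n)))
         (normal_law 0 (\<beta>\<^sup>2 / (1 - 2 * \<beta>) * (\<pi>\<^sub>P \<bullet> map_vec (\<lambda>x. x\<^sup>2) \<nu>)))" if less: "\<beta> < 1/2"
  proof -
    (* The midpoint between the critical exponent 1/2 and the larger of \<beta> and s/2, the orders of
       growth of C n \<bullet> t\<^sub>2 that come from the eigenvalue and from its noise. *)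
    define \<eta> where "\<eta> = (max \<beta> (s / 2) + 1/2) / 2"
    have \<eta>: "\<beta> < \<eta>" "\<eta> < 1/2" "0 \<le> \<eta>" "s \<le> 2 * \<eta>"
      using less s by (auto simp: \<eta>_def max_def field_simps)
    have Rt2: "R *\<^sub>v t\<^sub>2 \<in> carrier_vec 4" "(R *\<^sub>v t\<^sub>2) $ 2 = 0" "(R *\<^sub>v t\<^sub>2) $ 3 = 0"
      unfolding chain(1) using t2c upper by simp_all
    then obtain ct where ct: "\<And>k. second_moment (noise (R *\<^sub>v t\<^sub>2) k) \<le> ct * real (Suc k) powr (s - 1)"
      using noise_upper by blast
    obtain c where c: "\<And>n. expectation (\<lambda>\<omega>. (C n \<omega> \<bullet> t\<^sub>2)\<^sup>2) \<le> c * real (Suc n) powr (2 * \<eta>)"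
      using eigenvector_second_moment[OF t2c chain(1) \<theta>1(3) \<eta>(1,3,4) ct] by blast
    have Et2: "mean_abs t\<^sub>2 k \<le> (c + 1) * real (Suc k) powr \<eta>" for k
    proof -
      define a where "a = real (Suc k) powr \<eta>"
      have a: "a > 0" by (simp add: a_def)
      have a2: "a * a = real (Suc k) powr (2 * \<eta>)" by (simp add: a_def flip: powr_add)
      have i2: "integrable M (\<lambda>\<omega>. (C k \<omega> \<bullet> t\<^sub>2)\<^sup>2)"
        by (rule integrable_square_bounded[OF _ C_prod_bounded[OF t2c]]) (use t2c in measurable)
      (* The modulus of t is at most t\<^sup>2 / a + a for every a > 0; the choice of a gives both terms the
         same order. *)
      have "mean_abs t\<^sub>2 k \<le> expectation (\<lambda>\<omega>. (C k \<omega> \<bullet> t\<^sub>2)\<^sup>2 / a + a)"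
      proof (rule integral_mono)
        show "integrable M (\<lambda>\<omega>. \<bar>C k \<omega> \<bullet> t\<^sub>2\<bar>)" using C_prod_integrable[OF t2c] by simp
        show "integrable M (\<lambda>\<omega>. (C k \<omega> \<bullet> t\<^sub>2)\<^sup>2 / a + a)" using i2 by simp
        fix \<omega>
        have "0 \<le> (\<bar>C k \<omega> \<bullet> t\<^sub>2\<bar> - a)\<^sup>2" by simp
        also have "\<dots> = (C k \<omega> \<bullet> t\<^sub>2)\<^sup>2 - 2 * (a * \<bar>C k \<omega> \<bullet> t\<^sub>2\<bar>) + a\<^sup>2" by (simp add: power2_diff)
        finally have "a * \<bar>C k \<omega> \<bullet> t\<^sub>2\<bar> \<le> (C k \<omega> \<bullet> t\<^sub>2)\<^sup>2 + a\<^sup>2"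
          using mult_nonneg_nonneg[of a "\<bar>C k \<omega> \<bullet> t\<^sub>2\<bar>"] a by linarith
        then show "\<bar>C k \<omega> \<bullet> t\<^sub>2\<bar> \<le> (C k \<omega> \<bullet> t\<^sub>2)\<^sup>2 / a + a"
          using a by (simp add: field_simps power2_eq_square)
      qed
      also have "\<dots> = expectation (\<lambda>\<omega>. (C k \<omega> \<bullet> t\<^sub>2)\<^sup>2) / a + a" using i2 by (simp add: prob_space)
      also have "\<dots> \<le> c * (a * a) / a + a"
        using c[of k] a unfolding a2 by (intro add_mono divide_right_mono) auto
      also have "\<dots> = (c + 1) * a" using a by (simp add: algebra_simps)
      finally show ?thesis by (simp add: a_def)
    qed
    define r where "r = R *\<^sub>v t\<^sub>3"
    have rc: "r \<in> carrier_vec 4" and r: "r = \<beta> \<cdot>\<^sub>v t\<^sub>3 + t\<^sub>2"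
      unfolding r_def chain(2) using t\<^sub>3 t2c by auto
    define v where "v = \<beta>\<^sup>2 * (\<pi>\<^sub>P \<bullet> map_vec (\<lambda>x. x\<^sup>2) \<nu>)"
    have \<beta>1: "\<beta> \<noteq> 1" using less by simp
    note \<nu>2 = stationary_square_moment[OF Pc \<pi>\<^sub>P \<nu>c P\<nu> \<beta>1]
    have v: "v \<ge> 0" using \<nu>2(2) by (simp add: v_def)
    (* On the lower half r\<^sup>2 = \<beta>\<^sup>2 \<nu>\<^sup>2 is the combination b t\<^sub>3 + v t\<^sub>4, by the quadratic relation
       satisfied by both coordinates of \<nu>. The rest u lives on white and black, so that only
       negligible functionals are left besides the constant v. *)
    define b where "b = \<beta>\<^sup>2 * (\<nu> $ 0 + \<nu> $ 1)"
    define u where "u = square_vec r - b \<cdot>\<^sub>v t\<^sub>3 - v \<cdot>\<^sub>v t\<^sub>4"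
    have uc: "u \<in> carrier_vec 4" using rc t\<^sub>3 t4c by (simp add: u_def)
    have t4e: "t\<^sub>4 $ i = 1" if "i < 4" for i
      using that unfolding less4 by (elim disjE) (simp_all add: t\<^sub>4 vec_of_list_index numeral_eq_Suc)
    have u0: "u $ 2 = 0" "u $ 3 = 0"
    proof -
      have "r $ 2 = \<beta> * \<nu> $ 0" "r $ 3 = \<beta> * \<nu> $ 1" unfolding r \<nu>e using t\<^sub>3 t2c upper by simp_all
      then show "u $ 2 = 0" "u $ 3 = 0"
        unfolding u_def b_def v_def \<nu>2(1) using rc t\<^sub>3 t4c t4e
        by (simp_all add: \<nu>e \<nu>e[unfolded One_nat_def] power2_eq_square algebra_simps)
    qed
    let ?dev = "\<lambda>n \<omega>. C n \<omega> \<bullet> square_vec r / real (Suc n) - (C n \<omega> \<bullet> r / real (Suc n))\<^sup>2 - v"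
    let ?bound = "\<lambda>n \<omega>. (\<bar>b\<bar> + coord_bound r * \<bar>\<beta>\<bar>) * (\<bar>C n \<omega> \<bullet> t\<^sub>3\<bar> / real (Suc n))
        + coord_bound u * (C n \<omega> \<bullet> v\<^sub>1 / real (Suc n))
        + coord_bound r * (\<bar>C n \<omega> \<bullet> t\<^sub>2\<bar> / real (Suc n))"
    have pointwise: "\<bar>?dev n \<omega>\<bar>
      \<le> ?bound n \<omega>" if \<omega>: "\<omega> \<in> space M" for n \<omega>
    proof -
      let ?N = "real (Suc n)"
      have Cc: "C n \<omega> \<in> carrier_vec 4" by (rule C_carrier[OF \<omega>])
      have "square_vec r = u + b \<cdot>\<^sub>v t\<^sub>3 + v \<cdot>\<^sub>v t\<^sub>4"
        unfolding u_def using rc t\<^sub>3 t4c by (intro eq_vecI) auto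
      then have "C n \<omega> \<bullet> square_vec r = C n \<omega> \<bullet> u + b * (C n \<omega> \<bullet> t\<^sub>3) + v * (C n \<omega> \<bullet> t\<^sub>4)"
        using Cc uc t\<^sub>3 t4c by (simp add: scalar_prod_add_distrib[of _ 4])
      moreover have "C n \<omega> \<bullet> t\<^sub>4 = ?N"
        unfolding C_prod[OF t4c] using C_total[OF \<omega>, of n] t4e by simp
      ultimately have sq: "C n \<omega> \<bullet> square_vec r / ?N - v =
          C n \<omega> \<bullet> u / ?N + b * (C n \<omega> \<bullet> t\<^sub>3 / ?N)"
        by (simp add: add_divide_distrib del: of_nat_Suc)
      have "\<bar>C n \<omega> \<bullet> u\<bar> \<le> C n \<omega> \<bullet> (coord_bound u \<cdot>\<^sub>v v\<^sub>1)"
      proof (intro C_prod_le uc \<omega>)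
        show "coord_bound u \<cdot>\<^sub>v v\<^sub>1 \<in> carrier_vec 4" using v1c by simp
        fix i :: nat assume i: "i < 4"
        have "\<bar>u $ i\<bar> \<le> coord_bound u" by (rule coord_bound[OF i])
        moreover have "coord_bound u \<ge> 0" using order_trans[OF abs_ge_zero calculation] .
        moreover have "(coord_bound u \<cdot>\<^sub>v v\<^sub>1) $ i = coord_bound u * v\<^sub>1 $ i" using v1c i by simp
        ultimately show "\<bar>u $ i\<bar> \<le> (coord_bound u \<cdot>\<^sub>v v\<^sub>1) $ i"
          using i u0 v1e unfolding less4 by (elim disjE) simp_all
      qed
      then have "\<bar>C n \<omega> \<bullet> u\<bar> \<le> coord_bound u * (C n \<omega> \<bullet> v\<^sub>1)" using Cc v1c by simp
      then have U1: "\<bar>C n \<omega> \<bullet> u / ?N\<bar> \<le> coord_bound u * (C n \<omega> \<bullet> v\<^sub>1 / ?N)"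
        by (simp add: abs_divide divide_right_mono del: of_nat_Suc)
      have U2: "\<bar>b * (C n \<omega> \<bullet> t\<^sub>3 / ?N)\<bar> = \<bar>b\<bar> * (\<bar>C n \<omega> \<bullet> t\<^sub>3\<bar> / ?N)"
        by (simp add: abs_mult abs_divide del: of_nat_Suc)
      have "C n \<omega> \<bullet> r = \<beta> * (C n \<omega> \<bullet> t\<^sub>3) + C n \<omega> \<bullet> t\<^sub>2"
        unfolding r using Cc t\<^sub>3 t2c by (simp add: scalar_prod_add_distrib[of _ 4])
      then have "\<bar>C n \<omega> \<bullet> r\<bar> \<le> \<bar>\<beta>\<bar> * \<bar>C n \<omega> \<bullet> t\<^sub>3\<bar> + \<bar>C n \<omega> \<bullet> t\<^sub>2\<bar>"
        using abs_triangle_ineq[of "\<beta> * (C n \<omega> \<bullet> t\<^sub>3)" "C n \<omega> \<bullet> t\<^sub>2"] by (simp only: abs_mult)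
      then have "\<bar>C n \<omega> \<bullet> r\<bar> / ?N \<le> (\<bar>\<beta>\<bar> * \<bar>C n \<omega> \<bullet> t\<^sub>3\<bar> + \<bar>C n \<omega> \<bullet> t\<^sub>2\<bar>) / ?N"
        by (rule divide_right_mono) simp
      then have "\<bar>C n \<omega> \<bullet> r / ?N\<bar> \<le> \<bar>\<beta>\<bar> * (\<bar>C n \<omega> \<bullet> t\<^sub>3\<bar> / ?N) + \<bar>C n \<omega> \<bullet> t\<^sub>2\<bar> / ?N"
        by (simp only: abs_divide abs_of_nat add_divide_distrib times_divide_eq_right)
      from abs_mult_le[OF proportion_bounded[OF rc \<omega>, of n] this]
      have U3: "\<bar>(C n \<omega> \<bullet> r / ?N)\<^sup>2\<bar> \<le> coord_bound r * (\<bar>\<beta>\<bar> * (\<bar>C n \<omega> \<bullet> t\<^sub>3\<bar> / ?N) + \<bar>C n \<omega> \<bullet> t\<^sub>2\<bar> / ?N)"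
        by (simp only: power2_eq_square)
      have triangle: "\<bar>p - q - v\<bar> \<le> y' + x' + q'"
        if "p - v = x + y" "\<bar>x\<bar> \<le> x'" "\<bar>y\<bar> = y'" "\<bar>q\<bar> \<le> q'" for p q x y x' y' q' :: real
        using that by linarith
      show ?thesis
        using triangle[OF sq U1 U2 U3] by (simp only: distrib_left distrib_right mult.assoc add_ac)
    qed
    define X where "X n = (\<bar>b\<bar> + coord_bound r * \<bar>\<beta>\<bar>) * (mean_abs t\<^sub>3 n / real (Suc n))
        + coord_bound u * (expectation (\<lambda>\<omega>. C n \<omega> \<bullet> v\<^sub>1) / real (Suc n))
        + coord_bound r * (mean_abs t\<^sub>2 n / real (Suc n))" for n
    have le: "expectation (\<lambda>\<omega>. \<bar>?dev n \<omega>\<bar>) \<le> X n" for n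
    proof -
      have "expectation (\<lambda>\<omega>. \<bar>?dev n \<omega>\<bar>)
        \<le> expectation (\<lambda>\<omega>. ?bound n \<omega>)"
        using C_prod_integrable[OF t\<^sub>3, of n] C_prod_integrable[OF t2c, of n] C_prod_integrable[OF v1c, of n]
        by (intro integral_mono' pointwise order_trans[OF abs_ge_zero pointwise]) (simp_all del: of_nat_Suc)
      also have "\<dots> = X n"
        unfolding X_def using C_prod_integrable[OF t\<^sub>3, of n] C_prod_integrable[OF t2c, of n] C_prod_integrable[OF v1c, of n]
        by (simp del: of_nat_Suc)
      finally show ?thesis .
    qed
    note ctx = t\<^sub>3 t2c chain(2) \<theta>1(3) less \<eta>(1,2) Et2
    have l3: "(\<lambda>n. mean_abs t\<^sub>3 n / real (Suc n)) \<longlonglongrightarrow> 0"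
      by (rule jordan_chain_mean_tendsto_0[OF ctx])
    have l2: "(\<lambda>n. mean_abs t\<^sub>2 n / real (Suc n)) \<longlonglongrightarrow> 0"
    proof (rule tendsto_sandwich[OF _ _ tendsto_const])
      show "(\<lambda>n. (c + 1) * real (Suc n) powr \<eta> / real (Suc n)) \<longlonglongrightarrow> 0" using \<eta> by real_asymp
    qed (auto intro!: always_eventually divide_right_mono Et2 divide_nonneg_nonneg simp del: of_nat_Suc)
    have l1: "(\<lambda>n. expectation (\<lambda>\<omega>. C n \<omega> \<bullet> v\<^sub>1) / real (Suc n)) \<longlonglongrightarrow> 0"
    proof -
      obtain c1 where c1: "\<And>k. expectation (\<lambda>\<omega>. C k \<omega> \<bullet> v\<^sub>1) \<le> c1 * real (Suc k) powr s"
        using expectation_dominating_le[OF v1c Rv1 s(1)] by blast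
      have nn: "expectation (\<lambda>\<omega>. C k \<omega> \<bullet> v\<^sub>1) \<ge> 0" for k
        unfolding C_prod[OF v1c] using C_nonneg v1e
        by (intro Bochner_Integration.integral_nonneg sum_nonneg mult_nonneg_nonneg) (auto simp: less4)
      show ?thesis
      proof (rule tendsto_sandwich[OF _ _ tendsto_const])
        show "(\<lambda>n. c1 * real (Suc n) powr s / real (Suc n)) \<longlonglongrightarrow> 0" using s by real_asymp
      qed (auto intro!: always_eventually divide_right_mono c1 divide_nonneg_nonneg nn simp del: of_nat_Suc)
    qed
    have "X \<longlonglongrightarrow> (\<bar>b\<bar> + coord_bound r * \<bar>\<beta>\<bar>) * 0 + coord_bound u * 0 + coord_bound r * 0"
      unfolding X_def by (intro tendsto_intros l1 l2 l3)
    then have X0: "X \<longlonglongrightarrow> 0" by simp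
    have "(\<lambda>n. expectation (\<lambda>\<omega>. \<bar>?dev n \<omega>\<bar>)) \<longlonglongrightarrow> 0"
      by (rule tendsto_sandwich[OF _ _ tendsto_const X0]) (auto simp del: of_nat_Suc intro!: always_eventually le)
    from jordan_chain_weak_convergence[OF ctx v this[unfolded r_def]]
    show ?thesis by (simp add: v_def)
  qed
  show ?thesis
    using ev1 ev2 \<beta> ev\<nu> i lam U' V' ii by (intro conjI exI[of _ "\<lambda>\<omega>. gs * U \<omega>"] exI[of _ "\<lambda>\<omega>. gl * V \<omega>"]) auto
qed

end
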